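(* Let $A$ be a self-adjoint operator on a Hilbert space $\mathfrak{H}$ such that $$\operatorname{spec}(A)=\sigma_-\cup\sigma_+\quad\text{and}\quad \sup\sigma_-<\inf\sigma_+ .$$ Suppose that a symmetric operator $V$ on $\mathfrak{H}$ with $\operatorname{Dom}(V)\supset\operatorname{Dom}(A)$ is off-diagonal with respect to the decomposition $\mathfrak{H}=\operatorname{Ran}\mathsf{E}_A(\sigma_-)\oplus\operatorname{Ran}\mathsf{E}_A(\sigma_+)$, and that the closure $L=\overline{A+V}$ of the sum $A+V$ with $\operatorname{Dom}(A+V)=\operatorname{Dom}(A)$ is a self-adjoint operator. Then the spectrum of $L$ consists of two subordinated components $\sigma'_-$ and $\sigma'_+$ (that is, $\operatorname{spec}(L)=\sigma'_-\cup\sigma'_+$ with $\sup\sigma'_-<\inf\sigma'_+$) such that $$\sigma'_-\subset(-\infty,\sup\sigma_-],\qquad \sigma'_+\subset[\inf\sigma_+,+\infty),$$ and the following inequality holds: $$\|\mathsf{E}_L(\sigma'_-)-\mathsf{E}_A(\sigma_-)\|\le\sin\left(\tfrac12\arctan\varkappa\right),$$ where $$\varkappa=\inf_{\sup\sigma_-<\mu<\inf\sigma_+}\ \sup_{\substack{x\in\operatorname{Dom}(A)\\ \|x\|=1}}\frac{|\langle x,JVx\rangle|}{\langle x,|A-\mu|x\rangle},\qquad J=\mathsf{E}_A(\sigma_+)-\mathsf{E}_A(\sigma_-).$$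
   Context: $\mathsf{E}_A(\delta)$ denotes the spectral projection of a self-adjoint operator $A$ associated with a Borel set $\delta\subset\mathbb{R}$. The convention $\arctan(+\infty)=\pi/2$ is adopted ($\varkappa=+\infty$ is allowed). Given an orthogonal decomposition $\mathfrak{H}=\mathfrak{H}_-\oplus\mathfrak{H}_+$ with $P^\pm$ the orthogonal projections onto $\mathfrak{H}_\pm$, a linear operator $V$ on $\mathfrak{H}$ is off-diagonal with respect to this decomposition if $\mathfrak{H}_-\cap\operatorname{Dom}(V)=P^-(\operatorname{Dom}(V))$, $\mathfrak{H}_+\cap\operatorname{Dom}(V)=P^+(\operatorname{Dom}(V))$, $V$ maps $\mathfrak{H}_-\cap\operatorname{Dom}(V)$ into $\mathfrak{H}_+$, and $V$ maps $\mathfrak{H}_+\cap\operatorname{Dom}(V)$ into $\mathfrak{H}_-$. *)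

theory Defs
  imports "HOL-Analysis.Analysis"
begin

section \<open>Complex Hilbert spaces\<close>

text \<open>
  The norm, the metric and the real inner product are those of the class \<open>real_inner\<close>; the complex
  inner product (antilinear in the first argument) has the real one as its real part, so that
  positive definiteness and \<open>norm x = sqrt (Re (cinner x x))\<close> are inherited.
\<close>

class complex_hilbert_space = real_inner + complete_space +
  fixes scaleC :: "complex \<Rightarrow> 'a \<Rightarrow> 'a" (infixr "*\<^sub>C" 75)
    and cinner :: "'a \<Rightarrow> 'a \<Rightarrow> complex"
  assumes scaleC_add_right: "c *\<^sub>C (x + y) = c *\<^sub>C x + c *\<^sub>C y"
    and scaleC_add_left: "(c + d) *\<^sub>C x = c *\<^sub>C x + d *\<^sub>C x"
    and scaleC_scaleC: "c *\<^sub>C d *\<^sub>C x = (c * d) *\<^sub>C x"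
    and scaleC_of_real: "complex_of_real r *\<^sub>C x = r *\<^sub>R x"
    and cinner_commute: "cinner x y = cnj (cinner y x)"
    and cinner_add_right: "cinner x (y + z) = cinner x y + cinner x z"
    and cinner_scaleC_right: "cinner x (c *\<^sub>C y) = c * cinner x y"
    and Re_cinner: "Re (cinner x y) = inner x y"


section \<open>Unbounded operators\<close>

text \<open>
  An operator is identified with its graph. Hence \<open>Domain T\<close> is its domain, set inclusion is
  extension of operators, and the closure of a closable operator is the topological closure of its
  graph in the product space.
\<close>

type_synonym 'h operator = "('h \<times> 'h) set"

definition linear_operator :: "'h::complex_hilbert_space operator \<Rightarrow> bool" where
  "linear_operator T \<longleftrightarrow>
     (0, 0) \<in> T \<and>
     (\<forall>x y x' y'. (x, y) \<in> T \<longrightarrow> (x', y') \<in> T \<longrightarrow> (x + x', y + y') \<in> T) \<and>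
     (\<forall>c x y. (x, y) \<in> T \<longrightarrow> (c *\<^sub>C x, c *\<^sub>C y) \<in> T) \<and>
     single_valued T"

definition app :: "'h operator \<Rightarrow> 'h \<Rightarrow> 'h" where
  "app T x = (THE y. (x, y) \<in> T)"

definition op_add :: "'h::complex_hilbert_space operator \<Rightarrow> 'h operator \<Rightarrow> 'h operator" where
  "op_add S T = {(x, y + z) | x y z. (x, y) \<in> S \<and> (x, z) \<in> T}"

text \<open>This is the graph of an operator only for densely defined \<open>T\<close>.\<close>

definition op_adjoint :: "'h::complex_hilbert_space operator \<Rightarrow> 'h operator" where
  "op_adjoint T = {(x, y). \<forall>u v. (u, v) \<in> T \<longrightarrow> cinner v x = cinner u y}"

definition densely_defined :: "'h::complex_hilbert_space operator \<Rightarrow> bool" where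
  "densely_defined T \<longleftrightarrow> closure (Domain T) = UNIV"

definition symmetric :: "'h::complex_hilbert_space operator \<Rightarrow> bool" where
  "symmetric T \<longleftrightarrow> linear_operator T \<and> densely_defined T \<and> T \<subseteq> op_adjoint T"

definition self_adjoint :: "'h::complex_hilbert_space operator \<Rightarrow> bool" where
  "self_adjoint T \<longleftrightarrow> linear_operator T \<and> densely_defined T \<and> op_adjoint T = T"

text \<open>\<open>R\<close> is the everywhere defined bounded inverse of \<open>T - z\<close>.\<close>

definition resolvent_set :: "'h::complex_hilbert_space operator \<Rightarrow> complex set" where
  "resolvent_set T = {z. \<exists>R. bounded_linear R \<and>
     (\<forall>x y. (x, y) \<in> T \<longrightarrow> R (y - z *\<^sub>C x) = x) \<and>
     (\<forall>y. (R y, y + z *\<^sub>C R y) \<in> T)}"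

definition spectrum :: "'h::complex_hilbert_space operator \<Rightarrow> complex set" where
  "spectrum T = - resolvent_set T"


section \<open>Spectral measures and functional calculus\<close>

definition orthogonal_projection :: "('h::complex_hilbert_space \<Rightarrow> 'h) \<Rightarrow> bool" where
  "orthogonal_projection P \<longleftrightarrow>
     (\<forall>x y. P (x + y) = P x + P y) \<and> (\<forall>c x. P (c *\<^sub>C x) = c *\<^sub>C P x) \<and>
     (\<forall>x. P (P x) = P x) \<and> (\<forall>x y. cinner (P x) y = cinner x (P y))"

text \<open>Countable additivity is required in the strong operator topology.\<close>

definition projection_valued_measure ::
    "(real set \<Rightarrow> 'h::complex_hilbert_space \<Rightarrow> 'h) \<Rightarrow> bool" where
  "projection_valued_measure E \<longleftrightarrow>
     (\<forall>\<delta>\<in>sets borel. orthogonal_projection (E \<delta>)) \<and>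
     E UNIV = id \<and>
     (\<forall>D. range D \<subseteq> sets borel \<longrightarrow> disjoint_family D \<longrightarrow>
        (\<forall>x. (\<lambda>n::nat. E (D n) x) sums E (\<Union>n. D n) x))"

definition scalar_measure ::
    "(real set \<Rightarrow> 'h::complex_hilbert_space \<Rightarrow> 'h) \<Rightarrow> 'h \<Rightarrow> real measure" where
  "scalar_measure E x = measure_of UNIV (sets borel) (\<lambda>\<delta>. ennreal (Re (cinner x (E \<delta> x))))"

text \<open>
  \<open>T\<close> is the operator \<open>\<integral> f dE\<close> with its maximal domain. Since \<open>T\<close> is linear on the given dense
  domain, its quadratic form determines it by polarization.
\<close>

definition is_spectral_integral ::
    "(real set \<Rightarrow> 'h::complex_hilbert_space \<Rightarrow> 'h) \<Rightarrow> (real \<Rightarrow> real) \<Rightarrow> 'h operator \<Rightarrow> bool" where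
  "is_spectral_integral E f T \<longleftrightarrow>
     linear_operator T \<and>
     Domain T = {x. integrable (scalar_measure E x) (\<lambda>t. (f t)\<^sup>2)} \<and>
     (\<forall>x y. (x, y) \<in> T \<longrightarrow> cinner x y = complex_of_real (\<integral>t. f t \<partial>scalar_measure E x))"

text \<open>
  For self-adjoint \<open>A\<close>, a spectral measure exists and its values on Borel sets are unique
  by the spectral theorem; the choice operator only affects the values on other sets.
\<close>

definition spectral_projection ::
    "'h::complex_hilbert_space operator \<Rightarrow> real set \<Rightarrow> 'h \<Rightarrow> 'h" where
  "spectral_projection A =
     (SOME E. projection_valued_measure E \<and> is_spectral_integral E (\<lambda>t. t) A)"

definition functional_calculus ::
    "'h::complex_hilbert_space operator \<Rightarrow> (real \<Rightarrow> real) \<Rightarrow> 'h operator" where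
  "functional_calculus A f = (SOME T. is_spectral_integral (spectral_projection A) f T)"

text \<open>\<open>abs_shift A \<mu>\<close> is the absolute value \<open>|A - \<mu>|\<close>.\<close>

definition abs_shift :: "'h::complex_hilbert_space operator \<Rightarrow> real \<Rightarrow> 'h operator" where
  "abs_shift A \<mu> = functional_calculus A (\<lambda>t. \<bar>t - \<mu>\<bar>)"


section \<open>Off-diagonal perturbations\<close>

text \<open>
  The decomposition of the space is given by the two orthogonal projections, so that the subspaces
  are \<open>range Pm\<close> and \<open>range Pp\<close>.
\<close>

definition off_diagonal ::
    "('h::complex_hilbert_space \<Rightarrow> 'h) \<Rightarrow> ('h \<Rightarrow> 'h) \<Rightarrow> 'h operator \<Rightarrow> bool" where
  "off_diagonal Pm Pp V \<longleftrightarrow>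
     range Pm \<inter> Domain V = Pm ` Domain V \<and>
     range Pp \<inter> Domain V = Pp ` Domain V \<and>
     (\<forall>x y. (x, y) \<in> V \<longrightarrow> x \<in> range Pm \<longrightarrow> y \<in> range Pp) \<and>
     (\<forall>x y. (x, y) \<in> V \<longrightarrow> x \<in> range Pp \<longrightarrow> y \<in> range Pm)"

text \<open>Suprema and infima of sets of reals are taken in the extended reals.\<close>

definition esup :: "real set \<Rightarrow> ereal" where
  "esup S = (SUP s\<in>S. ereal s)"

definition einf :: "real set \<Rightarrow> ereal" where
  "einf S = (INF s\<in>S. ereal s)"

definition sign_operator ::
    "'h::complex_hilbert_space operator \<Rightarrow> real set \<Rightarrow> real set \<Rightarrow> 'h \<Rightarrow> 'h" where
  "sign_operator A \<sigma>m \<sigma>p x = spectral_projection A \<sigma>p x - spectral_projection A \<sigma>m x"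

text \<open>
  The quotients are nonnegative, and \<open>\<infinity>\<close> is an admissible value of the supremum and of the infimum.
  For \<open>\<mu>\<close> in the gap the denominators are real and positive.
\<close>

definition kappa ::
    "'h::complex_hilbert_space operator \<Rightarrow> 'h operator \<Rightarrow> real set \<Rightarrow> real set \<Rightarrow> ennreal" where
  "kappa A V \<sigma>m \<sigma>p =
     (INF \<mu>\<in>{\<mu>::real. esup \<sigma>m < ereal \<mu> \<and> ereal \<mu> < einf \<sigma>p}.
        SUP x\<in>{x \<in> Domain A. norm x = 1}.
          ennreal (cmod (cinner x (sign_operator A \<sigma>m \<sigma>p (app V x)))
                   / Re (cinner x (app (abs_shift A \<mu>) x))))"

definition arctan_ext :: "ennreal \<Rightarrow> real" where
  "arctan_ext k = (if k = \<infinity> then pi / 2 else arctan (enn2real k))"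

end

theory Submission
  imports Defs
begin

text \<open>
  Put \<open>J = E\<^sub>A(\<sigma>\<^sub>+) - E\<^sub>A(\<sigma>\<^sub>-)\<close> and let \<open>\<mu>\<close> lie in the gap of \<open>A\<close>. Since \<open>J (A - \<mu>) = \<bar>A - \<mu>\<bar>\<close> and the
  form of \<open>J V\<close> is purely imaginary for off-diagonal \<open>V\<close>, the values \<open>\<langle>x, J (A + V - \<mu>) x\<rangle>\<close> have real part
  \<open>\<langle>x, \<bar>A - \<mu>\<bar> x\<rangle> \<ge> d \<parallel>x\<parallel>\<^sup>2\<close>, where \<open>d > 0\<close> separates \<open>\<mu>\<close> from the edges of the gap, and lie in the sector
  \<open>\<bar>Im w\<bar> \<le> k Re w\<close>, where \<open>k\<close> is the supremum of the quotients for this \<open>\<mu>\<close>. Both facts pass to the closure \<open>L\<close>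
  (\<open>L_form_lower\<close>, \<open>L_sector\<close>). The first one gives \<open>\<parallel>(L - \<mu>) x\<parallel> \<ge> d \<parallel>x\<parallel>\<close>, hence the gap of \<open>A\<close> is free of
  spectrum of \<open>L\<close>, and its two sides cut the spectrum of \<open>L\<close> into \<open>\<sigma>'\<^sub>-\<close> and \<open>\<sigma>'\<^sub>+\<close>.

  For the angle put \<open>Q = E\<^sub>L(\<sigma>'\<^sub>+) - E\<^sub>L(\<sigma>'\<^sub>-)\<close>, so that \<open>L - \<mu> = Q \<bar>L - \<mu>\<bar>\<close>. With \<open>U = J Q\<close>, which is unitary, the
  operator \<open>J (L - \<mu>) = U \<bar>L - \<mu>\<bar>\<close> has its numerical range in the sector of half-angle \<open>\<theta> = arctan k\<close>. In finite
  dimensions an eigenvector of \<open>U\<close> shows at once that the spectrum of \<open>U\<close> lies in the same sector, and therefore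
  that \<open>Re U \<ge> cos \<theta>\<close>. Approximate eigenvectors cannot replace eigenvectors when \<open>\<bar>L - \<mu>\<bar>\<close> is unbounded, because the
  form of \<open>R = \<bar>L - \<mu>\<bar>\<^sup>-\<^sup>1\<close> may tend to zero along them. Instead, if \<open>Re \<langle>R y, B y\<rangle> \<ge> 0\<close> for a unitary \<open>B\<close>, then
  the discretized flow \<open>(1 + s B)\<^sup>n\<close> never decreases the form of \<open>R\<close>, whereas on the spectral subspace where
  \<open>Re B \<le> - s\<close> it tends to zero in norm; so this subspace is trivial (\<open>unitary_accretive_if_form_accretive\<close>). Applied to the multiples of
  \<open>U\<close> by the unit vectors \<open>\<alpha>\<close> and \<open>\<alpha>\<^sup>*\<close> orthogonal to the edges of the sector this yields \<open>Re U \<ge> cos \<theta>\<close>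
  (\<open>symmetry_product_sector\<close>). Finally \<open>\<parallel>J y - Q y\<parallel>\<^sup>2 = 2 \<parallel>y\<parallel>\<^sup>2 - 2 Re \<langle>y, U y\<rangle> \<le> 4 sin\<^sup>2 (\<theta>/2) \<parallel>y\<parallel>\<^sup>2\<close>, and the
  difference of the spectral projections is \<open>(J - Q) / 2\<close>. Taking the infimum over \<open>\<mu>\<close> is a matter of continuity.

  All of this presupposes the spectral theorem for unbounded self-adjoint operators, which makes up the larger part of
  the text. A bounded symmetric \<open>B\<close> is split into a negative and a positive part by means of \<open>\<bar>B\<bar> = \<surd>(B\<^sup>2)\<close>
  (\<open>negative_projector_exists\<close>). Applied to \<open>(T - l) ((T - l)\<^sup>2 + 1)\<^sup>-\<^sup>1\<close> for each real \<open>l\<close> this produces the spectral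
  family of \<open>T\<close> (\<open>spectral_family_exists\<close>). The Stieltjes measures of the functions \<open>l \<mapsto> \<parallel>E\<^sub>l x\<parallel>\<^sup>2\<close> extend it to
  Borel sets by a Dynkin argument (\<open>spectral_measure_exists\<close>), and \<open>T\<close> is recovered as the integral of the identity
  (\<open>spectral_theorem\<close>). The projections that occur in the statement are defined by choosing a projection-valued measure that
  represents \<open>T\<close>; that they reduce \<open>T\<close> and live on the spectrum is derived from this representation alone
  (\<open>graph_invariant_spectral\<close>, \<open>spectral_projection_real_resolvent\<close>).
\<close>

section \<open>Bounded operators on a real Hilbert space\<close>

text \<open>
  Much of the bounded theory is insensitive to the scalars and is developed over the reals. Complex linearity comes back
  as the property of commuting with multiplication by \<open>\<i>\<close>.
\<close>

text \<open>Exponent \<open>1\<close> transfers the Cauchy property along a Lipschitz estimate; exponent \<open>2\<close> is for norms whose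
  squares are increments of a convergent real sequence.\<close>

lemma Cauchy_if_power_dist_le:
  fixes f :: "nat \<Rightarrow> 'a::metric_space" and g :: "nat \<Rightarrow> 'b::metric_space"
  assumes g: "Cauchy g" and le: "\<And>m n. m \<le> n \<Longrightarrow> dist (f m) (f n) ^ p \<le> K * dist (g m) (g n)"
  shows "Cauchy f"
proof (rule metric_CauchyI)
  fix e :: real assume e: "e > 0"
  then have "e ^ p / (\<bar>K\<bar> + 1) > 0" by simp
  from metric_CauchyD[OF g this] obtain N where
    N: "\<And>m n. m \<ge> N \<Longrightarrow> n \<ge> N \<Longrightarrow> dist (g m) (g n) < e ^ p / (\<bar>K\<bar> + 1)" by blast
  have less: "dist (f m) (f n) < e" if "N \<le> m" "m \<le> n" for m n
  proof -
    have "dist (f m) (f n) ^ p \<le> (\<bar>K\<bar> + 1) * dist (g m) (g n)"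
      by (rule order_trans[OF le[OF that(2)]]) (intro mult_right_mono, auto)
    also have "\<dots> < e ^ p" using N[of m n] that by (simp add: pos_less_divide_eq mult.commute)
    finally show ?thesis by (rule power_less_imp_less_base) (use e in simp)
  qed
  have "dist (f m) (f n) < e" if "N \<le> m" "N \<le> n" for m n
    using less[of m n] less[of n m] that by (cases "m \<le> n") (auto simp: dist_commute)
  then show "\<exists>N. \<forall>m\<ge>N. \<forall>n\<ge>N. dist (f m) (f n) < e" by blast
qed

lemma nearest_point_exists:
  fixes M :: "'a::{real_inner,complete_space} set"
  assumes "closed M" and "subspace M"
  shows "\<exists>p\<in>M. \<forall>m\<in>M. norm (x - p) \<le> norm (x - m)"
proof -
  define d where "d = (INF m\<in>M. (norm (x - m))\<^sup>2)"
  have M0: "0 \<in> M" using assms(2) by (simp add: subspace_0)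
  have bdd: "bdd_below ((\<lambda>m. (norm (x - m))\<^sup>2) ` M)"
    by (rule bdd_belowI[of _ 0]) auto
  have d_le: "d \<le> (norm (x - m))\<^sup>2" if "m \<in> M" for m
    unfolding d_def by (rule cINF_lower[OF bdd that])
  have "\<exists>m\<in>M. (norm (x - m))\<^sup>2 < d + inverse (real (Suc n))" for n
  proof (rule ccontr)
    assume "\<not> ?thesis"
    then have "d + inverse (real (Suc n)) \<le> d"
      unfolding d_def using M0 by (intro cINF_greatest) (auto simp: not_less d_def)
    then show False using positive_imp_inverse_positive[of "real (Suc n)"] by linarith
  qed
  then obtain m where m: "\<And>n. m n \<in> M" "\<And>n. (norm (x - m n))\<^sup>2 < d + inverse (real (Suc n))"
    by metis
  \<comment> \<open>The parallelogram identity bounds the distance of two almost nearest points.\<close>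
  have near: "(dist (m i) (m j))\<^sup>2 \<le> 2 * inverse (real (Suc i)) + 2 * inverse (real (Suc j))" for i j
  proof -
    have mid: "(1/2) *\<^sub>R (m i + m j) \<in> M"
      using m(1) assms(2) by (simp add: subspace_add subspace_scale)
    have "(dist (m i) (m j))\<^sup>2 + 4 * (norm (x - (1/2) *\<^sub>R (m i + m j)))\<^sup>2
        = 2 * (norm (x - m i))\<^sup>2 + 2 * (norm (x - m j))\<^sup>2"
      by (simp add: dist_norm power2_norm_eq_inner inner_diff_left inner_diff_right
          inner_add_left inner_add_right inner_commute algebra_simps)
    then show ?thesis using d_le[OF mid] m(2)[of i] m(2)[of j] by linarith
  qed
  have "Cauchy m"
  proof (rule metric_CauchyI)
    fix e :: real assume "e > 0"
    then obtain k where k: "inverse (real (Suc k)) < e\<^sup>2 / 4"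
      using reals_Archimedean[of "e\<^sup>2/4"] by auto
    show "\<exists>K. \<forall>i\<ge>K. \<forall>j\<ge>K. dist (m i) (m j) < e"
    proof (intro exI allI impI)
      fix i j assume ij: "k \<le> i" "k \<le> j"
      have "inverse (real (Suc i)) \<le> inverse (real (Suc k))" "inverse (real (Suc j)) \<le> inverse (real (Suc k))"
        using ij by (auto simp: field_simps)
      then have "(dist (m i) (m j))\<^sup>2 < e\<^sup>2" using near[of i j] k by linarith
      then show "dist (m i) (m j) < e" using \<open>e > 0\<close> by (simp add: power_less_imp_less_base)
    qed
  qed
  then obtain p where p: "m \<longlonglongrightarrow> p" using Cauchy_convergent convergent_def by blast
  have pM: "p \<in> M" using closed_sequentially[OF assms(1), of m p] m(1) p by auto
  have "(norm (x - p))\<^sup>2 \<le> d"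
  proof (rule LIMSEQ_le)
    show "(\<lambda>n. (norm (x - m n))\<^sup>2) \<longlonglongrightarrow> (norm (x - p))\<^sup>2" by (intro tendsto_intros p)
    show "(\<lambda>n. d + inverse (real (Suc n))) \<longlonglongrightarrow> d"
      using tendsto_add[OF tendsto_const[of d] LIMSEQ_inverse_real_of_nat] by simp
    show "\<exists>N. \<forall>n\<ge>N. (norm (x - m n))\<^sup>2 \<le> d + inverse (real (Suc n))" using m(2) less_imp_le by blast
  qed
  then have "norm (x - p) \<le> norm (x - q)" if "q \<in> M" for q
    using d_le[OF that] by (meson norm_ge_zero order_trans power2_le_imp_le)
  then show ?thesis using pM by auto
qed

lemma orthogonal_decomposition_exists:
  fixes M :: "'a::{real_inner,complete_space} set"
  assumes "closed M" and "subspace M"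
  shows "\<exists>p\<in>M. \<forall>m\<in>M. inner (x - p) m = 0"
proof -
  obtain p where p: "p \<in> M" "\<And>m. m \<in> M \<Longrightarrow> norm (x - p) \<le> norm (x - m)"
    using nearest_point_exists[OF assms] by blast
  have "inner (x - p) m = 0" if "m \<in> M" for m
  proof (cases "m = 0")
    case False
    define t where "t = inner (x - p) m / inner m m"
    have pos: "inner m m > 0" using False by simp
    have "p + t *\<^sub>R m \<in> M" using p(1) that assms(2) by (simp add: subspace_add subspace_scale)
    then have "(norm (x - p))\<^sup>2 \<le> (norm (x - (p + t *\<^sub>R m)))\<^sup>2" using p(2) by (simp add: power_mono)
    also have "\<dots> = (norm (x - p))\<^sup>2 - 2 * t * inner (x - p) m + t\<^sup>2 * inner m m"
      unfolding power2_norm_eq_inner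
      by (simp add: inner_diff_left inner_diff_right
          inner_add_left inner_add_right inner_commute algebra_simps power2_eq_square)
    also have "\<dots> = (norm (x - p))\<^sup>2 - (inner (x - p) m)\<^sup>2 / inner m m"
      using pos by (simp add: t_def power2_eq_square field_simps)
    finally have "(inner (x - p) m)\<^sup>2 / inner m m \<le> 0" by simp
    then show ?thesis using pos by (simp add: divide_le_0_iff)
  qed auto
  then show ?thesis using p(1) by auto
qed

text \<open>This is how an operator is shown to be onto: its range is closed and nothing is orthogonal to it.\<close>

lemma closed_subspace_UNIV:
  fixes M :: "'a::{real_inner,complete_space} set"
  assumes "closed M" and "subspace M" and "\<And>x. (\<And>m. m \<in> M \<Longrightarrow> inner x m = 0) \<Longrightarrow> x = 0"
  shows "M = UNIV"
proof -
  have "x \<in> M" for x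
  proof -
    obtain p where "p \<in> M" "\<forall>m\<in>M. inner (x - p) m = 0"
      using orthogonal_decomposition_exists[OF assms(1,2)] by blast
    then show ?thesis using assms(3)[of "x - p"] by auto
  qed
  then show ?thesis by auto
qed

subsection \<open>Symmetric, positive and projecting operators\<close>

definition symmetric_op :: "('a::real_inner \<Rightarrow> 'a) \<Rightarrow> bool" where
  "symmetric_op T \<longleftrightarrow> bounded_linear T \<and> (\<forall>x y. inner (T x) y = inner x (T y))"

definition positive_op :: "('a::real_inner \<Rightarrow> 'a) \<Rightarrow> bool" where
  "positive_op T \<longleftrightarrow> symmetric_op T \<and> (\<forall>x. 0 \<le> inner x (T x))"

definition projector :: "('a::real_inner \<Rightarrow> 'a) \<Rightarrow> bool" where
  "projector P \<longleftrightarrow> symmetric_op P \<and> (\<forall>x. P (P x) = P x)"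

definition commuting :: "('a \<Rightarrow> 'a) \<Rightarrow> ('a \<Rightarrow> 'a) \<Rightarrow> bool" where
  "commuting S T \<longleftrightarrow> (\<forall>x. S (T x) = T (S x))"

lemma commutingD: "commuting S T \<Longrightarrow> S (T x) = T (S x)"
  by (simp add: commuting_def)

lemma symmetric_opD:
  assumes "symmetric_op T"
  shows "bounded_linear T" "inner (T x) y = inner x (T y)"
    "T (x + y) = T x + T y" "T (x - y) = T x - T y" "T (r *\<^sub>R x) = r *\<^sub>R T x" "T 0 = 0" "T (- x) = - T x"
  using assms unfolding symmetric_op_def
  by (auto simp: bounded_linear.linear linear_add linear_diff linear_scale linear_0 linear_neg)

lemma positive_opD: "positive_op T \<Longrightarrow> symmetric_op T" "positive_op T \<Longrightarrow> 0 \<le> inner x (T x)"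
  by (auto simp: positive_op_def)

lemma projectorD: "projector P \<Longrightarrow> symmetric_op P" "projector P \<Longrightarrow> P (P x) = P x"
  by (auto simp: projector_def)

lemma projector_inner: "projector P \<Longrightarrow> inner x (P x) = (norm (P x))\<^sup>2"
  by (metis power2_norm_eq_inner projectorD symmetric_opD(2))

lemma projector_pythagoras: "projector P \<Longrightarrow> (norm x)\<^sup>2 = (norm (P x))\<^sup>2 + (norm (x - P x))\<^sup>2"
  using projector_inner[of P x]
  by (simp add: power2_norm_eq_inner inner_diff_left inner_diff_right inner_commute)

lemma projector_norm_le: "projector P \<Longrightarrow> norm (P x) \<le> norm x"
  using projector_pythagoras[of P x] by (simp add: power2_le_imp_le)

lemma projector_complement: "projector P \<Longrightarrow> projector (\<lambda>x. x - P x)"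
  unfolding projector_def symmetric_op_def
  by (auto simp: bounded_linear_sub bounded_linear_ident inner_diff_left inner_diff_right
      bounded_linear.linear linear_diff)

lemma symmetric_op_combine:
  assumes "symmetric_op S" "symmetric_op T"
  shows "symmetric_op (\<lambda>x. a *\<^sub>R S x + b *\<^sub>R T x)"
  using assms unfolding symmetric_op_def
  by (auto simp: inner_add_left inner_add_right bounded_linear_add
      bounded_linear_compose[OF bounded_linear_scaleR_right])

lemma symmetric_op_id: "symmetric_op (\<lambda>x. x)"
  by (simp add: symmetric_op_def bounded_linear_ident)

text \<open>Polarization.\<close>

lemma symmetric_op_eqI:
  assumes "symmetric_op S" "symmetric_op T" "\<And>x. inner x (S x) = inner x (T x)"
  shows "S = T"
proof
  fix x
  have "inner y (S x) = inner y (T x)" for y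
  proof -
    have "inner x (S y) = inner y (S x)" "inner x (T y) = inner y (T x)"
      by (metis assms inner_commute symmetric_opD(2))+
    then show ?thesis
      using assms(3)[of "x + y"] assms(3)[of x] assms(3)[of y]
      by (simp add: symmetric_opD[OF assms(1)] symmetric_opD[OF assms(2)] inner_add_left inner_add_right)
  qed
  then have "inner (S x - T x) (S x - T x) = 0" by (simp add: inner_diff_right)
  then show "S x = T x" by simp
qed

text \<open>This is the Cauchy-Schwarz inequality for the form of \<open>T\<close>, at \<open>x\<close> and \<open>T x\<close>. It turns convergence of
  forms into strong convergence, and vanishing of the form into vanishing of the vector.\<close>

lemma positive_op_norm:
  assumes "positive_op T" and "\<And>x. norm (T x) \<le> K * norm x"
  shows "(norm (T x))\<^sup>2 \<le> K * inner x (T x)"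
proof (cases "T x = 0")
  case False
  note s = symmetric_opD[OF positive_opD(1)[OF assms(1)]]
  define q where "q = inner (T x) (T (T x))"
  have q: "0 \<le> q" "q \<le> K * (norm (T x))\<^sup>2"
  proof -
    show "0 \<le> q" unfolding q_def using positive_opD(2)[OF assms(1)] .
    have "q \<le> norm (T x) * norm (T (T x))" unfolding q_def by (rule norm_cauchy_schwarz)
    also have "\<dots> \<le> norm (T x) * (K * norm (T x))" by (intro mult_left_mono assms(2)) simp
    finally show "q \<le> K * (norm (T x))\<^sup>2" by (simp add: power2_eq_square algebra_simps)
  qed
  have n0: "(norm (T x))\<^sup>2 > 0" using False by simp
  have quad: "0 \<le> inner x (T x) - 2 * t * (norm (T x))\<^sup>2 + t\<^sup>2 * q" for t
  proof -
    have e: "inner x (T (T x)) = (norm (T x))\<^sup>2" by (metis power2_norm_eq_inner s(2))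
    have "0 \<le> inner (x - t *\<^sub>R T x) (T (x - t *\<^sub>R T x))" using positive_opD(2)[OF assms(1)] .
    also have "\<dots> = inner x (T x) - 2 * t * (norm (T x))\<^sup>2 + t\<^sup>2 * q"
      by (simp add: s inner_diff_left inner_diff_right e q_def power2_norm_eq_inner
          power2_eq_square algebra_simps)
    finally show ?thesis .
  qed
  have K0: "K > 0" using assms(2)[of x] False
    by (smt (verit) mult_nonpos_nonneg norm_ge_zero zero_less_norm_iff)
  \<comment> \<open>With \<open>q\<close> replaced by its upper bound, the quadratic polynomial is minimal at \<open>t = 1/K\<close>.\<close>
  have "(1/K)\<^sup>2 * q \<le> (1/K)\<^sup>2 * (K * (norm (T x))\<^sup>2)" using q(2) by (simp add: mult_left_mono)
  also have "\<dots> = (norm (T x))\<^sup>2 / K" using K0 by (simp add: power2_eq_square)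
  finally have "(norm (T x))\<^sup>2 / K \<le> inner x (T x)" using quad[of "1/K"] by simp
  then show ?thesis using K0 by (simp add: field_simps)
qed (use positive_opD(2)[OF assms(1), of x] in auto)

subsection \<open>Monotone limits\<close>

text \<open>The increments are positive operators, so the norm of an increment at \<open>x\<close> is controlled by the increment
  of the form at \<open>x\<close>, and the forms converge because they are monotone and bounded.\<close>

lemma increasing_contractions_converge:
  fixes T :: "nat \<Rightarrow> 'a::{real_inner,complete_space} \<Rightarrow> 'a"
  assumes sym: "\<And>n. symmetric_op (T n)"
    and mono: "\<And>m n x. m \<le> n \<Longrightarrow> inner x (T m x) \<le> inner x (T n x)"
    and contr: "\<And>n x. norm (T n x) \<le> norm x"
  shows "\<exists>S. symmetric_op S \<and> (\<forall>x. (\<lambda>n. T n x) \<longlonglongrightarrow> S x) \<and> (\<forall>x. norm (S x) \<le> norm x)"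
proof -
  have diff: "(norm (T n x - T m x))\<^sup>2 \<le> 2 * (inner x (T n x) - inner x (T m x))" if "m \<le> n" for m n x
  proof -
    have "symmetric_op (\<lambda>x. T n x - T m x)"
      using symmetric_op_combine[OF sym[of n] sym[of m], of 1 "-1"] by simp
    then have "positive_op (\<lambda>x. T n x - T m x)"
      using mono[OF that] by (simp add: positive_op_def inner_diff_right)
    moreover have "norm (T n x - T m x) \<le> 2 * norm x" for x
      using norm_triangle_ineq4[of "T n x" "T m x"] contr[of n x] contr[of m x] by linarith
    ultimately show ?thesis using positive_op_norm[of "\<lambda>x. T n x - T m x" 2 x] by (simp add: inner_diff_right)
  qed
  have conv: "convergent (\<lambda>n. T n x)" for x
  proof -
    have "incseq (\<lambda>n. inner x (T n x))" using mono by (auto simp: incseq_def)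
    moreover have "inner x (T n x) \<le> norm x * norm x" for n
      using norm_cauchy_schwarz[of x "T n x"] contr[of n x] by (meson mult_left_mono norm_ge_zero order_trans)
    ultimately obtain l where "(\<lambda>n. inner x (T n x)) \<longlonglongrightarrow> l" using incseq_convergent by blast
    then have C: "Cauchy (\<lambda>n. inner x (T n x))" by (simp add: LIMSEQ_imp_Cauchy)
    have "Cauchy (\<lambda>n. T n x)"
    proof (rule Cauchy_if_power_dist_le[OF C])
      fix m n :: nat assume "m \<le> n"
      from diff[OF this, of x]
      show "(dist (T m x) (T n x))\<^sup>2 \<le> 2 * dist (inner x (T m x)) (inner x (T n x))"
        using mono[OF \<open>m \<le> n\<close>, of x] by (simp add: dist_norm norm_minus_commute)
    qed
    then show ?thesis by (simp add: Cauchy_convergent)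
  qed
  define S where "S x = lim (\<lambda>n. T n x)" for x
  have lim: "(\<lambda>n. T n x) \<longlonglongrightarrow> S x" for x
    using conv by (simp add: S_def convergent_LIMSEQ_iff)
  have nS: "norm (S x) \<le> norm x" for x
    by (rule LIMSEQ_le_const2[OF tendsto_norm[OF lim]]) (use contr in auto)
  have "bounded_linear S"
  proof (rule bounded_linear_intro[where K = 1])
    fix x y show "S (x + y) = S x + S y"
      using LIMSEQ_unique[OF lim[of "x + y"]] tendsto_add[OF lim[of x] lim[of y]]
      by (simp add: symmetric_opD[OF sym])
    fix r show "S (r *\<^sub>R x) = r *\<^sub>R S x"
      using LIMSEQ_unique[OF lim[of "r *\<^sub>R x"]] tendsto_scaleR[OF tendsto_const lim[of x], of r]
      by (simp add: symmetric_opD[OF sym])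
  qed (use nS in auto)
  moreover have "inner (S x) y = inner x (S y)" for x y
  proof -
    have "(\<lambda>n. inner (T n x) y) \<longlonglongrightarrow> inner (S x) y" "(\<lambda>n. inner x (T n y)) \<longlonglongrightarrow> inner x (S y)"
      by (intro tendsto_intros lim)+
    then show ?thesis using LIMSEQ_unique by (simp add: symmetric_opD(2)[OF sym])
  qed
  ultimately show ?thesis using lim nS by (auto simp: symmetric_op_def)
qed

lemma increasing_projectors_converge:
  fixes P :: "nat \<Rightarrow> 'a::{real_inner,complete_space} \<Rightarrow> 'a"
  assumes proj: "\<And>n. projector (P n)"
    and mono: "\<And>m n x. m \<le> n \<Longrightarrow> inner x (P m x) \<le> inner x (P n x)"
  shows "\<exists>S. projector S \<and> (\<forall>x. (\<lambda>n. P n x) \<longlonglongrightarrow> S x)"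
proof -
  obtain S where S: "symmetric_op S" "\<And>x. (\<lambda>n. P n x) \<longlonglongrightarrow> S x"
    using increasing_contractions_converge[of P] projectorD(1)[OF proj] mono projector_norm_le[OF proj] by metis
  have "S (S x) = S x" for x
  proof -
    have "(\<lambda>n. P n (P n x) - P n (S x)) \<longlonglongrightarrow> 0"
    proof (rule tendsto_0_le[where K = 1 and f = "\<lambda>n. P n x - S x"])
      show "(\<lambda>n. P n x - S x) \<longlonglongrightarrow> 0" using S(2)[of x] by (simp add: LIM_zero)
      show "\<forall>\<^sub>F n in sequentially. norm (P n (P n x) - P n (S x)) \<le> norm (P n x - S x) * 1"
        using projector_norm_le[OF proj]
        by (metis (no_types, lifting) always_eventually mult.right_neutral proj projectorD(1) symmetric_opD(4))
    qed
    then have "(\<lambda>n. P n x - P n (S x)) \<longlonglongrightarrow> 0" by (simp add: projectorD(2)[OF proj])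
    moreover have "(\<lambda>n. P n x - P n (S x)) \<longlonglongrightarrow> S x - S (S x)" by (intro tendsto_intros S)
    ultimately show ?thesis using LIMSEQ_unique by fastforce
  qed
  then show ?thesis using S by (auto simp: projector_def)
qed

subsection \<open>The square root of a positive operator\<close>

text \<open>The successive approximations of \<open>1 - sqrt (1 - X)\<close>, the fixed point of \<open>Y = (X + Y\<^sup>2) / 2\<close>.\<close>

primrec sqrt_iter :: "('a::real_vector \<Rightarrow> 'a) \<Rightarrow> nat \<Rightarrow> 'a \<Rightarrow> 'a" where
  "sqrt_iter X 0 = (\<lambda>x. 0)"
| "sqrt_iter X (Suc n) = (\<lambda>x. (1/2) *\<^sub>R (X x + sqrt_iter X n (sqrt_iter X n x)))"

text \<open>Polynomials in \<open>X\<close> with nonnegative coefficients. The iteration is monotone because its increments have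
  this form, and every such polynomial inherits positivity and the commutant from \<open>X\<close>.\<close>

inductive_set nonneg_polys :: "('a::real_vector \<Rightarrow> 'a) \<Rightarrow> ('a \<Rightarrow> 'a) set" for X where
  zero: "(\<lambda>x. 0) \<in> nonneg_polys X"
| mono: "r \<ge> 0 \<Longrightarrow> p \<in> nonneg_polys X \<Longrightarrow> (\<lambda>x. r *\<^sub>R (X ^^ n) x + p x) \<in> nonneg_polys X"

lemma nonneg_polys_add:
  assumes "p \<in> nonneg_polys X" "q \<in> nonneg_polys X"
  shows "(\<lambda>x. p x + q x) \<in> nonneg_polys X"
  using assms
proof (induction rule: nonneg_polys.induct)
  case (mono r p n)
  then show ?case using nonneg_polys.mono[OF mono(1), of "\<lambda>x. p x + q x" X n] by (simp add: add.assoc)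
qed simp

lemma linear_funpow: "linear X \<Longrightarrow> linear (X ^^ n)" for X :: "'a::real_vector \<Rightarrow> 'a"
  by (induction n) (auto simp: linear_compose linear_id)

lemma nonneg_polys_linear:
  assumes "p \<in> nonneg_polys X" "linear X"
  shows "linear p"
  using assms(1)
proof (induction rule: nonneg_polys.induct)
  case (mono r p n)
  show ?case using mono linear_funpow[OF assms(2)] by (intro linear_compose_add linear_compose_scale_right)
qed (simp add: linear_zero)

lemma nonneg_polys_scale:
  assumes "p \<in> nonneg_polys X" "r \<ge> 0"
  shows "(\<lambda>x. r *\<^sub>R p x) \<in> nonneg_polys X"
  using assms(1)
proof (induction rule: nonneg_polys.induct)
  case (mono s p n)
  then show ?case using nonneg_polys.mono[of "r * s" "\<lambda>x. r *\<^sub>R p x" X n] assms(2)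
    by (simp add: scaleR_add_right)
qed (simp add: nonneg_polys.zero)

lemma nonneg_polys_mult:
  assumes "p \<in> nonneg_polys X" "q \<in> nonneg_polys X" "linear X"
  shows "(\<lambda>x. p (q x)) \<in> nonneg_polys X"
  using assms(1)
proof (induction rule: nonneg_polys.induct)
  case (mono r p n)
  have shift: "(\<lambda>x. (X ^^ n) (q x)) \<in> nonneg_polys X"
    using assms(2)
  proof (induction rule: nonneg_polys.induct)
    case (mono r p m)
    note l = linear_funpow[OF assms(3), of n]
    show ?case using nonneg_polys.mono[OF mono(1,3), of "n + m"]
      by (simp add: linear_add[OF l] linear_scale[OF l] funpow_add)
  qed (simp add: nonneg_polys.zero linear_0[OF linear_funpow[OF assms(3)]])
  show ?case using nonneg_polys_add[OF nonneg_polys_scale[OF shift mono(1)] mono(3)] .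
qed (simp add: nonneg_polys.zero)

text \<open>The powers are handled by \<open>\<langle>x, X\<^sup>2\<^sup>j x\<rangle> = \<parallel>X\<^sup>j x\<parallel>\<^sup>2\<close> and \<open>\<langle>x, X\<^sup>2\<^sup>j\<^sup>+\<^sup>1 x\<rangle> = \<langle>X\<^sup>j x, X X\<^sup>j x\<rangle>\<close>.\<close>

lemma nonneg_polys_positive:
  assumes "p \<in> nonneg_polys X" "positive_op X"
  shows "positive_op p"
  using assms(1)
proof (induction rule: nonneg_polys.induct)
  case zero
  show ?case by (simp add: positive_op_def symmetric_op_def bounded_linear_zero)
next
  case (mono r p n)
  note s = symmetric_opD[OF positive_opD(1)[OF assms(2)]]
  have sym: "symmetric_op (X ^^ k)" for k
  proof (induction k)
    case (Suc k)
    have swap: "(X ^^ k) (X x) = X ((X ^^ k) x)" for x by (rule funpow_swap1[symmetric])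
    have "bounded_linear (\<lambda>x. X ((X ^^ k) x))"
      by (rule bounded_linear_compose[OF s(1) symmetric_opD(1)[OF Suc]])
    moreover have "inner (X ((X ^^ k) x)) y = inner x (X ((X ^^ k) y))" for x y
      by (simp only: s(2) symmetric_opD(2)[OF Suc] swap)
    ultimately show ?case by (simp add: symmetric_op_def o_def)
  qed (simp add: symmetric_op_def id_def bounded_linear_ident)
  have "0 \<le> inner x ((X ^^ k) x)" for k x
  proof (induction k rule: less_induct)
    case (less k)
    obtain j where "k = 2 * j \<or> k = Suc (2 * j)" by (metis evenE oddE Suc_eq_plus1)
    then show ?case
    proof
      assume k: "k = 2 * j"
      have "inner x ((X ^^ k) x) = inner ((X ^^ j) x) ((X ^^ j) x)"
        unfolding k mult_2 funpow_add by (simp add: symmetric_opD(2)[OF sym])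
      then show ?thesis by simp
    next
      assume "k = Suc (2 * j)"
      then have k: "k = j + Suc j" by simp
      have "inner x ((X ^^ k) x) = inner ((X ^^ j) x) (X ((X ^^ j) x))"
        unfolding k funpow_add by (simp add: symmetric_opD(2)[OF sym])
      then show ?thesis using positive_opD(2)[OF assms(2)] by simp
    qed
  qed
  moreover have "symmetric_op (\<lambda>x. r *\<^sub>R (X ^^ n) x + p x)"
    using symmetric_op_combine[OF sym[of n] positive_opD(1)[OF mono(3)], of r 1] by simp
  ultimately show ?case using mono by (auto simp: positive_op_def inner_add_right)
qed

lemma sqrt_iter_nonneg_polys:
  assumes "linear X"
  shows "sqrt_iter X n \<in> nonneg_polys X"
proof (induction n)
  case (Suc n)
  have "X \<in> nonneg_polys X" using nonneg_polys.mono[OF _ nonneg_polys.zero, of 1 1 X] by simp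
  then show ?case using nonneg_polys_scale[OF nonneg_polys_add[OF _ nonneg_polys_mult[OF Suc Suc assms]], of X "1/2"]
    by simp
qed (simp add: nonneg_polys.zero)

lemma nonneg_polys_commuting:
  assumes "p \<in> nonneg_polys X" "linear C" "commuting C X"
  shows "commuting C p"
  using assms(1)
proof (induction rule: nonneg_polys.induct)
  case zero
  show ?case using assms(2) by (simp add: commuting_def linear_0)
next
  case (mono r p n)
  have "C ((X ^^ n) x) = (X ^^ n) (C x)" for x
    using assms(3) by (induction n) (auto simp: commuting_def)
  then show ?case using mono assms(2) by (simp add: commuting_def linear_add linear_scale)
qed

text \<open>Induction with \<open>Z\<^sup>2 - Y\<^sup>2 = (Z - Y) (Z + Y)\<close> for consecutive approximations \<open>Y\<close> and \<open>Z\<close>, which commute.\<close>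

lemma sqrt_iter_increment:
  assumes "linear X"
  shows "(\<lambda>x. sqrt_iter X (Suc n) x - sqrt_iter X n x) \<in> nonneg_polys X"
proof (induction n)
  case 0
  show ?case using sqrt_iter_nonneg_polys[OF assms, of 1] by simp
next
  case (Suc n)
  let ?Y = "sqrt_iter X n" and ?Z = "sqrt_iter X (Suc n)"
  have Y: "?Y \<in> nonneg_polys X" and Z: "?Z \<in> nonneg_polys X" by (rule sqrt_iter_nonneg_polys[OF assms])+
  have lY: "linear ?Y" and lZ: "linear ?Z" using nonneg_polys_linear[OF _ assms] Y Z by auto
  have "commuting X X" by (simp add: commuting_def)
  then have "commuting X ?Y" using nonneg_polys_commuting[OF Y assms] by simp
  then have "commuting ?Y X" unfolding commuting_def by metis
  then have YZ: "?Y (?Z x) = ?Z (?Y x)" for x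
    by (rule commutingD[OF nonneg_polys_commuting[OF Z lY]])
  have "(\<lambda>x. ?Z (?Z x) - ?Y (?Y x)) = (\<lambda>x. (\<lambda>x. ?Z x - ?Y x) ((\<lambda>x. ?Z x + ?Y x) x))"
    by (simp add: linear_add[OF lY] linear_add[OF lZ] YZ del: sqrt_iter.simps)
  then have "(\<lambda>x. ?Z (?Z x) - ?Y (?Y x)) \<in> nonneg_polys X"
    using nonneg_polys_mult[OF Suc nonneg_polys_add[OF Z Y] assms] by simp
  from nonneg_polys_scale[OF this, of "1/2"]
  have poly: "(\<lambda>x. (1/2) *\<^sub>R (?Z (?Z x) - ?Y (?Y x))) \<in> nonneg_polys X" by (simp del: sqrt_iter.simps)
  have "sqrt_iter X (Suc (Suc n)) x - ?Z x = (1/2) *\<^sub>R (?Z (?Z x) - ?Y (?Y x))" for x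
  proof -
    have "sqrt_iter X (Suc (Suc n)) x - ?Z x
        = (1/2) *\<^sub>R (X x + ?Z (?Z x)) - (1/2) *\<^sub>R (X x + ?Y (?Y x))"
      by (rule arg_cong2[where f = minus]) (rule fun_cong[OF sqrt_iter.simps(2)])+
    then show ?thesis by (simp only: scaleR_right_diff_distrib[symmetric] add_diff_cancel_left)
  qed
  then show ?case using poly by (simp only:)
qed

text \<open>The square root is \<open>1 - Y\<close>, where \<open>Y\<close> is the strong limit of the approximations for \<open>X = 1 - T\<close>. As a limit of
  polynomials in \<open>T\<close> it commutes with the commutant of \<open>T\<close>.\<close>

lemma positive_contraction_sqrt:
  fixes T :: "'a::{real_inner,complete_space} \<Rightarrow> 'a"
  assumes T: "positive_op T" and contr: "\<And>x. norm (T x) \<le> norm x"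
  shows "\<exists>S. positive_op S \<and> (\<forall>x. S (S x) = T x) \<and>
    (\<forall>C. bounded_linear C \<longrightarrow> commuting C T \<longrightarrow> commuting C S)"
proof -
  note s = symmetric_opD[OF positive_opD(1)[OF T]]
  define X where "X = (\<lambda>x. x - T x)"
  have symX: "symmetric_op X"
    using symmetric_op_combine[OF symmetric_op_id positive_opD(1)[OF T], of 1 "-1"] by (simp add: X_def)
  have "inner x (T x) \<le> inner x x" for x
  proof -
    have "inner x (T x) \<le> norm x * norm (T x)" by (rule norm_cauchy_schwarz)
    also have "\<dots> \<le> norm x * norm x" by (intro mult_left_mono contr) simp
    finally show ?thesis by (simp add: norm_eq_sqrt_inner)
  qed
  then have posX: "positive_op X" using symX by (simp add: positive_op_def X_def inner_diff_right)
  have nX: "norm (X x) \<le> norm x" for x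
  proof -
    have "(norm (T x))\<^sup>2 \<le> inner x (T x)" using positive_op_norm[OF T, of 1 x] contr by simp
    then have "(norm (X x))\<^sup>2 \<le> (norm x)\<^sup>2" using positive_opD(2)[OF T, of x]
      by (simp add: X_def power2_norm_eq_inner inner_diff_left inner_diff_right inner_commute)
    then show ?thesis by (rule power2_le_imp_le) simp
  qed
  have lX: "linear X" using symX by (simp add: symmetric_op_def bounded_linear.linear)
  let ?Y = "sqrt_iter X"
  have posY: "positive_op (?Y n)" for n using nonneg_polys_positive[OF sqrt_iter_nonneg_polys[OF lX] posX] .
  have nY: "norm (?Y n x) \<le> norm x" for n x
  proof (induction n arbitrary: x)
    case (Suc n)
    have "norm (?Y n (?Y n x)) \<le> norm x" using Suc[of "?Y n x"] Suc[of x] by linarith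
    then show ?case using norm_triangle_ineq[of "X x" "?Y n (?Y n x)"] nX[of x] by simp
  qed simp
  have step: "inner x (?Y n x) \<le> inner x (?Y (Suc n) x)" for n x
    using positive_opD(2)[OF nonneg_polys_positive[OF sqrt_iter_increment[OF lX] posX], of x n]
    by (simp only: inner_diff_right)
  have monoY: "inner x (?Y m x) \<le> inner x (?Y n x)" if "m \<le> n" for m n x
    using lift_Suc_mono_le[of "\<lambda>n. inner x (?Y n x)", OF step that] .
  obtain Y where Y: "symmetric_op Y" "\<And>x. (\<lambda>n. ?Y n x) \<longlonglongrightarrow> Y x" "\<And>x. norm (Y x) \<le> norm x"
    using increasing_contractions_converge[of ?Y] positive_opD(1)[OF posY] monoY nY by metis
  have YY: "(\<lambda>n. ?Y n (?Y n x)) \<longlonglongrightarrow> Y (Y x)" for x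
  proof -
    have "(\<lambda>n. ?Y n (?Y n x) - ?Y n (Y x)) \<longlonglongrightarrow> 0"
    proof (rule tendsto_0_le[where K = 1 and f = "\<lambda>n. ?Y n x - Y x"])
      show "(\<lambda>n. ?Y n x - Y x) \<longlonglongrightarrow> 0" using Y(2)[of x] by (simp add: LIM_zero)
      show "\<forall>\<^sub>F n in sequentially. norm (?Y n (?Y n x) - ?Y n (Y x)) \<le> norm (?Y n x - Y x) * 1"
        by (intro always_eventually allI)
           (simp add: symmetric_opD(4)[OF positive_opD(1)[OF posY], symmetric] nY)
    qed
    from tendsto_add[OF this Y(2)[of "Y x"]] show ?thesis by simp
  qed
  have fixed_point: "Y x = (1/2) *\<^sub>R (X x + Y (Y x))" for x
  proof -
    have "(\<lambda>n. ?Y (Suc n) x) \<longlonglongrightarrow> (1/2) *\<^sub>R (X x + Y (Y x))"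
      unfolding sqrt_iter.simps by (intro tendsto_intros YY)
    then show ?thesis by (rule LIMSEQ_unique[OF LIMSEQ_Suc[OF Y(2)]])
  qed
  define S where "S = (\<lambda>x. x - Y x)"
  have symS: "symmetric_op S"
    using symmetric_op_combine[OF symmetric_op_id Y(1), of 1 "-1"] by (simp add: S_def)
  have "inner x (Y x) \<le> inner x x" for x
  proof -
    have "inner x (Y x) \<le> norm x * norm (Y x)" by (rule norm_cauchy_schwarz)
    also have "\<dots> \<le> norm x * norm x" by (intro mult_left_mono Y) simp
    finally show ?thesis by (simp add: norm_eq_sqrt_inner)
  qed
  then have posS: "positive_op S" using symS by (simp add: positive_op_def S_def inner_diff_right)
  have "S (S x) = T x" for x
  proof -
    have "Y x + Y x = X x + Y (Y x)" using fixed_point[of x]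
      by (metis (no_types, lifting) scaleR_half_double scaleR_add_right)
    then show ?thesis by (simp add: S_def X_def symmetric_opD[OF Y(1)] algebra_simps)
  qed
  moreover have "commuting C S" if C: "bounded_linear C" "commuting C T" for C
  proof -
    interpret C: bounded_linear C by fact
    have CX: "commuting C X" using C(2) by (simp add: commuting_def X_def C.diff)
    have "C (Y x) = Y (C x)" for x
    proof -
      have "(\<lambda>n. C (?Y n x)) \<longlonglongrightarrow> C (Y x)" by (intro C.tendsto Y)
      moreover have "C (?Y n x) = ?Y n (C x)" for n
        by (rule commutingD[OF nonneg_polys_commuting[OF sqrt_iter_nonneg_polys[OF lX] C.linear CX]])
      ultimately have "(\<lambda>n. ?Y n (C x)) \<longlonglongrightarrow> C (Y x)" by simp
      then show ?thesis using Y(2) by (rule LIMSEQ_unique)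
    qed
    then show ?thesis by (simp add: commuting_def S_def C.diff)
  qed
  ultimately show ?thesis using posS by blast
qed

subsection \<open>The negative part of a symmetric operator\<close>

lemma subspace_closure:
  fixes S :: "'a::real_normed_vector set"
  assumes "subspace S"
  shows "subspace (closure S)"
  unfolding subspace_def
proof (intro conjI ballI allI)
  show "0 \<in> closure S" using subspace_0[OF assms] closure_subset[of S] by auto
  fix x assume "x \<in> closure S"
  then obtain f where f: "\<And>n. f n \<in> S" "f \<longlonglongrightarrow> x" by (auto simp: closure_sequential)
  show "c *\<^sub>R x \<in> closure S" for c
    using f assms by (intro closure_sequential[THEN iffD2] exI[of _ "\<lambda>n. c *\<^sub>R f n"])
      (auto intro!: tendsto_intros simp: subspace_scale)
  fix y assume "y \<in> closure S"
  then obtain g where g: "\<And>n. g n \<in> S" "g \<longlonglongrightarrow> y" by (auto simp: closure_sequential)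
  show "x + y \<in> closure S"
    using f g assms by (intro closure_sequential[THEN iffD2] exI[of _ "\<lambda>n. f n + g n"])
      (auto intro!: tendsto_intros simp: subspace_add)
qed

lemma projector_onto_exists:
  fixes M :: "'a::{real_inner,complete_space} set"
  assumes "closed M" and "subspace M"
  shows "\<exists>P. projector P \<and> range P \<subseteq> M \<and> (\<forall>x\<in>M. P x = x) \<and> (\<forall>x. P x = 0 \<longleftrightarrow> (\<forall>m\<in>M. inner x m = 0))"
proof -
  obtain P where P: "\<And>x. P x \<in> M" "\<And>x m. m \<in> M \<Longrightarrow> inner (x - P x) m = 0"
    using orthogonal_decomposition_exists[OF assms] by metis
  have uniq: "P x = p" if "p \<in> M" "\<And>m. m \<in> M \<Longrightarrow> inner (x - p) m = 0" for x p
  proof -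
    have d: "P x - p \<in> M" using P(1) that(1) assms(2) by (simp add: subspace_diff)
    then have "inner (x - p) (P x - p) = 0" "inner (x - P x) (P x - p) = 0" using P(2) that(2) by auto
    then have "inner (P x - p) (P x - p) = 0" by (simp add: inner_diff_left)
    then show ?thesis by simp
  qed
  have id: "P x = x" if "x \<in> M" for x using uniq[of x x] that by simp
  have sym: "inner (P x) y = inner x (P y)" for x y
  proof -
    have "inner x (P y) = inner (P x) (P y)" "inner y (P x) = inner (P y) (P x)"
      using P(2)[OF P(1)[of y], of x] P(2)[OF P(1)[of x], of y] by (simp_all add: inner_diff_left)
    then show ?thesis by (metis inner_commute)
  qed
  have "bounded_linear P"
  proof (rule bounded_linear_intro[where K = 1])
    show "P (x + y) = P x + P y" for x y
    proof (rule uniq)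
      show "P x + P y \<in> M" using P(1) assms(2) by (simp add: subspace_add)
      show "inner (x + y - (P x + P y)) m = 0" if "m \<in> M" for m
        using P(2)[OF that, of x] P(2)[OF that, of y] by (simp add: inner_diff_left inner_add_left)
    qed
    show "P (r *\<^sub>R x) = r *\<^sub>R P x" for r x
    proof (rule uniq)
      show "r *\<^sub>R P x \<in> M" using P(1) assms(2) by (simp add: subspace_scale)
      show "inner (r *\<^sub>R x - r *\<^sub>R P x) m = 0" if "m \<in> M" for m
        using P(2)[OF that, of x] by (simp add: inner_diff_left)
    qed
    show "norm (P x) \<le> norm x * 1" for x
    proof -
      have "(norm x)\<^sup>2 = (norm (P x))\<^sup>2 + (norm (x - P x))\<^sup>2"
        using P(2)[OF P(1)[of x], of x]
        by (simp add: power2_norm_eq_inner inner_diff_left inner_diff_right inner_commute)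
      then have "(norm (P x))\<^sup>2 \<le> (norm x)\<^sup>2" by simp
      then have "norm (P x) \<le> norm x" by (rule power2_le_imp_le) simp
      then show ?thesis by simp
    qed
  qed
  then have "projector P" using sym id P(1) by (simp add: projector_def symmetric_op_def)
  moreover have "P x = 0 \<longleftrightarrow> (\<forall>m\<in>M. inner x m = 0)" for x
    using P(2)[of _ x] uniq[of 0 x] assms(2) by (auto simp: subspace_0)
  ultimately show ?thesis using P(1) id by blast
qed

text \<open>On the kernel of \<open>W = \<bar>B\<bar> + B\<close> one has \<open>B = - \<bar>B\<bar> \<le> 0\<close>. On its complement, the closure of the range of \<open>W\<close>, one
  has \<open>B = \<bar>B\<bar>\<close> because \<open>(\<bar>B\<bar> - B) W = 0\<close>. The projector onto the kernel commutes with the commutant of \<open>B\<close>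
  because the commutant leaves both the kernel and the range of \<open>W\<close> invariant. Since the kernel of \<open>B\<close> goes to the
  negative part, the form is strictly positive on the complement.\<close>

lemma negative_projector_exists:
  fixes B :: "'a::{real_inner,complete_space} \<Rightarrow> 'a"
  assumes B: "symmetric_op B"
  shows "\<exists>F. projector F \<and> (\<forall>C. bounded_linear C \<longrightarrow> commuting C B \<longrightarrow> commuting C F) \<and>
    (\<forall>x. F x = x \<longrightarrow> inner x (B x) \<le> 0) \<and> (\<forall>x. F x = 0 \<longrightarrow> x \<noteq> 0 \<longrightarrow> 0 < inner x (B x))"
proof -
  note b = symmetric_opD[OF B]
  obtain K where K: "K > 0" "\<And>x. norm (B x) \<le> norm x * K"
    using bounded_linear.pos_bounded[OF b(1)] by blast
  \<comment> \<open>Scaled to a contraction, so that \<open>D\<^sup>2\<close> has a square root by \<open>positive_contraction_sqrt\<close>.\<close>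
  define D where "D = (\<lambda>x. (1/K) *\<^sub>R B x)"
  have symD: "symmetric_op D" using symmetric_op_combine[OF B B, of "1/K" 0] by (simp add: D_def)
  note d = symmetric_opD[OF symD]
  have nD: "norm (D x) \<le> norm x" for x using K(2)[of x] K(1) by (simp add: D_def field_simps)
  have blDD: "bounded_linear (\<lambda>x. D (D x))" by (rule bounded_linear_compose[OF d(1) d(1)])
  have posDD: "positive_op (\<lambda>x. D (D x))"
    unfolding positive_op_def symmetric_op_def
  proof (intro conjI allI blDD)
    show "inner (D (D x)) y = inner x (D (D y))" for x y by (simp only: d(2))
    have "inner x (D (D x)) = inner (D x) (D x)" for x by (simp only: d(2))
    then show "0 \<le> inner x (D (D x))" for x by (simp only: inner_ge_zero)
  qed
  have "norm (D (D x)) \<le> norm x" for x using nD[of x] nD[of "D x"] by linarith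
  from positive_contraction_sqrt[OF posDD this] obtain S where S: "positive_op S" "\<And>x. S (S x) = D (D x)"
    "\<And>C. bounded_linear C \<Longrightarrow> commuting C (\<lambda>x. D (D x)) \<Longrightarrow> commuting C S"
    by metis
  note s = symmetric_opD[OF positive_opD(1)[OF S(1)]]
  have SD: "S (D x) = D (S x)" for x
    using S(3)[OF d(1)] by (simp add: commuting_def)
  define W where "W = (\<lambda>x. S x + D x)"
  have symW: "symmetric_op W"
    using symmetric_op_combine[OF positive_opD(1)[OF S(1)] symD, of 1 1] by (simp add: W_def)
  note w = symmetric_opD[OF symW]
  define M where "M = closure (range W)"
  have "subspace (range W)"
    by (rule linear_subspace_image[OF bounded_linear.linear[OF w(1)] subspace_UNIV])
  then have "closed M" "subspace M" by (auto simp: M_def intro: subspace_closure)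
  then obtain P where P: "projector P" "\<And>x. P x \<in> M" "\<And>x. x \<in> M \<Longrightarrow> P x = x"
    "\<And>x. P x = 0 \<longleftrightarrow> (\<forall>m\<in>M. inner x m = 0)"
    using projector_onto_exists[of M] by (metis rangeI subsetD)
  note p = symmetric_opD[OF projectorD(1)[OF P(1)]]
  have closed_ker: "closed {x. T x = 0}" if "bounded_linear T" for T :: "'a \<Rightarrow> 'b::real_normed_vector"
    using that by (intro closed_Collect_eq continuous_intros linear_continuous_on)
  have kerP: "P x = 0 \<longleftrightarrow> W x = 0" for x
  proof
    assume "P x = 0"
    moreover have "W (W x) \<in> M" unfolding M_def by (rule closure_subset[THEN subsetD]) blast
    ultimately have "inner x (W (W x)) = 0" using P(4)[of x] by blast
    then have "inner (W x) (W x) = 0" by (simp only: w(2))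
    then show "W x = 0" by simp
  next
    assume W0: "W x = 0"
    have "range W \<subseteq> {m. inner x m = 0}"
    proof clarify
      fix y show "inner x (W y) = 0" using W0 w(2)[of x y] by simp
    qed
    then have "M \<subseteq> {m. inner x m = 0}"
      unfolding M_def by (intro closure_minimal closed_ker bounded_linear_inner_right)
    then show "P x = 0" using P(4)[of x] by blast
  qed
  have on_M: "S x = D x" if "x \<in> M" for x
  proof -
    have "M \<subseteq> {x. S x - D x = 0}"
      unfolding M_def
    proof (intro closure_minimal closed_ker bounded_linear_sub s(1) d(1))
      show "range W \<subseteq> {x. S x - D x = 0}" by (auto simp: W_def s d S(2) SD)
    qed
    then show ?thesis using that by auto
  qed
  define F where "F = (\<lambda>x. x - P x)"
  have "projector F" unfolding F_def by (rule projector_complement[OF P(1)])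
  moreover have "commuting C F" if C: "bounded_linear C" "commuting C B" for C
  proof -
    interpret C: bounded_linear C by fact
    have CD: "C (D x) = D (C x)" for x using C(2) by (simp add: commuting_def D_def C.scaleR)
    then have "commuting C S" using S(3)[OF C(1)] by (simp add: commuting_def)
    then have CW: "C (W x) = W (C x)" for x using CD by (simp add: W_def commuting_def C.add)
    have CM: "C x \<in> M" if "x \<in> M" for x
    proof -
      have "C ` closure (range W) \<subseteq> closure (C ` range W)"
        by (rule closure_bounded_linear_image_subset[OF C(1)])
      also have "\<dots> \<subseteq> closure (range W)" by (intro closure_mono) (auto simp: CW)
      finally show ?thesis using that by (auto simp: M_def)
    qed
    have "P (C x) = C (P x)" for x
    proof -
      have "P (x - P x) = 0" by (simp add: p projectorD[OF P(1)])
      then have "W (C (x - P x)) = 0" by (simp add: kerP CW[symmetric] C.zero)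
      then have "P (C (x - P x)) = 0" by (simp add: kerP)
      then have "P (C x) = P (C (P x))" by (simp add: C.diff p)
      then show ?thesis using P(3)[OF CM[OF P(2)]] by simp
    qed
    then show ?thesis by (simp add: commuting_def F_def C.diff)
  qed
  moreover have "inner x (B x) \<le> 0" if "F x = x" for x
  proof -
    have "W x = 0" using that kerP by (simp add: F_def)
    then have "D x = - S x" by (simp add: W_def add_eq_0_iff)
    then have "inner x (D x) \<le> 0" using positive_opD(2)[OF S(1), of x] by simp
    then show ?thesis using K(1) by (simp add: D_def field_simps mult_le_0_iff divide_le_0_iff)
  qed
  moreover have "0 < inner x (B x)" if x: "F x = 0" "x \<noteq> 0" for x
  proof -
    have "P x = x" using x by (simp add: F_def)
    then have SDx: "S x = D x" using on_M P(2) by metis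
    have "S x \<noteq> 0"
      using kerP[of x] \<open>P x = x\<close> x(2) SDx by (auto simp: W_def)
    moreover obtain k where "\<And>y. norm (S y) \<le> norm y * k"
      using bounded_linear.pos_bounded[OF s(1)] by blast
    then have "(norm (S x))\<^sup>2 \<le> k * inner x (S x)"
      using positive_op_norm[OF S(1), of k x] by (simp add: mult.commute)
    ultimately have "inner x (S x) \<noteq> 0" by auto
    then have "inner x (D x) > 0" using positive_opD(2)[OF S(1), of x] SDx by simp
    then show ?thesis using K(1) by (simp add: D_def zero_less_divide_iff)
  qed
  ultimately show ?thesis by blast
qed

subsection \<open>Accretivity relative to a positive form\<close>

text \<open>The steps \<open>1 + s B\<close> of the Euler scheme for the flow of \<open>B\<close> do not decrease the form of \<open>R\<close>. On the
  invariant subspace where the symmetric part of \<open>B\<close> is at most \<open>- s\<close> they contract, as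
  \<open>\<parallel>x + s B x\<parallel>\<^sup>2 = \<parallel>x\<parallel>\<^sup>2 + 2 s \<langle>x, B x\<rangle> + s\<^sup>2 \<parallel>x\<parallel>\<^sup>2 \<le> (1 - s\<^sup>2) \<parallel>x\<parallel>\<^sup>2\<close>. So the form of \<open>R\<close>, which is bounded,
  vanishes there, and injectivity of \<open>R\<close> makes the subspace trivial.\<close>

lemma unitary_accretive_if_form_accretive:
  fixes B B' R :: "'a::{real_inner,complete_space} \<Rightarrow> 'a"
  assumes B: "bounded_linear B" and B': "bounded_linear B'"
    and adj: "\<And>x y. inner (B x) y = inner x (B' y)"
    and inv: "\<And>x. B (B' x) = x" "\<And>x. B' (B x) = x"
    and R: "positive_op R" and inj: "\<And>x. R x = 0 \<Longrightarrow> x = 0"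
    and accr: "\<And>y. 0 \<le> inner (R y) (B y)"
  shows "0 \<le> inner y (B y)"
proof -
  interpret B: bounded_linear B by fact
  interpret B': bounded_linear B' by fact
  note r = symmetric_opD[OF positive_opD(1)[OF R]]
  have iso: "norm (B x) = norm x" for x
    by (simp add: norm_eq_sqrt_inner adj inv)
  have form: "inner y ((1/2) *\<^sub>R (B y + B' y)) = inner y (B y)" for y
    using adj[of y y] by (simp add: inner_add_right inner_commute)
  \<comment> \<open>The step size serves as the threshold for the symmetric part as well.\<close>
  have lower: "- s * (norm y)\<^sup>2 \<le> inner y (B y)" if s: "0 < s" "s < 1" for s y
  proof -
    define N where "N = (\<lambda>x. (1/2) *\<^sub>R (B x + B' x) + s *\<^sub>R x)"
    have adj': "inner (B' x) y = inner x (B y)" for x y using adj[of y x] by (simp add: inner_commute)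
    have symN: "symmetric_op N" unfolding N_def symmetric_op_def
      using B B' by (auto simp: inner_add_left inner_add_right adj adj' algebra_simps
          intro!: bounded_linear_add bounded_linear_compose[OF bounded_linear_scaleR_right] bounded_linear_ident)
    from negative_projector_exists[OF symN] obtain F where F: "projector F" "\<And>C. bounded_linear C \<Longrightarrow> commuting C N \<Longrightarrow> commuting C F"
      "\<And>x. F x = x \<Longrightarrow> inner x (N x) \<le> 0" "\<And>x. F x = 0 \<Longrightarrow> x \<noteq> 0 \<Longrightarrow> 0 < inner x (N x)"
      by metis
    note f = symmetric_opD[OF projectorD(1)[OF F(1)]]
    have formN: "inner x (N x) = inner x (B x) + s * (norm x)\<^sup>2" for x
      using form[of x] by (simp add: N_def inner_add_right power2_norm_eq_inner)
    have "commuting B N" by (simp add: commuting_def N_def B.add B.scaleR inv)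
    then have FB: "F (B x) = B (F x)" for x using F(2)[OF B] by (simp add: commuting_def)
    define E where "E = (\<lambda>x. x + s *\<^sub>R B x)"
    have FE: "F (E x) = E x" if "F x = x" for x using that by (simp add: E_def f FB)
    have nE: "(norm (E x))\<^sup>2 \<le> (1 - s\<^sup>2) * (norm x)\<^sup>2" if "F x = x" for x
    proof -
      have "(norm (E x))\<^sup>2 = (norm x)\<^sup>2 + 2 * s * inner x (B x) + s\<^sup>2 * (norm (B x))\<^sup>2"
        unfolding power2_norm_eq_inner E_def
        by (simp add: inner_add_left inner_add_right inner_commute power2_eq_square algebra_simps)
      also have "\<dots> = (1 - s\<^sup>2) * (norm x)\<^sup>2 + 2 * s * inner x (N x)"
        by (simp add: iso formN power2_eq_square algebra_simps)
      also have "\<dots> \<le> (1 - s\<^sup>2) * (norm x)\<^sup>2" using F(3)[OF that] s by (simp add: mult_nonneg_nonpos)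
      finally show ?thesis .
    qed
    have RE: "inner x (R x) \<le> inner (E x) (R (E x))" for x
    proof -
      have e: "inner x (R (B x)) = inner (R x) (B x)" "inner (B x) (R x) = inner (R x) (B x)"
        by (rule r(2)[symmetric]) (rule inner_commute)
      have "inner (E x) (R (E x)) = inner x (R x) + 2 * s * inner (R x) (B x) + s\<^sup>2 * inner (B x) (R (B x))"
        unfolding E_def r(3,5)
        by (simp add: inner_add_left inner_add_right e power2_eq_square algebra_simps)
      moreover have "0 \<le> 2 * s * inner (R x) (B x)" using s accr by simp
      moreover have "0 \<le> s\<^sup>2 * inner (B x) (R (B x))" using positive_opD(2)[OF R] by simp
      ultimately show ?thesis by linarith
    qed
    have F0: "x = 0" if "F x = x" for x
    proof -
      have it: "F ((E ^^ n) x) = (E ^^ n) x" for n using that by (induction n) (auto simp: FE)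
      have nit: "(norm ((E ^^ n) x))\<^sup>2 \<le> (1 - s\<^sup>2) ^ n * (norm x)\<^sup>2" for n
      proof (induction n)
        case (Suc n)
        have "0 \<le> 1 - s\<^sup>2" using s by (simp add: power_le_one)
        from mult_left_mono[OF Suc this] nE[OF it[of n]] show ?case by (simp add: mult.assoc)
      qed simp
      have Rit: "inner x (R x) \<le> inner ((E ^^ n) x) (R ((E ^^ n) x))" for n
      proof (induction n)
        case (Suc n)
        then show ?case using RE[of "(E ^^ n) x"] by simp
      qed simp
      obtain K where K: "K > 0" "\<And>y. norm (R y) \<le> norm y * K"
        using bounded_linear.pos_bounded[OF r(1)] by blast
      have "inner x (R x) \<le> (1 - s\<^sup>2) ^ n * ((norm x)\<^sup>2 * K)" for n
      proof -
        have "inner ((E ^^ n) x) (R ((E ^^ n) x)) \<le> norm ((E ^^ n) x) * norm (R ((E ^^ n) x))"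
          by (rule norm_cauchy_schwarz)
        also have "\<dots> \<le> norm ((E ^^ n) x) * (norm ((E ^^ n) x) * K)"
          by (intro mult_left_mono K) simp
        also have "\<dots> = (norm ((E ^^ n) x))\<^sup>2 * K" by (simp add: power2_eq_square)
        also have "\<dots> \<le> ((1 - s\<^sup>2) ^ n * (norm x)\<^sup>2) * K" using nit K(1) by (intro mult_right_mono) auto
        finally show ?thesis using Rit[of n] by (simp add: mult.assoc)
      qed
      moreover have "(\<lambda>n. (1 - s\<^sup>2) ^ n * ((norm x)\<^sup>2 * K)) \<longlonglongrightarrow> 0 * ((norm x)\<^sup>2 * K)"
      proof (intro tendsto_mult_right LIMSEQ_power_zero)
        have "0 < s\<^sup>2" "s\<^sup>2 < 1" using s by (auto simp: power_less_one_iff)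
        then show "norm (1 - s\<^sup>2) < 1" by simp
      qed
      ultimately have "inner x (R x) \<le> 0 * ((norm x)\<^sup>2 * K)" by (intro LIMSEQ_le_const) auto
      then have "inner x (R x) \<le> 0" by simp
      moreover have "(norm (R x))\<^sup>2 \<le> K * inner x (R x)"
        using positive_op_norm[OF R, of K x] K(2) by (simp add: mult.commute)
      ultimately have "(norm (R x))\<^sup>2 \<le> 0" using mult_nonneg_nonpos[of K "inner x (R x)"] K(1) by linarith
      then show "x = 0" using inj by simp
    qed
    have "F y = 0" using F0[of "F y"] projectorD(2)[OF F(1)] by simp
    then show ?thesis using F(4)[of y] formN[of y] by (cases "y = 0") auto
  qed
  show ?thesis
  proof (rule ccontr)
    assume neg: "\<not> 0 \<le> inner y (B y)"
    then have y0: "(norm y)\<^sup>2 > 0" by (auto simp: B.zero)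
    define s where "s = min (1/2) (- inner y (B y) / (2 * (norm y)\<^sup>2))"
    have s: "0 < s" "s < 1" using neg y0 by (auto simp: s_def zero_less_divide_iff min_def divide_neg_pos)
    have "s * (norm y)\<^sup>2 \<le> - inner y (B y) / 2"
    proof -
      have "s * (norm y)\<^sup>2 \<le> (- inner y (B y) / (2 * (norm y)\<^sup>2)) * (norm y)\<^sup>2"
        by (intro mult_right_mono) (auto simp: s_def)
      then show ?thesis using y0 by simp
    qed
    then show False using lower[OF s, of y] neg by simp
  qed
qed

subsection \<open>Commuting positive operators\<close>

text \<open>For a multiple \<open>Z\<close> of the square root of \<open>S\<close> the form equals \<open>\<langle>Z y, T Z y\<rangle>\<close> up to a positive factor.\<close>

lemma positive_op_commuting_product:
  fixes S T :: "'a::{real_inner,complete_space} \<Rightarrow> 'a"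
  assumes S: "positive_op S" and T: "positive_op T" and comm: "commuting T S"
  shows "0 \<le> inner y (S (T y))"
proof -
  note s = symmetric_opD[OF positive_opD(1)[OF S]]
  obtain K where K: "K > 0" "\<And>x. norm (S x) \<le> norm x * K"
    using bounded_linear.pos_bounded[OF s(1)] by blast
  define S' where "S' = (\<lambda>x. (1/K) *\<^sub>R S x)"
  have "symmetric_op S'"
    using symmetric_op_combine[OF positive_opD(1)[OF S] positive_opD(1)[OF S], of "1/K" 0] by (simp add: S'_def)
  then have "positive_op S'" using K(1) positive_opD(2)[OF S] by (simp add: positive_op_def S'_def)
  moreover have "norm (S' x) \<le> norm x" for x using K(2)[of x] K(1) by (simp add: S'_def field_simps)
  ultimately obtain Z where Z: "positive_op Z" "\<forall>x. Z (Z x) = S' x"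
    "\<forall>C. bounded_linear C \<longrightarrow> commuting C S' \<longrightarrow> commuting C Z"
    using positive_contraction_sqrt by metis
  note t = symmetric_opD[OF positive_opD(1)[OF T]]
  have "commuting T S'" using comm by (simp add: commuting_def S'_def t)
  then have ZT: "T (Z x) = Z (T x)" for x using Z(3) t(1) commutingD by metis
  have "inner y (S' (T y)) = inner y (Z (Z (T y)))" using Z(2) by simp
  also have "\<dots> = inner (Z y) (T (Z y))"
    by (simp only: ZT symmetric_opD(2)[OF positive_opD(1)[OF Z(1)]])
  also have "\<dots> \<ge> 0" by (rule positive_opD(2)[OF T])
  finally show ?thesis using K(1) by (simp add: S'_def zero_le_divide_iff)
qed

text \<open>Let \<open>b < c\<close>. On the subspace where \<open>0 \<le> C \<le> b\<close> the product \<open>C (b - C)\<close> of commuting positive operators is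
  positive, which gives \<open>\<parallel>C x\<parallel>\<^sup>2 \<le> b \<langle>x, C x\<rangle> \<le> b\<^sup>2 \<parallel>x\<parallel>\<^sup>2\<close>; so the subspace is trivial.\<close>

lemma positive_op_lower_bound:
  fixes C :: "'a::{real_inner,complete_space} \<Rightarrow> 'a"
  assumes C: "positive_op C" and lower: "\<And>y. c * norm y \<le> norm (C y)"
  shows "c * (norm y)\<^sup>2 \<le> inner y (C y)"
proof (cases "c \<le> 0")
  case True
  then have "c * (norm y)\<^sup>2 \<le> 0" by (simp add: mult_nonpos_nonneg)
  then show ?thesis using positive_opD(2)[OF C, of y] by linarith
next
  case False
  note s = symmetric_opD[OF positive_opD(1)[OF C]]
  have below: "b * (norm y)\<^sup>2 \<le> inner y (C y)" if b: "0 < b" "b < c" for b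
  proof -
    define N where "N = (\<lambda>x. C x - b *\<^sub>R x)"
    have formN: "inner x (N x) = inner x (C x) - b * (norm x)\<^sup>2" for x
      by (simp add: N_def inner_diff_right power2_norm_eq_inner)
    have "symmetric_op N"
      using symmetric_op_combine[OF positive_opD(1)[OF C] symmetric_op_id, of 1 "- b"] by (simp add: N_def)
    from negative_projector_exists[OF this] obtain F where F: "projector F"
      "\<And>D. bounded_linear D \<Longrightarrow> commuting D N \<Longrightarrow> commuting D F"
      "\<And>x. F x = x \<Longrightarrow> inner x (N x) \<le> 0" "\<And>x. F x = 0 \<Longrightarrow> x \<noteq> 0 \<Longrightarrow> 0 < inner x (N x)"
      by metis
    note f = symmetric_opD[OF projectorD(1)[OF F(1)]]
    have "commuting C N" by (simp add: commuting_def N_def s)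
    then have CF: "C (F x) = F (C x)" for x by (rule commutingD[OF F(2)[OF s(1)]])
    define T where "T = (\<lambda>x. b *\<^sub>R F x - C (F x))"
    have "symmetric_op (\<lambda>x. C (F x))"
      unfolding symmetric_op_def
    proof (intro conjI allI)
      show "bounded_linear (\<lambda>x. C (F x))" by (rule bounded_linear_compose[OF s(1) f(1)])
      show "inner (C (F x)) y = inner x (C (F y))" for x y by (simp only: s(2) f(2) CF)
    qed
    from symmetric_op_combine[OF projectorD(1)[OF F(1)] this, of b "-1"]
    have "symmetric_op T" by (simp add: T_def)
    moreover have "0 \<le> inner x (T x)" for x
    proof -
      have "F (F x) = F x" by (rule projectorD(2)[OF F(1)])
      then have "0 \<le> inner (F x) (b *\<^sub>R F x - C (F x))" using F(3)[of "F x"]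
        by (simp add: formN inner_diff_right power2_norm_eq_inner)
      also have "\<dots> = inner x (F (b *\<^sub>R F x - C (F x)))" by (rule f(2))
      also have "F (b *\<^sub>R F x - C (F x)) = T x" by (simp add: T_def f CF projectorD[OF F(1)])
      finally show ?thesis .
    qed
    ultimately have T: "positive_op T" by (simp add: positive_op_def)
    have "commuting T C" by (simp add: commuting_def T_def s CF)
    from positive_op_commuting_product[OF C T this]
    have CT: "0 \<le> inner x (C (T x))" for x .
    have F0: "x = 0" if x: "F x = x" for x
    proof (rule ccontr)
      assume "x \<noteq> 0"
      have "0 \<le> b * inner x (C x) - (norm (C x))\<^sup>2"
        using CT[of x] x by (simp add: T_def s inner_diff_right power2_norm_eq_inner)
      moreover have "inner x (C x) \<le> b * (norm x)\<^sup>2"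
        using F(3)[OF x] by (simp add: formN)
      ultimately have "(norm (C x))\<^sup>2 \<le> b * (b * (norm x)\<^sup>2)"
        using b(1) mult_left_mono[of "inner x (C x)" "b * (norm x)\<^sup>2" b] by linarith
      then have "(norm (C x))\<^sup>2 \<le> (b * norm x)\<^sup>2" by (simp add: power2_eq_square algebra_simps)
      then have "norm (C x) \<le> b * norm x" by (rule power2_le_imp_le) (use b(1) in simp)
      moreover have "b * norm x < c * norm x" using b(2) \<open>x \<noteq> 0\<close> by simp
      ultimately show False using lower[of x] by linarith
    qed
    have "F y = 0" using F0[of "F y"] projectorD(2)[OF F(1)] by simp
    then show ?thesis using F(4)[of y] by (cases "y = 0") (auto simp: formN)
  qed
  show ?thesis
  proof (rule ccontr)
    assume neg: "\<not> ?thesis"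
    then have n: "(norm y)\<^sup>2 > 0" using positive_opD(2)[OF C, of y] by (cases "y = 0") auto
    have "inner y (C y) / (norm y)\<^sup>2 < c" using neg n by (simp add: pos_divide_less_eq)
    moreover have "0 \<le> inner y (C y) / (norm y)\<^sup>2" using positive_opD(2)[OF C, of y] by simp
    ultimately obtain b where b: "inner y (C y) / (norm y)\<^sup>2 < b" "b < c" using dense by blast
    then have "0 < b" using \<open>0 \<le> inner y (C y) / (norm y)\<^sup>2\<close> by linarith
    from below[OF this b(2)] b(1) n show False by (simp add: pos_divide_less_eq)
  qed
qed

section \<open>Complex scalars\<close>

lemma scaleC_one [simp]: "1 *\<^sub>C x = x"
  using scaleC_of_real[of 1 x] by simp

lemma scaleC_zero [simp]: "0 *\<^sub>C x = 0"
  using scaleC_of_real[of 0 x] by simp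

lemma cinner_add_left: "cinner (x + y) z = cinner x z + cinner y z"
  using cinner_commute[of "x + y" z] cinner_commute[of x z] cinner_commute[of y z]
  by (simp add: cinner_add_right)

lemma cinner_scaleC_left: "cinner (c *\<^sub>C x) y = cnj c * cinner x y"
  using cinner_commute[of "c *\<^sub>C x" y] cinner_commute[of x y]
  by (simp add: cinner_scaleC_right)

lemma inner_scaleC_left: "inner (c *\<^sub>C x) y = inner x (cnj c *\<^sub>C y)"
  by (simp add: Re_cinner[symmetric] cinner_scaleC_left cinner_scaleC_right)

lemma inner_scaleC_right: "inner x (c *\<^sub>C y) = Re (c * cinner x y)"
  by (simp add: Re_cinner[symmetric] cinner_scaleC_right)

lemma Im_cinner: "Im (cinner x y) = inner (\<i> *\<^sub>C x) y"
  by (simp add: Re_cinner[symmetric] cinner_scaleC_left)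

lemma cinner_eq_Complex: "cinner x y = Complex (inner x y) (inner (\<i> *\<^sub>C x) y)"
  by (simp add: complex_eq_iff Re_cinner Im_cinner)

lemma cinner_self: "cinner x x = complex_of_real ((norm x)\<^sup>2)"
proof -
  have "Im (cinner x x) = 0" using cinner_commute[of x x] by (metis Reals_cnj_iff complex_is_Real_iff)
  then show ?thesis by (simp add: complex_eq_iff Re_cinner power2_norm_eq_inner)
qed

lemma norm_scaleC: "norm (c *\<^sub>C x) = cmod c * norm x"
proof -
  have "cinner (c *\<^sub>C x) (c *\<^sub>C x) = (c * cnj c) * cinner x x"
    by (simp add: cinner_scaleC_left cinner_scaleC_right)
  then have "complex_of_real ((norm (c *\<^sub>C x))\<^sup>2) = complex_of_real ((cmod c * norm x)\<^sup>2)"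
    by (simp only: cinner_self complex_norm_square[symmetric] of_real_mult[symmetric]
        of_real_power[symmetric] power_mult_distrib)
  then have "(norm (c *\<^sub>C x))\<^sup>2 = (cmod c * norm x)\<^sup>2" by (simp only: of_real_eq_iff)
  then show ?thesis by (simp add: power2_eq_iff_nonneg)
qed

lemma scaleC_zero_right [simp]: "c *\<^sub>C 0 = 0"
  using norm_scaleC[of c 0] by simp

lemma scaleC_minus_right: "c *\<^sub>C (- x) = - (c *\<^sub>C x)"
  using scaleC_add_right[of c x "- x"] by (simp add: eq_neg_iff_add_eq_0 add.commute)

lemma scaleC_minus_left: "(- c) *\<^sub>C x = - (c *\<^sub>C x)"
  using scaleC_add_left[of c "- c" x] by (simp add: eq_neg_iff_add_eq_0 add.commute)

lemma scaleC_diff_right: "c *\<^sub>C (x - y) = c *\<^sub>C x - c *\<^sub>C y"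
  using scaleC_add_right[of c x "- y"] by (simp add: scaleC_minus_right)

lemma scaleC_diff_left: "(c - d) *\<^sub>C x = c *\<^sub>C x - d *\<^sub>C x"
  using scaleC_add_left[of c "- d" x] by (simp add: scaleC_minus_left)

lemma scaleC_scaleR: "c *\<^sub>C (r *\<^sub>R x) = r *\<^sub>R (c *\<^sub>C x)"
  by (simp add: scaleC_of_real[symmetric] scaleC_scaleC mult.commute)

lemma bounded_linear_scaleC: "bounded_linear (\<lambda>x::'h::complex_hilbert_space. c *\<^sub>C x)"
  by (rule bounded_linear_intro[where K = "cmod c"])
     (auto simp: scaleC_add_right scaleC_scaleR norm_scaleC)

lemma tendsto_scaleC: "(f \<longlongrightarrow> l) F \<Longrightarrow> ((\<lambda>x. c *\<^sub>C f x) \<longlongrightarrow> c *\<^sub>C (l::'h::complex_hilbert_space)) F"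
  by (rule bounded_linear.tendsto[OF bounded_linear_scaleC])

lemma tendsto_cinner:
  fixes a b :: "'h::complex_hilbert_space"
  assumes "(f \<longlongrightarrow> a) F" "(g \<longlongrightarrow> b) F"
  shows "((\<lambda>n. cinner (f n) (g n)) \<longlongrightarrow> cinner a b) F"
  unfolding cinner_eq_Complex using assms by (intro tendsto_Complex tendsto_intros tendsto_scaleC)

text \<open>Additivity is always provided by real linearity, so this asks for homogeneity only.\<close>

definition complex_linear :: "('h::complex_hilbert_space \<Rightarrow> 'h) \<Rightarrow> bool" where
  "complex_linear T \<longleftrightarrow> (\<forall>c x. T (c *\<^sub>C x) = c *\<^sub>C T x)"

lemma complex_linear_if_commuting:
  assumes "bounded_linear T" "commuting (\<lambda>x. \<i> *\<^sub>C x) T"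
  shows "complex_linear T"
proof -
  interpret bounded_linear T by fact
  have e: "c *\<^sub>C x = Re c *\<^sub>R x + Im c *\<^sub>R (\<i> *\<^sub>C x)" for c and x :: 'a
  proof -
    have "c = complex_of_real (Re c) + complex_of_real (Im c) * \<i>" by (simp add: complex_eq_iff)
    then have "c *\<^sub>C x = (complex_of_real (Re c) + complex_of_real (Im c) * \<i>) *\<^sub>C x"
      by (rule arg_cong)
    then show ?thesis by (simp only: scaleC_add_left scaleC_scaleC[symmetric] scaleC_of_real)
  qed
  have "\<i> *\<^sub>C T x = T (\<i> *\<^sub>C x)" for x using assms(2) commutingD by metis
  then show ?thesis unfolding complex_linear_def using e by (metis add scaleR)
qed

lemma cinner_symmetric_op:
  assumes "symmetric_op T" "complex_linear T"
  shows "cinner (T x) y = cinner x (T y)"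
  using symmetric_opD(2)[OF assms(1)] assms(2)
  by (metis cinner_eq_Complex complex_linear_def)

section \<open>The angle between two symmetries\<close>

definition symmetry :: "('h::complex_hilbert_space \<Rightarrow> 'h) \<Rightarrow> bool" where
  "symmetry J \<longleftrightarrow> symmetric_op J \<and> complex_linear J \<and> (\<forall>x. J (J x) = x)"

lemma symmetryD:
  assumes "symmetry J"
  shows "symmetric_op J" "J (c *\<^sub>C x) = c *\<^sub>C J x" "J (J x) = x"
  using assms by (auto simp: symmetry_def complex_linear_def)

lemma symmetry_product_accretive:
  fixes J Q R :: "'h::complex_hilbert_space \<Rightarrow> 'h"
  assumes J: "symmetry J" and Q: "symmetry Q" and \<alpha>: "cmod \<alpha> = 1"
    and R: "positive_op R" and inj: "\<And>x. R x = 0 \<Longrightarrow> x = 0"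
    and accr: "\<And>y. 0 \<le> Re (\<alpha> * cinner (R y) (J (Q y)))"
  shows "0 \<le> Re (\<alpha> * cinner y (J (Q y)))"
proof -
  note j = symmetric_opD[OF symmetryD(1)[OF J]] and q = symmetric_opD[OF symmetryD(1)[OF Q]]
  have \<alpha>1: "\<alpha> * cnj \<alpha> = 1" "cnj \<alpha> * \<alpha> = 1" using \<alpha> complex_norm_square[of \<alpha>] by (auto simp: mult.commute)
  have "0 \<le> inner y (\<alpha> *\<^sub>C J (Q y))"
  proof (rule unitary_accretive_if_form_accretive[where B' = "\<lambda>x. Q (J (cnj \<alpha> *\<^sub>C x))" and R = R])
    show "bounded_linear (\<lambda>x. \<alpha> *\<^sub>C J (Q x))"
      by (intro bounded_linear_compose[OF bounded_linear_scaleC] bounded_linear_compose[OF j(1) q(1)])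
    show "bounded_linear (\<lambda>x. Q (J (cnj \<alpha> *\<^sub>C x)))"
      by (intro bounded_linear_compose[OF q(1)] bounded_linear_compose[OF j(1)] bounded_linear_scaleC)
    show "inner (\<alpha> *\<^sub>C J (Q x)) y = inner x (Q (J (cnj \<alpha> *\<^sub>C y)))" for x y
      by (simp only: inner_scaleC_left j(2) q(2))
    show "\<alpha> *\<^sub>C J (Q (Q (J (cnj \<alpha> *\<^sub>C x)))) = x" "Q (J (cnj \<alpha> *\<^sub>C \<alpha> *\<^sub>C J (Q x))) = x" for x
      by (simp_all add: symmetryD(3)[OF J] symmetryD(3)[OF Q] scaleC_scaleC \<alpha>1)
    show "0 \<le> inner (R y) (\<alpha> *\<^sub>C J (Q y))" for y using accr by (simp add: inner_scaleC_right)
  qed (use R inj in auto)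
  then show ?thesis by (simp add: inner_scaleC_right)
qed

text \<open>For the unitary \<open>U = J Q\<close> the accretivity of \<open>\<alpha> U\<close> and \<open>\<alpha>\<^sup>* U\<close>, where \<open>\<alpha>\<close> is the unit vector
  in the direction \<open>k + \<i>\<close>, confines the spectrum of \<open>U\<close> to an arc. In operator terms: with \<open>C = Re U\<close> the product
  of the commuting positive operators \<open>Re (\<alpha> U)\<close> and \<open>Re (\<alpha>\<^sup>* U)\<close> is \<open>C\<^sup>2 - cos\<^sup>2 (arctan k)\<close>, so that
  \<open>\<parallel>C y\<parallel> \<ge> cos (arctan k) \<parallel>y\<parallel>\<close>, and \<open>C\<close> itself is positive by the accretivity of \<open>U\<close>.\<close>

lemma symmetry_product_sector:
  fixes J Q R :: "'h::complex_hilbert_space \<Rightarrow> 'h"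
  assumes J: "symmetry J" and Q: "symmetry Q" and k: "0 \<le> k"
    and R: "positive_op R" and inj: "\<And>x. R x = 0 \<Longrightarrow> x = 0"
    and sector: "\<And>y. \<bar>Im (cinner (R y) (J (Q y)))\<bar> \<le> k * Re (cinner (R y) (J (Q y)))"
    and accr: "\<And>y. 0 \<le> Re (cinner (R y) (J (Q y)))"
  shows "cos (arctan k) * (norm y)\<^sup>2 \<le> inner y (J (Q y))"
proof -
  note j = symmetric_opD[OF symmetryD(1)[OF J]] and q = symmetric_opD[OF symmetryD(1)[OF Q]]
  note j' = symmetryD(2,3)[OF J] and q' = symmetryD(2,3)[OF Q]
  define s where "s = sqrt (1 + k\<^sup>2)"
  have s: "s > 0" "s\<^sup>2 = 1 + k\<^sup>2" by (auto simp: s_def add_pos_nonneg)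
  define \<alpha> where "\<alpha> = Complex (k / s) (1 / s)"
  have "(cmod \<alpha>)\<^sup>2 = (k\<^sup>2 + 1) / s\<^sup>2"
    unfolding cmod_power2 by (simp add: \<alpha>_def power_divide add_divide_distrib)
  also have "k\<^sup>2 + 1 = s\<^sup>2" using s(2) by simp
  finally have "(cmod \<alpha>)\<^sup>2 = s\<^sup>2 / s\<^sup>2" .
  then have "(cmod \<alpha>)\<^sup>2 = 1\<^sup>2" using s(1) by simp
  then have mod: "cmod \<alpha> = 1" by (rule power2_eq_imp_eq) auto
  then have mod': "cmod (cnj \<alpha>) = 1" by simp
  have acc: "0 \<le> Re (\<beta> * cinner (R y) (J (Q y)))" if "\<beta> = \<alpha> \<or> \<beta> = cnj \<alpha>" for \<beta> y
  proof -
    define w where "w = cinner (R y) (J (Q y))"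
    have "\<bar>Im w\<bar> \<le> k * Re w" using sector by (simp add: w_def)
    then have "0 \<le> (k * Re w - Im w) / s" "0 \<le> (k * Re w + Im w) / s"
      using s(1) by (auto intro!: divide_nonneg_pos)
    then show ?thesis using that
      by (auto simp: \<alpha>_def w_def[symmetric] diff_divide_distrib add_divide_distrib)
  qed
  have pos: "0 \<le> Re (\<beta> * cinner y (J (Q y)))" if "\<beta> = \<alpha> \<or> \<beta> = cnj \<alpha>" for \<beta> y
    using symmetry_product_accretive[OF J Q _ R inj acc[OF that]] that mod mod' by auto
  \<comment> \<open>This is twice the real part of \<open>\<beta> U\<close>; for \<open>\<beta> = 1/2\<close> it is the real part of \<open>U\<close>.\<close>
  define X where "X \<beta> = (\<lambda>y. \<beta> *\<^sub>C J (Q y) + cnj \<beta> *\<^sub>C Q (J y))" for \<beta>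
  have symX: "symmetric_op (X \<beta>)" for \<beta>
    unfolding symmetric_op_def
  proof (intro conjI allI)
    show "bounded_linear (X \<beta>)" unfolding X_def
      by (intro bounded_linear_add bounded_linear_compose[OF bounded_linear_scaleC]
          bounded_linear_compose[OF j(1) q(1)] bounded_linear_compose[OF q(1) j(1)])
    show "inner (X \<beta> x) y = inner x (X \<beta> y)" for x y
      by (simp add: X_def inner_add_left inner_add_right inner_scaleC_left j(2) q(2) j' q')
  qed
  have formX: "inner y (X \<beta> y) = 2 * Re (\<beta> * cinner y (J (Q y)))" for \<beta> y
  proof -
    have "inner y (cnj \<beta> *\<^sub>C Q (J y)) = inner (\<beta> *\<^sub>C J (Q y)) y"
      by (simp add: inner_scaleC_left j(2) q(2) j' q')
    then have "inner y (X \<beta> y) = 2 * inner y (\<beta> *\<^sub>C J (Q y))"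
      by (simp add: X_def inner_add_right inner_commute)
    then show ?thesis by (simp only: inner_scaleC_right)
  qed
  have "positive_op (X \<beta>)" if "\<beta> = \<alpha> \<or> \<beta> = cnj \<alpha>" for \<beta>
  proof -
    have "0 \<le> inner y (X \<beta> y)" for y unfolding formX using pos[OF that, of y] by linarith
    then show ?thesis using symX by (simp add: positive_op_def)
  qed
  then have posX: "positive_op (X \<alpha>)" "positive_op (X (cnj \<alpha>))" by blast+
  have XX: "X \<beta> (X \<gamma> y) = (\<beta> * \<gamma>) *\<^sub>C J (Q (J (Q y))) + (\<beta> * cnj \<gamma> + cnj \<beta> * \<gamma>) *\<^sub>C y
      + (cnj \<beta> * cnj \<gamma>) *\<^sub>C Q (J (Q (J y)))" for \<beta> \<gamma> y
    by (simp add: X_def j(3) q(3) j' q' scaleC_add_right scaleC_add_left scaleC_scaleC algebra_simps)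
  have "commuting (X (cnj \<alpha>)) (X \<alpha>)" by (simp add: commuting_def XX mult.commute add.commute)
  from positive_op_commuting_product[OF posX(1) posX(2) this]
  have prod: "0 \<le> inner y (X \<alpha> (X (cnj \<alpha>) y))" for y .
  have \<alpha>1: "\<alpha> * cnj \<alpha> = 1" "cnj \<alpha> * \<alpha> = 1" using mod complex_norm_square[of \<alpha>] by (auto simp: mult.commute)
  have \<alpha>2: "\<alpha> * \<alpha> + cnj \<alpha> * cnj \<alpha> = complex_of_real (2 - 4 / s\<^sup>2)"
  proof -
    have "2 * ((k / s)\<^sup>2 - (1 / s)\<^sup>2) = 2 - 4 / s\<^sup>2"
    proof -
      have "k\<^sup>2 = s\<^sup>2 - 1" using s(2) by simp
      then have "2 * ((k / s)\<^sup>2 - (1 / s)\<^sup>2) = 2 * ((s\<^sup>2 - 1) / s\<^sup>2 - 1 / s\<^sup>2)"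
        by (simp add: power_divide)
      then show ?thesis using s(1) by (simp add: diff_divide_distrib)
    qed
    then show ?thesis by (simp add: complex_eq_iff \<alpha>_def power2_eq_square)
  qed
  define C where "C = X (1/2)"
  have CC: "X \<alpha> (X (cnj \<alpha>) y) = 4 *\<^sub>R C (C y) - (4 / s\<^sup>2) *\<^sub>R y" for y
  proof -
    have "X \<alpha> (X (cnj \<alpha>) y) = J (Q (J (Q y))) + (2 - 4 / s\<^sup>2) *\<^sub>R y + Q (J (Q (J y)))"
      unfolding XX using \<alpha>1 \<alpha>2 by (simp add: scaleC_of_real[symmetric])
    moreover have "4 *\<^sub>R C (C y) = J (Q (J (Q y))) + 2 *\<^sub>R y + Q (J (Q (J y)))"
      unfolding C_def XX by (simp add: scaleC_of_real[symmetric] scaleC_add_right scaleC_scaleC)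
    ultimately show ?thesis by (simp add: scaleR_diff_left)
  qed
  have "0 \<le> Re (1 * cinner y (J (Q y)))" for y
    using accr by (intro symmetry_product_accretive[OF J Q _ R inj]) auto
  then have "0 \<le> inner y (C y)" for y unfolding C_def formX by simp
  then have posC: "positive_op C" using symX by (simp add: positive_op_def C_def)
  have "cos (arctan k) * norm y \<le> norm (C y)" for y
  proof (rule power2_le_imp_le)
    have "0 \<le> 4 * inner y (C (C y)) - 4 / s\<^sup>2 * inner y y"
      using prod[of y] by (simp add: CC inner_diff_right)
    also have "inner y (C (C y)) = (norm (C y))\<^sup>2"
      by (simp only: power2_norm_eq_inner symmetric_opD(2)[OF positive_opD(1)[OF posC]])
    finally have "1 / s\<^sup>2 * (norm y)\<^sup>2 \<le> (norm (C y))\<^sup>2" by (simp add: power2_norm_eq_inner)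
    moreover have "(cos (arctan k))\<^sup>2 = 1 / s\<^sup>2" by (simp add: cos_arctan s_def power_divide)
    ultimately show "(cos (arctan k) * norm y)\<^sup>2 \<le> (norm (C y))\<^sup>2" by (simp add: power_mult_distrib)
  qed simp
  from positive_op_lower_bound[OF posC this, of y] formX[of y "1/2"]
  show ?thesis by (simp add: C_def Re_cinner)
qed

lemma symmetry_difference_norm:
  fixes J Q :: "'h::complex_hilbert_space \<Rightarrow> 'h"
  assumes J: "symmetry J" and Q: "symmetry Q" and \<theta>: "0 \<le> \<theta>" "\<theta> \<le> pi"
    and angle: "cos \<theta> * (norm y)\<^sup>2 \<le> inner y (J (Q y))"
  shows "norm (J y - Q y) \<le> 2 * sin (\<theta> / 2) * norm y"
proof (rule power2_le_imp_le)
  note j = symmetric_opD[OF symmetryD(1)[OF J]] and q = symmetric_opD[OF symmetryD(1)[OF Q]]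
  have "inner (J y) (J y) = inner y y" "inner (Q y) (Q y) = inner y y" "inner (J y) (Q y) = inner y (J (Q y))"
    by (simp_all add: j(2) q(2) symmetryD[OF J] symmetryD[OF Q])
  then have "(norm (J y - Q y))\<^sup>2 = 2 * (norm y)\<^sup>2 - 2 * inner y (J (Q y))"
    unfolding power2_norm_eq_inner by (simp add: inner_diff_left inner_diff_right inner_commute[of "Q y" "J y"])
  also have "\<dots> \<le> 2 * (1 - cos \<theta>) * (norm y)\<^sup>2" using angle by (simp add: algebra_simps)
  also have "1 - cos \<theta> = 2 * (sin (\<theta> / 2))\<^sup>2"
    using cos_double_sin[of "\<theta> / 2"] by simp
  finally show "(norm (J y - Q y))\<^sup>2 \<le> (2 * sin (\<theta> / 2) * norm y)\<^sup>2" by (simp add: power_mult_distrib)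
  show "0 \<le> 2 * sin (\<theta> / 2) * norm y" using \<theta> by (simp add: sin_ge_zero)
qed

section \<open>Self-adjoint operators and their resolvents\<close>

lemma linear_operatorD:
  assumes "linear_operator T"
  shows "(0, 0) \<in> T" "(x, y) \<in> T \<Longrightarrow> (x', y') \<in> T \<Longrightarrow> (x + x', y + y') \<in> T"
    "(x, y) \<in> T \<Longrightarrow> (c *\<^sub>C x, c *\<^sub>C y) \<in> T" "(x, y) \<in> T \<Longrightarrow> (x, y') \<in> T \<Longrightarrow> y = y'"
    "(x, y) \<in> T \<Longrightarrow> (r *\<^sub>R x, r *\<^sub>R y) \<in> T"
    "(x, y) \<in> T \<Longrightarrow> (x', y') \<in> T \<Longrightarrow> (x - x', y - y') \<in> T"
proof -
  note l = assms[unfolded linear_operator_def]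
  show zero: "(0, 0) \<in> T" using l by blast
  show add: "(x, y) \<in> T \<Longrightarrow> (x', y') \<in> T \<Longrightarrow> (x + x', y + y') \<in> T" for x y x' y' using l by blast
  show scale: "(x, y) \<in> T \<Longrightarrow> (c *\<^sub>C x, c *\<^sub>C y) \<in> T" for c x y using l by blast
  show "(x, y) \<in> T \<Longrightarrow> (x, y') \<in> T \<Longrightarrow> y = y'" using l by (auto simp: single_valued_def)
  show "(x, y) \<in> T \<Longrightarrow> (r *\<^sub>R x, r *\<^sub>R y) \<in> T" using scale[of x y "complex_of_real r"] by (simp add: scaleC_of_real)
  show "(x, y) \<in> T \<Longrightarrow> (x', y') \<in> T \<Longrightarrow> (x - x', y - y') \<in> T"
    using add[of x y "- x'" "- y'"] scale[of x' y' "- 1"] by (simp add: scaleC_minus_left)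
qed

lemma app_eq: "linear_operator T \<Longrightarrow> (x, y) \<in> T \<Longrightarrow> app T x = y"
  unfolding app_def using linear_operatorD(4) by (intro the_equality) blast+

lemma self_adjoint_linear: "self_adjoint T \<Longrightarrow> linear_operator T"
  by (simp add: self_adjoint_def)

lemma self_adjoint_cinner:
  assumes "self_adjoint T" "(x, y) \<in> T" "(u, v) \<in> T"
  shows "cinner v x = cinner u y"
proof -
  have "(x, y) \<in> op_adjoint T" using assms by (simp add: self_adjoint_def)
  then show ?thesis using assms(3) by (auto simp: op_adjoint_def)
qed

lemma self_adjoint_inner:
  "self_adjoint T \<Longrightarrow> (x, y) \<in> T \<Longrightarrow> (u, v) \<in> T \<Longrightarrow> inner v x = inner u y"
  using self_adjoint_cinner[of T x y u v] by (simp add: Re_cinner[symmetric])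

lemma self_adjoint_memI:
  assumes "self_adjoint T" "\<And>u v. (u, v) \<in> T \<Longrightarrow> cinner v x = cinner u y"
  shows "(x, y) \<in> T"
proof -
  have "(x, y) \<in> op_adjoint T" using assms(2) by (simp add: op_adjoint_def)
  then show ?thesis using assms(1) by (simp add: self_adjoint_def)
qed

lemma self_adjoint_closed:
  assumes "self_adjoint T" "\<And>n. (f n, g n) \<in> T" "f \<longlonglongrightarrow> x" "g \<longlonglongrightarrow> y"
  shows "(x, y) \<in> T"
proof (rule self_adjoint_memI[OF assms(1)])
  fix u v assume uv: "(u, v) \<in> T"
  have "(\<lambda>n. cinner v (f n)) \<longlonglongrightarrow> cinner v x" "(\<lambda>n. cinner u (g n)) \<longlonglongrightarrow> cinner u y"
    by (intro tendsto_cinner tendsto_const assms)+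
  moreover have "cinner v (f n) = cinner u (g n)" for n by (rule self_adjoint_cinner[OF assms(1,2) uv])
  ultimately show "cinner v x = cinner u y" using LIMSEQ_unique by auto
qed

lemma self_adjoint_dense:
  fixes x :: "'h::complex_hilbert_space"
  assumes "self_adjoint T"
  obtains f where "\<And>n. f n \<in> Domain T" "f \<longlonglongrightarrow> x"
proof -
  have "x \<in> closure (Domain T)" using assms by (simp add: self_adjoint_def densely_defined_def)
  then show ?thesis using that by (auto simp: closure_sequential)
qed

text \<open>The domain of a self-adjoint operator is dense.\<close>

lemma continuous_eq_on_Domain:
  fixes f g :: "'h::complex_hilbert_space \<Rightarrow> 'b::real_normed_vector"
  assumes "self_adjoint T" "bounded_linear f" "bounded_linear g" "\<And>x. x \<in> Domain T \<Longrightarrow> f x = g x"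
  shows "f x = g x"
proof -
  obtain s where s: "\<And>n. s n \<in> Domain T" "s \<longlonglongrightarrow> x" using self_adjoint_dense[OF assms(1)] by blast
  have "(\<lambda>n. f (s n)) \<longlonglongrightarrow> f x" "(\<lambda>n. g (s n)) \<longlonglongrightarrow> g x"
    by (intro bounded_linear.tendsto[OF assms(2)] bounded_linear.tendsto[OF assms(3)] s)+
  moreover have "f (s n) = g (s n)" for n using assms(4) s(1) by auto
  ultimately show ?thesis using LIMSEQ_unique by auto
qed

lemma self_adjoint_Im: "self_adjoint T \<Longrightarrow> (x, y) \<in> T \<Longrightarrow> Im (cinner x y) = 0"
  using self_adjoint_cinner[of T x y x y] cinner_commute[of x y]
  by (metis Reals_cnj_iff complex_is_Real_iff)

text \<open>The lower bound and the closedness of \<open>T\<close> make the range of \<open>T - z\<close> closed. A vector orthogonal to the range is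
  an eigenvector of the adjoint, that is of \<open>T\<close>, for the conjugate of \<open>z\<close>.\<close>

lemma resolvent_exists:
  fixes T :: "'h::complex_hilbert_space operator"
  assumes T: "self_adjoint T" and c: "c > 0"
    and lower: "\<And>x y. (x, y) \<in> T \<Longrightarrow> c * norm x \<le> norm (y - z *\<^sub>C x)"
    and inj: "\<And>x. (x, cnj z *\<^sub>C x) \<in> T \<Longrightarrow> x = 0"
  shows "\<exists>R. bounded_linear R \<and> complex_linear R \<and>
    (\<forall>x y. (x, y) \<in> T \<longrightarrow> R (y - z *\<^sub>C x) = x) \<and> (\<forall>y. (R y, y + z *\<^sub>C R y) \<in> T)"
proof -
  note l = linear_operatorD[OF self_adjoint_linear[OF T]]
  define M where "M = {y - z *\<^sub>C x | x y. (x, y) \<in> T}"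
  have MI: "y - z *\<^sub>C x \<in> M" if "(x, y) \<in> T" for x y using that by (auto simp: M_def)
  have "M = UNIV"
  proof (rule closed_subspace_UNIV)
    show "subspace M"
      unfolding subspace_def
    proof (intro conjI ballI allI)
      show "0 \<in> M" using MI[OF l(1)] by simp
      fix a assume "a \<in> M"
      then obtain x y where a: "(x, y) \<in> T" "a = y - z *\<^sub>C x" by (auto simp: M_def)
      show "r *\<^sub>R a \<in> M" for r
        using MI[OF l(5)[OF a(1), of r]] by (simp add: a(2) scaleC_scaleR scaleR_diff_right)
      fix b assume "b \<in> M"
      then obtain x' y' where b: "(x', y') \<in> T" "b = y' - z *\<^sub>C x'" by (auto simp: M_def)
      show "a + b \<in> M"
        using MI[OF l(2)[OF a(1) b(1)]] by (simp add: a(2) b(2) scaleC_add_right algebra_simps)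
    qed
    show "closed M"
      unfolding closed_sequential_limits
    proof (intro allI impI, elim conjE)
      fix f a assume f: "\<forall>n. f n \<in> M" "f \<longlonglongrightarrow> a"
      then have "\<forall>n. \<exists>x y. (x, y) \<in> T \<and> f n = y - z *\<^sub>C x" unfolding M_def by blast
      then obtain x y where xy: "\<And>n. (x n, y n) \<in> T" "\<And>n. f n = y n - z *\<^sub>C x n" by metis
      have "Cauchy f" using f(2) by (rule LIMSEQ_imp_Cauchy)
      then have "Cauchy x"
      proof (rule Cauchy_if_power_dist_le[where p = 1 and K = "1 / c"])
        fix m n
        have "c * norm (x m - x n) \<le> norm ((y m - y n) - z *\<^sub>C (x m - x n))"
          by (rule lower[OF l(6)[OF xy(1) xy(1)]])
        also have "(y m - y n) - z *\<^sub>C (x m - x n) = f m - f n"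
          by (simp add: xy(2) scaleC_diff_right algebra_simps)
        finally show "dist (x m) (x n) ^ 1 \<le> 1 / c * dist (f m) (f n)" using c by (simp add: dist_norm field_simps)
      qed
      then obtain u where u: "x \<longlonglongrightarrow> u" using Cauchy_convergent convergent_def by blast
      have "(\<lambda>n. f n + z *\<^sub>C x n) \<longlonglongrightarrow> a + z *\<^sub>C u" by (intro tendsto_add f tendsto_scaleC u)
      then have "y \<longlonglongrightarrow> a + z *\<^sub>C u" by (simp add: xy(2))
      from self_adjoint_closed[OF T xy(1) u this] have "(u, a + z *\<^sub>C u) \<in> T" .
      from MI[OF this] show "a \<in> M" by simp
    qed
    fix u assume orth: "\<And>m. m \<in> M \<Longrightarrow> inner u m = 0"
    have "(u, cnj z *\<^sub>C u) \<in> T"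
    proof (rule self_adjoint_memI[OF T])
      fix x y assume xy: "(x, y) \<in> T"
      have "inner (d *\<^sub>C u) (y - z *\<^sub>C x) = 0" for d
      proof -
        have "inner u (cnj d *\<^sub>C y - z *\<^sub>C (cnj d *\<^sub>C x)) = 0" by (rule orth[OF MI[OF l(3)[OF xy]]])
        then show ?thesis
          by (simp add: inner_scaleC_left scaleC_diff_right scaleC_scaleC mult.commute)
      qed
      from this[of 1] this[of \<i>] have "cinner u (y - z *\<^sub>C x) = 0" by (simp add: cinner_eq_Complex complex_eq_iff)
      moreover have "cinner u (y - z *\<^sub>C x) = cinner u y - z * cinner u x"
        using cinner_add_right[of u "y - z *\<^sub>C x" "z *\<^sub>C x"] by (simp add: cinner_scaleC_right)
      ultimately have "cnj (cinner u y) = cnj (z * cinner u x)" by simp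
      then show "cinner y u = cinner x (cnj z *\<^sub>C u)"
        by (simp add: cinner_scaleC_right cinner_commute[symmetric])
    qed
    then show "u = 0" by (rule inj)
  qed
  then have "\<exists>x. (x, y + z *\<^sub>C x) \<in> T" for y
  proof -
    have "y \<in> M" using \<open>M = UNIV\<close> by simp
    then obtain x w where "(x, w) \<in> T" "y = w - z *\<^sub>C x" by (auto simp: M_def)
    then show ?thesis by (intro exI[of _ x]) simp
  qed
  then obtain R where R: "\<And>y. (R y, y + z *\<^sub>C R y) \<in> T" by metis
  have uniq: "x = x'" if "(x, y + z *\<^sub>C x) \<in> T" "(x', y + z *\<^sub>C x') \<in> T" for x x' y
  proof -
    have "c * norm (x - x') \<le> norm ((y + z *\<^sub>C x) - (y + z *\<^sub>C x') - z *\<^sub>C (x - x'))"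
      by (rule lower[OF l(6)[OF that]])
    then have "c * norm (x - x') \<le> 0" by (simp add: scaleC_diff_right)
    then show ?thesis using c by (simp add: mult_le_0_iff)
  qed
  have left: "R (y - z *\<^sub>C x) = x" if "(x, y) \<in> T" for x y
    using R[of "y - z *\<^sub>C x"] that by (intro uniq[of _ "y - z *\<^sub>C x"]) auto
  have "bounded_linear R"
  proof (rule bounded_linear_intro[where K = "1 / c"])
    show "R (x + y) = R x + R y" for x y
      using R[of "x + y"] l(2)[OF R[of x] R[of y]]
      by (intro uniq[of _ "x + y"]) (auto simp: scaleC_add_right algebra_simps)
    show "R (r *\<^sub>R x) = r *\<^sub>R R x" for r x
      using R[of "r *\<^sub>R x"] l(5)[OF R[of x], of r]
      by (intro uniq[of _ "r *\<^sub>R x"]) (auto simp: scaleC_scaleR algebra_simps)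
    show "norm (R x) \<le> norm x * (1 / c)" for x
      using lower[OF R[of x]] c by (simp add: field_simps)
  qed
  moreover have "complex_linear R"
    unfolding complex_linear_def
  proof (intro allI)
    show "R (d *\<^sub>C x) = d *\<^sub>C R x" for d x
      using R[of "d *\<^sub>C x"] l(3)[OF R[of x], of d]
      by (intro uniq[of _ "d *\<^sub>C x"]) (auto simp: scaleC_scaleC scaleC_add_right mult.commute)
  qed
  ultimately show ?thesis using left R by blast
qed

text \<open>The form of \<open>T\<close> is real, so the imaginary part of \<open>\<langle>x, (T - z) x\<rangle>\<close> is \<open>- Im z \<parallel>x\<parallel>\<^sup>2\<close>.\<close>

lemma nonreal_lower_bound:
  assumes T: "self_adjoint T" and xy: "(x, y) \<in> T"
  shows "\<bar>Im z\<bar> * norm x \<le> norm (y - z *\<^sub>C x)"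
proof (cases "x = 0")
  case False
  have "cinner x (y - z *\<^sub>C x) = cinner x y - z * complex_of_real ((norm x)\<^sup>2)"
    using cinner_add_right[of x "y - z *\<^sub>C x" "z *\<^sub>C x"] by (simp add: cinner_scaleC_right cinner_self)
  then have "inner (\<i> *\<^sub>C x) (y - z *\<^sub>C x) = - Im z * (norm x)\<^sup>2"
    using self_adjoint_Im[OF T xy] by (simp add: Im_cinner[symmetric])
  moreover have "\<bar>inner (\<i> *\<^sub>C x) (y - z *\<^sub>C x)\<bar> \<le> norm x * norm (y - z *\<^sub>C x)"
    using Cauchy_Schwarz_ineq2[of "\<i> *\<^sub>C x"] by (simp add: norm_scaleC)
  ultimately have "\<bar>- Im z * (norm x)\<^sup>2\<bar> \<le> norm x * norm (y - z *\<^sub>C x)" by (simp only:)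
  then have "norm x * (\<bar>Im z\<bar> * norm x) \<le> norm x * norm (y - z *\<^sub>C x)"
    by (simp add: abs_mult power2_eq_square mult.left_commute)
  then show ?thesis using False by simp
qed simp

text \<open>For nonreal \<open>z\<close> the choice is the inverse of \<open>T - z\<close>; see the lemma of the same name.\<close>

definition resolvent :: "'h::complex_hilbert_space operator \<Rightarrow> complex \<Rightarrow> 'h \<Rightarrow> 'h" where
  "resolvent T z = (SOME R. bounded_linear R \<and> complex_linear R \<and>
    (\<forall>x y. (x, y) \<in> T \<longrightarrow> R (y - z *\<^sub>C x) = x) \<and> (\<forall>y. (R y, y + z *\<^sub>C R y) \<in> T))"

lemma resolvent:
  assumes T: "self_adjoint T" and z: "Im z \<noteq> 0"
  shows "bounded_linear (resolvent T z)" "complex_linear (resolvent T z)"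
    "(x, y) \<in> T \<Longrightarrow> resolvent T z (y - z *\<^sub>C x) = x"
    "(resolvent T z y, y + z *\<^sub>C resolvent T z y) \<in> T"
proof -
  have inj: "x = 0" if "(x, cnj z *\<^sub>C x) \<in> T" for x
    using nonreal_lower_bound[OF T that, of "cnj z"] z by (simp add: mult_le_0_iff)
  have "\<bar>Im z\<bar> > 0" using z by simp
  from resolvent_exists[OF T this nonreal_lower_bound[OF T] inj]
  have "bounded_linear (resolvent T z) \<and> complex_linear (resolvent T z) \<and>
    (\<forall>x y. (x, y) \<in> T \<longrightarrow> resolvent T z (y - z *\<^sub>C x) = x) \<and>
    (\<forall>y. (resolvent T z y, y + z *\<^sub>C resolvent T z y) \<in> T)"
    unfolding resolvent_def by (rule someI_ex)
  then show "bounded_linear (resolvent T z)" "complex_linear (resolvent T z)"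
    "(x, y) \<in> T \<Longrightarrow> resolvent T z (y - z *\<^sub>C x) = x"
    "(resolvent T z y, y + z *\<^sub>C resolvent T z y) \<in> T" by blast+
qed

lemma spectrum_real:
  assumes "self_adjoint T" "z \<in> spectrum T"
  shows "Im z = 0"
proof (rule ccontr)
  assume "Im z \<noteq> 0"
  from resolvent[OF assms(1) this] have "z \<in> resolvent_set T" unfolding resolvent_set_def by blast
  then show False using assms(2) by (simp add: spectrum_def)
qed

lemma resolvent_adjoint:
  assumes T: "self_adjoint T" and z: "Im z \<noteq> 0"
  shows "inner (resolvent T z x) y = inner x (resolvent T (cnj z) y)"
proof -
  let ?a = "resolvent T z x" and ?b = "resolvent T (cnj z) y"
  have z': "Im (cnj z) \<noteq> 0" using z by simp
  have "cinner (x + z *\<^sub>C ?a) ?b = cinner ?a (y + cnj z *\<^sub>C ?b)"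
    by (rule self_adjoint_cinner[OF T resolvent(4)[OF T z'] resolvent(4)[OF T z]])
  then have "cinner x ?b = cinner ?a y"
    by (simp add: cinner_add_left cinner_add_right cinner_scaleC_left cinner_scaleC_right)
  then show ?thesis by (simp add: Re_cinner[symmetric])
qed

text \<open>By the resolvent identity \<open>R\<^sub>z - R\<^sub>w = (z - w) R\<^sub>z R\<^sub>w\<close>, whose left-hand side is antisymmetric in \<open>z\<close> and \<open>w\<close>.\<close>

lemma resolvent_commuting:
  assumes T: "self_adjoint T" and z: "Im z \<noteq> 0" and w: "Im w \<noteq> 0"
  shows "resolvent T z (resolvent T w x) = resolvent T w (resolvent T z x)"
proof (cases "z = w")
  case False
  have identity: "resolvent T z x + (w - z) *\<^sub>C resolvent T z (resolvent T w x) = resolvent T w x"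
    if z: "Im z \<noteq> 0" and w: "Im w \<noteq> 0" for z w
  proof -
    interpret bounded_linear "resolvent T z" by (rule resolvent[OF T z])
    let ?a = "resolvent T w x"
    have "resolvent T z (x + w *\<^sub>C ?a - z *\<^sub>C ?a) = ?a"
      by (rule resolvent(3)[OF T z resolvent(4)[OF T w]])
    moreover have "x + w *\<^sub>C ?a - z *\<^sub>C ?a = x + (w - z) *\<^sub>C ?a" by (simp add: scaleC_diff_left)
    ultimately show ?thesis
      using resolvent(2)[OF T z] by (simp add: add complex_linear_def)
  qed
  have "(w - z) *\<^sub>C resolvent T z (resolvent T w x) = resolvent T w x - resolvent T z x"
    using identity[OF z w] by (simp add: eq_diff_eq add.commute)
  moreover have "(z - w) *\<^sub>C resolvent T w (resolvent T z x) = resolvent T z x - resolvent T w x"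
    using identity[OF w z] by (simp add: eq_diff_eq add.commute)
  then have "(w - z) *\<^sub>C resolvent T w (resolvent T z x) = resolvent T w x - resolvent T z x"
    using scaleC_minus_left[of "z - w" "resolvent T w (resolvent T z x)"] by simp
  ultimately have "(w - z) *\<^sub>C (resolvent T z (resolvent T w x) - resolvent T w (resolvent T z x)) = 0"
    by (simp add: scaleC_diff_right)
  then have "cmod (w - z) * norm (resolvent T z (resolvent T w x) - resolvent T w (resolvent T z x)) = 0"
    by (metis norm_scaleC norm_zero)
  then show ?thesis using False by simp
qed simp

text \<open>For a projector this says that its range reduces \<open>T\<close>.\<close>

definition graph_invariant :: "('h \<Rightarrow> 'h) \<Rightarrow> 'h operator \<Rightarrow> bool" where
  "graph_invariant C T \<longleftrightarrow> (\<forall>x y. (x, y) \<in> T \<longrightarrow> (C x, C y) \<in> T)"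

lemma graph_invariantD: "graph_invariant C T \<Longrightarrow> (x, y) \<in> T \<Longrightarrow> (C x, C y) \<in> T"
  by (auto simp: graph_invariant_def)

lemma graph_invariant_if_commuting_resolvent:
  assumes T: "self_adjoint T" and C: "bounded_linear C" "complex_linear C"
    and comm: "commuting C (resolvent T \<i>)"
  shows "graph_invariant C T"
  unfolding graph_invariant_def
proof (intro allI impI)
  fix x y assume xy: "(x, y) \<in> T"
  interpret bounded_linear C by fact
  have i: "Im \<i> \<noteq> 0" by simp
  define v where "v = y - \<i> *\<^sub>C x"
  have x: "resolvent T \<i> v = x" unfolding v_def by (rule resolvent(3)[OF T i xy])
  have Cx: "resolvent T \<i> (C v) = C x" using commutingD[OF comm, of v] x by simp
  have "C v + \<i> *\<^sub>C C x = C y" using C(2) by (simp add: v_def diff complex_linear_def)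
  then show "(C x, C y) \<in> T" using resolvent(4)[OF T i, of "C v"] Cx by simp
qed

section \<open>The spectral family\<close>

text \<open>The bounded operator \<open>(T - l) ((T - l)\<^sup>2 + 1)\<^sup>-\<^sup>1\<close>, which has the sign of \<open>T - l\<close>.\<close>

definition bounded_shift :: "'h::complex_hilbert_space operator \<Rightarrow> real \<Rightarrow> 'h \<Rightarrow> 'h" where
  "bounded_shift T l x = (1/2) *\<^sub>R resolvent T (Complex l 1) x + (1/2) *\<^sub>R resolvent T (Complex l (- 1)) x"

lemma symmetric_op_bounded_shift:
  assumes T: "self_adjoint T"
  shows "symmetric_op (bounded_shift T l)"
  unfolding symmetric_op_def
proof (intro conjI allI)
  have p: "Im (Complex l 1) \<noteq> 0" and m: "Im (Complex l (- 1)) \<noteq> 0" by auto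
  show "bounded_linear (bounded_shift T l)" unfolding bounded_shift_def[abs_def]
    by (intro bounded_linear_add bounded_linear_compose[OF bounded_linear_scaleR_right] resolvent(1)[OF T p]
        resolvent(1)[OF T m])
  have "cnj (Complex l 1) = Complex l (- 1)" "cnj (Complex l (- 1)) = Complex l 1" by (simp_all add: complex_eq_iff)
  then show "inner (bounded_shift T l x) y = inner x (bounded_shift T l y)" for x y
    using resolvent_adjoint[OF T p, of x y] resolvent_adjoint[OF T m, of x y]
    by (simp add: bounded_shift_def inner_add_left inner_add_right)
qed

lemma bounded_shift_form:
  assumes T: "self_adjoint T" and yw: "(y, w) \<in> T" and v: "v = w - Complex l 1 *\<^sub>C y"
  shows "inner v (bounded_shift T l v) = inner y w - l * (norm y)\<^sup>2"
proof -
  have p: "Im (Complex l 1) \<noteq> 0" by simp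
  have y: "resolvent T (Complex l 1) v = y" unfolding v by (rule resolvent(3)[OF T p yw])
  have "cnj (Complex l 1) = Complex l (- 1)" by (simp add: complex_eq_iff)
  then have "inner v (resolvent T (Complex l (- 1)) v) = inner y v"
    using resolvent_adjoint[OF T p, of v v] y by simp
  then have "inner v (bounded_shift T l v) = inner y v"
    by (simp add: bounded_shift_def inner_add_right y inner_commute)
  also have "\<dots> = inner y w - l * (norm y)\<^sup>2"
    by (simp add: v inner_diff_right inner_scaleC_right cinner_self)
  finally show ?thesis .
qed

text \<open>A vector \<open>y\<close> of the domain is \<open>(T - l - \<i>)\<^sup>-\<^sup>1 v\<close> for some \<open>v\<close>, and the form of \<open>T - l\<close> at \<open>y\<close> is the form of
  \<open>bounded_shift T l\<close> at \<open>v\<close>. As the projector commutes with \<open>T\<close>, the vectors \<open>y\<close> and \<open>v\<close> belong to the same one of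
  the two subspaces.\<close>

lemma spectral_projector_exists:
  fixes T :: "'h::complex_hilbert_space operator"
  assumes T: "self_adjoint T"
  shows "\<exists>F. projector F \<and> complex_linear F \<and> graph_invariant F T \<and>
    (\<forall>C. bounded_linear C \<longrightarrow> (\<forall>z. Im z \<noteq> 0 \<longrightarrow> commuting C (resolvent T z)) \<longrightarrow> commuting C F) \<and>
    (\<forall>y w. (y, w) \<in> T \<longrightarrow> F y = y \<longrightarrow> inner y w \<le> l * (norm y)\<^sup>2) \<and>
    (\<forall>y w. (y, w) \<in> T \<longrightarrow> F y = 0 \<longrightarrow> y \<noteq> 0 \<longrightarrow> l * (norm y)\<^sup>2 < inner y w)"
proof -
  note lin = linear_operatorD[OF self_adjoint_linear[OF T]]
  let ?B = "bounded_shift T l"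
  have p: "Im (Complex l 1) \<noteq> 0" and m: "Im (Complex l (- 1)) \<noteq> 0" and i: "Im \<i> \<noteq> 0" by auto
  obtain F where F: "projector F" "\<And>C. bounded_linear C \<Longrightarrow> commuting C ?B \<Longrightarrow> commuting C F"
    "\<And>x. F x = x \<Longrightarrow> inner x (?B x) \<le> 0" "\<And>x. F x = 0 \<Longrightarrow> x \<noteq> 0 \<Longrightarrow> 0 < inner x (?B x)"
    using negative_projector_exists[OF symmetric_op_bounded_shift[OF T]] by metis
  note f = symmetric_opD[OF projectorD(1)[OF F(1)]]
  have comm: "commuting C F" if C: "bounded_linear C" "\<And>z. Im z \<noteq> 0 \<Longrightarrow> commuting C (resolvent T z)" for C
  proof (rule F(2)[OF C(1)])
    interpret bounded_linear C by fact
    show "commuting C ?B" using C(2)[OF p] C(2)[OF m]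
      by (simp add: commuting_def bounded_shift_def add scaleR)
  qed
  have "commuting (\<lambda>x. \<i> *\<^sub>C x) F"
    using resolvent(2)[OF T] by (intro comm bounded_linear_scaleC) (simp add: commuting_def complex_linear_def)
  from complex_linear_if_commuting[OF f(1) this] have FC: "complex_linear F" .
  have "commuting (resolvent T \<i>) F"
    using resolvent_commuting[OF T i] by (intro comm resolvent(1)[OF T i]) (simp add: commuting_def)
  then have "commuting F (resolvent T \<i>)" by (simp add: commuting_def)
  from graph_invariant_if_commuting_resolvent[OF T f(1) FC this] have inv: "graph_invariant F T" .
  have le: "inner y w \<le> l * (norm y)\<^sup>2" if yw: "(y, w) \<in> T" and y: "F y = y" for y w
  proof -
    have "F w = w" using graph_invariantD[OF inv yw] yw lin(4) by (simp add: y)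
    then have "F (w - Complex l 1 *\<^sub>C y) = w - Complex l 1 *\<^sub>C y"
      using FC y by (simp add: f complex_linear_def)
    from F(3)[OF this] bounded_shift_form[OF T yw refl, of l] show ?thesis by simp
  qed
  moreover have "l * (norm y)\<^sup>2 < inner y w" if yw: "(y, w) \<in> T" and y: "F y = 0" "y \<noteq> 0" for y w
  proof -
    have "F w = 0" using graph_invariantD[OF inv yw] lin(1,4) by (simp add: y)
    then have v: "F (w - Complex l 1 *\<^sub>C y) = 0"
      using FC y by (simp add: f complex_linear_def)
    have "w - Complex l 1 *\<^sub>C y \<noteq> 0"
    proof
      assume 0: "w - Complex l 1 *\<^sub>C y = 0"
      interpret bounded_linear "resolvent T (Complex l 1)" by (rule resolvent(1)[OF T p])
      have "y = 0" using resolvent(3)[OF T p yw] 0 zero by simp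
      then show False using y by simp
    qed
    from F(4)[OF v this] bounded_shift_form[OF T yw refl, of l] show ?thesis by simp
  qed
  ultimately show ?thesis using F(1) FC inv comm by blast
qed

text \<open>A reducing subspace is trivial once it meets the domain trivially. The identities for
  the spectral family are reduced to this criterion, where the bounds on the form of \<open>T\<close> can be played off against each other.\<close>

lemma projector_eq_0:
  assumes T: "self_adjoint T" and P: "projector P" "graph_invariant P T"
    and triv: "\<And>y w. (y, w) \<in> T \<Longrightarrow> P y = y \<Longrightarrow> y = 0"
  shows "P x = 0"
proof (rule continuous_eq_on_Domain[OF T, where f = P and g = "\<lambda>x. 0"])
  show "bounded_linear P" by (rule symmetric_opD(1)[OF projectorD(1)[OF P(1)]])
  show "bounded_linear (\<lambda>x. 0)" by (rule bounded_linear_zero)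
  fix x assume "x \<in> Domain T"
  then obtain y where "(x, y) \<in> T" by auto
  from graph_invariantD[OF P(2) this] show "P x = 0" using triv projectorD(2)[OF P(1)] by blast
qed

lemma projector_product:
  assumes P: "projector P" and Q: "projector Q" and comm: "commuting P Q"
  shows "projector (\<lambda>x. P (Q x))"
  unfolding projector_def symmetric_op_def
proof (intro conjI allI)
  note p = symmetric_opD[OF projectorD(1)[OF P]] and q = symmetric_opD[OF projectorD(1)[OF Q]]
  show "bounded_linear (\<lambda>x. P (Q x))" by (rule bounded_linear_compose[OF p(1) q(1)])
  show "inner (P (Q x)) y = inner x (P (Q y))" for x y
    by (simp only: p(2) q(2) commutingD[OF comm])
  show "P (Q (P (Q x))) = P (Q x)" for x
    by (simp add: commutingD[OF comm, symmetric] projectorD(2)[OF P] projectorD(2)[OF Q])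
qed

text \<open>Here \<open>E l\<close> is the spectral projector of \<open>T\<close> for the half-line up to and including \<open>l\<close>. The inequality in
  \<open>lower\<close> is strict because eigenvectors for \<open>l\<close> belong to \<open>E l\<close>; this is what makes the family continuous from the
  right.\<close>

locale spectral_family =
  fixes T :: "'h::complex_hilbert_space operator" and E :: "real \<Rightarrow> 'h \<Rightarrow> 'h"
  assumes T: "self_adjoint T"
    and proj: "projector (E l)" and complex_lin: "complex_linear (E l)" and inv: "graph_invariant (E l) T"
    and absorb: "l \<le> m \<Longrightarrow> E l (E m x) = E l x" "l \<le> m \<Longrightarrow> E m (E l x) = E l x"
    and upper: "(y, w) \<in> T \<Longrightarrow> E l y = y \<Longrightarrow> inner y w \<le> l * (norm y)\<^sup>2"
    and lower: "(y, w) \<in> T \<Longrightarrow> E l y = 0 \<Longrightarrow> y \<noteq> 0 \<Longrightarrow> l * (norm y)\<^sup>2 < inner y w"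

text \<open>For \<open>l < m\<close> the range of \<open>E l (1 - E m)\<close> is trivial, since on it the form of \<open>T\<close> is at most \<open>l\<close> and at least \<open>m\<close>.\<close>

lemma spectral_family_exists:
  fixes T :: "'h::complex_hilbert_space operator"
  assumes T: "self_adjoint T"
  shows "\<exists>E. spectral_family T E"
proof -
  obtain E where E: "\<And>l. projector (E l)" "\<And>l. complex_linear (E l)" "\<And>l. graph_invariant (E l) T"
    "\<And>l C. bounded_linear C \<Longrightarrow> (\<forall>z. Im z \<noteq> 0 \<longrightarrow> commuting C (resolvent T z)) \<Longrightarrow> commuting C (E l)"
    "\<And>l y w. (y, w) \<in> T \<Longrightarrow> E l y = y \<Longrightarrow> inner y w \<le> l * (norm y)\<^sup>2"
    "\<And>l y w. (y, w) \<in> T \<Longrightarrow> E l y = 0 \<Longrightarrow> y \<noteq> 0 \<Longrightarrow> l * (norm y)\<^sup>2 < inner y w"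
    using spectral_projector_exists[OF T] by metis
  note e = symmetric_opD[OF projectorD(1)[OF E(1)]]
  have "commuting (resolvent T z) (E l)" if "Im z \<noteq> 0" for z l
    using resolvent_commuting[OF T that] by (intro E(4) resolvent(1)[OF T that]) (simp add: commuting_def)
  then have "commuting (E l) (resolvent T z)" if "Im z \<noteq> 0" for z l
    using that by (simp add: commuting_def)
  then have EE: "commuting (E l) (E m)" for l m by (intro E(4) e(1)) blast
  have less: "E l (E m x) = E l x" if "l < m" for l m x
  proof -
    have comm: "commuting (E l) (\<lambda>x. x - E m x)" using EE[of l m] by (simp add: commuting_def e)
    have "E l (x - E m x) = 0"
    proof (rule projector_eq_0[OF T projector_product[OF E(1) projector_complement[OF E(1)] comm]])
      have "graph_invariant (\<lambda>x. x - E m x) T"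
        using E(3) linear_operatorD(6)[OF self_adjoint_linear[OF T]] by (auto simp: graph_invariant_def)
      then show "graph_invariant (\<lambda>x. E l (x - E m x)) T" using E(3) by (auto simp: graph_invariant_def)
      fix y w assume yw: "(y, w) \<in> T" and y: "E l (y - E m y) = y"
      have "E l (E l (y - E m y)) = E l (y - E m y)" by (rule projectorD(2)[OF E(1)])
      then have "E l y = y" by (simp only: y)
      moreover have "E m y = E m (E l (y - E m y))" by (simp only: y)
      then have "E m y = 0" by (simp add: commutingD[OF EE, of m l] e projectorD(2)[OF E(1)])
      ultimately show "y = 0" using E(5)[OF yw, of l] E(6)[OF yw, of m] that
        by (smt (verit) mult_right_mono zero_le_power2)
    qed
    then show ?thesis by (simp add: e)
  qed
  have "spectral_family T E"
  proof
    show le: "E l (E m x) = E l x" if "l \<le> m" for l m x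
      using less[of l m x] that by (cases "l = m") (auto simp: projectorD(2)[OF E(1)])
    show "E m (E l x) = E l x" if "l \<le> m" for l m x
      using le[OF that] commutingD[OF EE, of m l] by simp
  qed (use T E in auto)
  then show ?thesis by blast
qed

text \<open>It suffices to control the sums of the forms. If \<open>y\<close> is in the range of one of the projectors, this one alone
  accounts for the whole of \<open>\<parallel>y\<parallel>\<^sup>2\<close>, so all the others annihilate \<open>y\<close>; thus the ranges are mutually orthogonal.\<close>

lemma projector_series:
  fixes P :: "nat \<Rightarrow> 'a::{real_inner,complete_space} \<Rightarrow> 'a"
  assumes proj: "\<And>n. projector (P n)"
    and sums: "\<And>x. (\<lambda>n. (norm (P n x))\<^sup>2) sums m x" and total: "\<And>x. m x \<le> (norm x)\<^sup>2"
  shows "\<exists>S. projector S \<and> (\<forall>x. (\<lambda>n. P n x) sums S x) \<and> (\<forall>x. (norm (S x))\<^sup>2 = m x)"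
proof -
  note p = symmetric_opD[OF projectorD(1)[OF proj]]
  have orth: "P i (P j x) = 0" if "i \<noteq> j" for i j x
  proof -
    let ?y = "P j x"
    have "(\<Sum>n\<in>{i, j}. (norm (P n ?y))\<^sup>2) \<le> (\<Sum>n. (norm (P n ?y))\<^sup>2)"
      by (rule sum_le_suminf) (use sums[of ?y] in \<open>auto simp: sums_iff\<close>)
    also have "\<dots> \<le> (norm ?y)\<^sup>2" using sums[of ?y] total[of ?y] by (simp add: sums_iff)
    finally have "(norm (P i ?y))\<^sup>2 \<le> 0" using that by (simp add: projectorD(2)[OF proj])
    then show ?thesis by simp
  qed
  define S where "S n = (\<lambda>x. \<Sum>i<n. P i x)" for n
  have formS: "inner x (S n x) = (\<Sum>i<n. (norm (P i x))\<^sup>2)" for n x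
    by (simp add: S_def inner_sum_right projector_inner[OF proj])
  have projS: "projector (S n)" for n
    unfolding projector_def symmetric_op_def
  proof (intro conjI allI)
    show "bounded_linear (S n)" unfolding S_def by (intro bounded_linear_sum p(1))
    show "inner (S n x) y = inner x (S n y)" for x y
      by (simp add: S_def inner_sum_left inner_sum_right p(2))
    have "P i (S n x) = P i x" if "i < n" for i x
    proof -
      have "P i (S n x) = (\<Sum>j<n. P i (P j x))"
        unfolding S_def by (rule linear_sum[OF bounded_linear.linear[OF p(1)]])
      also have "\<dots> = (\<Sum>j<n. if j = i then P i x else 0)"
        by (intro sum.cong refl) (auto simp: orth projectorD(2)[OF proj])
      also have "\<dots> = P i x" using that by simp
      finally show ?thesis .
    qed
    then have "(\<Sum>i<n. P i (S n x)) = (\<Sum>i<n. P i x)" for x by (intro sum.cong) auto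
    then show "S n (S n x) = S n x" for x
      using fun_cong[OF S_def[of n], of "S n x"] fun_cong[OF S_def[of n], of x] by metis
  qed
  have "inner x (S k x) \<le> inner x (S n x)" if "k \<le> n" for k n x
    unfolding formS using that by (intro sum_mono2) auto
  from increasing_projectors_converge[of S, OF projS this] obtain L where
    L: "projector L" "\<And>x. (\<lambda>n. S n x) \<longlonglongrightarrow> L x" by blast
  have "(norm (L x))\<^sup>2 = m x" for x
  proof -
    have "(\<lambda>n. inner x (S n x)) \<longlonglongrightarrow> inner x (L x)" by (intro tendsto_intros L)
    moreover have "(\<lambda>n. inner x (S n x)) \<longlonglongrightarrow> m x" using sums[of x] by (simp add: formS sums_def)
    ultimately have "inner x (L x) = m x" by (rule LIMSEQ_unique)
    then show ?thesis by (simp add: projector_inner[OF L(1)])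
  qed
  then show ?thesis using L by (auto simp: sums_def S_def)
qed

lemma complex_linear_limit:
  assumes "\<And>n. complex_linear (P n)" "\<And>x. (\<lambda>n. P n x) \<longlonglongrightarrow> S x"
  shows "complex_linear S"
  unfolding complex_linear_def
proof (intro allI)
  fix c x
  have "(\<lambda>n. c *\<^sub>C P n x) \<longlonglongrightarrow> c *\<^sub>C S x" by (intro tendsto_scaleC assms)
  then show "S (c *\<^sub>C x) = c *\<^sub>C S x"
    using assms(2)[of "c *\<^sub>C x"] assms(1) LIMSEQ_unique by (fastforce simp: complex_linear_def)
qed

lemma graph_invariant_limit:
  assumes "self_adjoint T" "\<And>n. graph_invariant (P n) T" "\<And>x. (\<lambda>n. P n x) \<longlonglongrightarrow> S x"
  shows "graph_invariant S T"
  unfolding graph_invariant_def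
proof (intro allI impI)
  fix x y assume "(x, y) \<in> T"
  then have "(P n x, P n y) \<in> T" for n using assms(2) by (rule graph_invariantD[rotated])
  then show "(S x, S y) \<in> T" by (rule self_adjoint_closed[OF assms(1) _ assms(3) assms(3)])
qed

context spectral_family
begin

lemmas proj_sym = symmetric_opD[OF projectorD(1)[OF proj]]

lemma norm_mono: "l \<le> m \<Longrightarrow> (norm (E l x))\<^sup>2 \<le> (norm (E m x))\<^sup>2"
  using projector_norm_le[OF proj, of l "E m x"] absorb(1)[of l m x] by (simp add: power_mono)

text \<open>The complements increase.\<close>

lemma antimono_limit:
  assumes "antimono s"
  shows "\<exists>G. projector G \<and> graph_invariant G T \<and> (\<forall>x. (\<lambda>n. E (s n) x) \<longlonglongrightarrow> G x) \<and>
    (\<forall>n x. E (s n) (G x) = G x)"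
proof -
  have "\<exists>S. projector S \<and> (\<forall>x. (\<lambda>n. x - E (s n) x) \<longlonglongrightarrow> S x)"
  proof (rule increasing_projectors_converge)
    show "projector (\<lambda>x. x - E (s n) x)" for n by (rule projector_complement[OF proj])
    show "inner x (x - E (s m) x) \<le> inner x (x - E (s n) x)" if "m \<le> n" for m n x
      using norm_mono[OF antimonoD[OF assms that], of x] by (simp add: inner_diff_right projector_inner[OF proj])
  qed
  then obtain S where S: "projector S" "\<And>x. (\<lambda>n. x - E (s n) x) \<longlonglongrightarrow> S x" by blast
  define G where "G = (\<lambda>x. x - S x)"
  have lim: "(\<lambda>n. E (s n) x) \<longlonglongrightarrow> G x" for x
    using tendsto_diff[OF tendsto_const[of x] S(2)[of x]] by (simp add: G_def)
  have "E (s n) (G x) = G x" for n x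
  proof (rule LIMSEQ_unique)
    show "(\<lambda>m. E (s n) (E (s m) x)) \<longlonglongrightarrow> E (s n) (G x)"
      by (intro bounded_linear.tendsto[OF proj_sym(1)] lim)
    have "\<forall>\<^sub>F m in sequentially. E (s n) (E (s m) x) = E (s m) x"
      unfolding eventually_sequentially using absorb(2) antimonoD[OF assms] by blast
    then show "(\<lambda>m. E (s n) (E (s m) x)) \<longlonglongrightarrow> G x" using lim[of x] by (simp add: filterlim_cong)
  qed
  moreover have "projector G" unfolding G_def by (rule projector_complement[OF S(1)])
  ultimately show ?thesis using graph_invariant_limit[OF T inv lim] lim by blast
qed

text \<open>On the range of the difference between the limit and \<open>E a\<close> the form of \<open>T\<close> is at most \<open>a\<close> and, at nonzero
  vectors, greater than \<open>a\<close>.\<close>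

lemma right_continuous_seq: "(\<lambda>n. E (a + inverse (real (Suc n))) x) \<longlonglongrightarrow> E a x"
proof -
  define s where "s n = a + inverse (real (Suc n))" for n
  have "antimono s" by (auto simp: antimono_def s_def field_simps)
  from antimono_limit[OF this] obtain G where G: "projector G" "graph_invariant G T"
    "\<And>x. (\<lambda>n. E (s n) x) \<longlonglongrightarrow> G x" "\<And>n x. E (s n) (G x) = G x" by blast
  note g = symmetric_opD[OF projectorD(1)[OF G(1)]]
  have as: "a \<le> s n" for n by (simp add: s_def)
  have GEa: "G (E a x) = E a x" for x
    using LIMSEQ_unique[OF G(3)[of "E a x"]] by (simp add: absorb(2)[OF as])
  have EaG: "E a (G x) = E a x" for x
  proof (rule LIMSEQ_unique)
    show "(\<lambda>m. E a (E (s m) x)) \<longlonglongrightarrow> E a (G x)"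
      by (intro bounded_linear.tendsto[OF proj_sym(1)] G)
    show "(\<lambda>m. E a (E (s m) x)) \<longlonglongrightarrow> E a x" by (simp add: absorb(1)[OF as])
  qed
  have comm: "commuting G (\<lambda>x. x - E a x)" by (simp add: commuting_def g GEa EaG)
  have "G (x - E a x) = 0" for x
  proof (rule projector_eq_0[OF T projector_product[OF G(1) projector_complement[OF proj] comm]])
    have "graph_invariant (\<lambda>x. x - E a x) T"
      using inv[of a] linear_operatorD(6)[OF self_adjoint_linear[OF T]] by (auto simp: graph_invariant_def)
    then show "graph_invariant (\<lambda>x. G (x - E a x)) T" using G(2) by (auto simp: graph_invariant_def)
    fix y w assume yw: "(y, w) \<in> T" and y: "G (y - E a y) = y"
    have "E a y = E a (G (y - E a y))" by (simp only: y)
    then have Ea0: "E a y = 0" by (simp add: EaG proj_sym projectorD(2)[OF proj])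
    have "E (s n) (G (y - E a y)) = G (y - E a y)" for n by (rule G(4))
    then have "E (s n) y = y" for n by (simp only: y)
    then have le: "inner y w \<le> s n * (norm y)\<^sup>2" for n by (rule upper[OF yw])
    have "s \<longlonglongrightarrow> a" unfolding s_def
      using tendsto_add[OF tendsto_const[of a] LIMSEQ_inverse_real_of_nat] by simp
    then have "(\<lambda>n. s n * (norm y)\<^sup>2) \<longlonglongrightarrow> a * (norm y)\<^sup>2" by (intro tendsto_intros)
    then have "inner y w \<le> a * (norm y)\<^sup>2" using le by (intro LIMSEQ_le_const) auto
    then show "y = 0" using lower[OF yw Ea0] by fastforce
  qed
  then have "G x = E a x" for x by (simp add: g GEa)
  then show ?thesis using G(3)[of x] by (simp add: s_def)
qed

text \<open>A vector in the range of the limit has a form below every real number.\<close>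

lemma tendsto_bot: "(\<lambda>n. E (- real n) x) \<longlonglongrightarrow> 0"
proof -
  have "antimono (\<lambda>n. - real n)" by (auto simp: antimono_def)
  from antimono_limit[OF this] obtain G where G: "projector G" "graph_invariant G T"
    "\<And>x. (\<lambda>n. E (- real n) x) \<longlonglongrightarrow> G x" "\<And>n x. E (- real n) (G x) = G x" by blast
  have "G x = 0"
  proof (rule projector_eq_0[OF T G(1,2)])
    fix y w assume yw: "(y, w) \<in> T" and y: "G y = y"
    have "E (- real n) y = y" for n using G(4)[of n y] by (simp only: y)
    then have le: "inner y w \<le> - real n * (norm y)\<^sup>2" for n by (rule upper[OF yw])
    show "y = 0"
    proof (rule ccontr)
      assume "y \<noteq> 0"
      then have n: "(norm y)\<^sup>2 > 0" by simp
      obtain n where "(- inner y w) / (norm y)\<^sup>2 < real n" using reals_Archimedean2 by blast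
      then have "- inner y w < real n * (norm y)\<^sup>2" by (rule pos_divide_less_eq[OF n, THEN iffD1])
      then show False using le[of n] by simp
    qed
  qed
  then show ?thesis using G(3)[of x] by simp
qed

lemma tendsto_top: "(\<lambda>n. E (real n) x) \<longlonglongrightarrow> x"
proof -
  have mono: "inner x (E (real m) x) \<le> inner x (E (real n) x)" if "m \<le> n" for m n x
    using norm_mono[of "real m" "real n" x] that by (simp add: projector_inner[OF proj])
  from increasing_projectors_converge[of "\<lambda>n. E (real n)", OF proj mono] obtain S where
    S: "projector S" "\<And>x. (\<lambda>n. E (real n) x) \<longlonglongrightarrow> S x" by blast
  have inv: "graph_invariant S T" by (rule graph_invariant_limit[OF T inv S(2)])
  have below: "(norm (E (real n) x))\<^sup>2 \<le> (norm (S x))\<^sup>2" for n x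
  proof (rule LIMSEQ_le_const)
    show "(\<lambda>m. (norm (E (real m) x))\<^sup>2) \<longlonglongrightarrow> (norm (S x))\<^sup>2" by (intro tendsto_intros S)
    show "\<exists>N. \<forall>m\<ge>N. (norm (E (real n) x))\<^sup>2 \<le> (norm (E (real m) x))\<^sup>2"
      by (intro exI[of _ n] allI impI norm_mono) simp
  qed
  have "x - S x = 0"
  proof (rule projector_eq_0[OF T projector_complement[OF S(1)]])
    show "graph_invariant (\<lambda>x. x - S x) T"
      using inv linear_operatorD(6)[OF self_adjoint_linear[OF T]] by (auto simp: graph_invariant_def)
    fix y w assume yw: "(y, w) \<in> T" and "y - S y = y"
    then have "S y = 0" by simp
    then have En: "E (real n) y = 0" for n using below[of n y] by simp
    show "y = 0"
    proof (rule ccontr)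
      assume y: "y \<noteq> 0"
      then have n: "(norm y)\<^sup>2 > 0" by simp
      obtain n where "real n > inner y w / (norm y)\<^sup>2" using reals_Archimedean2 by blast
      then have "inner y w < real n * (norm y)\<^sup>2" using n by (simp add: pos_divide_less_eq)
      then show False using lower[OF yw En y, of n] by simp
    qed
  qed
  then show ?thesis using S(2)[of x] by simp
qed

text \<open>The Stieltjes measure of \<open>l \<mapsto> \<parallel>E l x\<parallel>\<^sup>2\<close>; it will be \<open>A \<mapsto> \<langle>x, E A x\<rangle>\<close> for the spectral measure \<open>E\<close>.\<close>

definition form_measure :: "'h \<Rightarrow> real measure" where
  "form_measure x = interval_measure (\<lambda>l. (norm (E l x))\<^sup>2)"

lemma sets_form_measure [simp, measurable_cong]: "sets (form_measure x) = sets borel"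
  and space_form_measure [simp]: "space (form_measure x) = UNIV"
  by (simp_all add: form_measure_def)

lemma emeasure_form_measure_Ioc:
  assumes "a \<le> b"
  shows "emeasure (form_measure x) {a<..b} = ennreal ((norm (E b x))\<^sup>2 - (norm (E a x))\<^sup>2)"
  unfolding form_measure_def
proof (rule emeasure_interval_measure_Ioc[OF assms norm_mono])
  show "continuous (at_right c) (\<lambda>l. (norm (E l x))\<^sup>2)" for c
  proof (rule continuous_at_right_real_increasing[of "\<lambda>l. (norm (E l x))\<^sup>2", OF norm_mono, THEN iffD2],
      assumption, intro allI impI)
    fix e :: real assume "e > 0"
    have "(\<lambda>n. (norm (E (c + inverse (real (Suc n))) x))\<^sup>2) \<longlonglongrightarrow> (norm (E c x))\<^sup>2"
      by (intro tendsto_intros right_continuous_seq)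
    from LIMSEQ_D[OF this \<open>e > 0\<close>] obtain n where
      "norm ((norm (E (c + inverse (real (Suc n))) x))\<^sup>2 - (norm (E c x))\<^sup>2) < e" by blast
    then have "(norm (E (c + inverse (real (Suc n))) x))\<^sup>2 - (norm (E c x))\<^sup>2 < e" by simp
    then show "\<exists>d>0. (norm (E (c + d) x))\<^sup>2 - (norm (E c x))\<^sup>2 < e"
      by (intro exI[of _ "inverse (real (Suc n))"]) auto
  qed
qed

lemma emeasure_form_measure_UNIV: "emeasure (form_measure x) UNIV = ennreal ((norm x)\<^sup>2)"
proof (rule LIMSEQ_unique)
  have "(\<lambda>n. emeasure (form_measure x) {- real n<..real n}) \<longlonglongrightarrow> emeasure (form_measure x) (\<Union>n. {- real n<..real n})"
    by (intro Lim_emeasure_incseq) (auto simp: incseq_def)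
  moreover have "(\<Union>n. {- real n<..real n}) = UNIV"
  proof -
    have "\<exists>n. - real n < y \<and> y \<le> real n" for y
    proof -
      obtain n where "\<bar>y\<bar> < real n" using reals_Archimedean2 by blast
      then show ?thesis by (intro exI[of _ n]) linarith
    qed
    then show ?thesis by auto
  qed
  ultimately show "(\<lambda>n. emeasure (form_measure x) {- real n<..real n}) \<longlonglongrightarrow> emeasure (form_measure x) UNIV" by simp
  have "(\<lambda>n. ennreal ((norm (E (real n) x))\<^sup>2 - (norm (E (- real n) x))\<^sup>2)) \<longlonglongrightarrow> ennreal ((norm x)\<^sup>2 - (norm (0::'h))\<^sup>2)"
    by (intro tendsto_ennrealI tendsto_intros tendsto_top tendsto_bot)
  then show "(\<lambda>n. emeasure (form_measure x) {- real n<..real n}) \<longlonglongrightarrow> ennreal ((norm x)\<^sup>2)"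
    by (simp add: emeasure_form_measure_Ioc)
qed

lemma finite_form_measure: "finite_measure (form_measure x)"
  by (rule finite_measureI) (simp add: emeasure_form_measure_UNIV)

lemma measure_form_measure_UNIV: "measure (form_measure x) UNIV = (norm x)\<^sup>2"
  by (simp add: measure_def emeasure_form_measure_UNIV)

lemma measure_form_measure_le: "measure (form_measure x) A \<le> (norm x)\<^sup>2"
  using finite_measure.bounded_measure[OF finite_form_measure, of x A] by (simp add: measure_form_measure_UNIV)

lemma measure_form_measure_Ioc:
  "a \<le> b \<Longrightarrow> measure (form_measure x) {a<..b} = (norm (E b x))\<^sup>2 - (norm (E a x))\<^sup>2"
  using norm_mono[of a b x] by (simp add: measure_def emeasure_form_measure_Ioc)

lemma projector_Ioc:
  assumes "a \<le> b"
  shows "projector (\<lambda>x. E b x - E a x)" "(norm (E b x - E a x))\<^sup>2 = (norm (E b x))\<^sup>2 - (norm (E a x))\<^sup>2"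
proof -
  have eq: "(\<lambda>x. E b x - E a x) = (\<lambda>x. E b (x - E a x))" by (simp add: proj_sym absorb(2)[OF assms])
  have comm: "commuting (E b) (\<lambda>x. x - E a x)"
    by (simp add: commuting_def proj_sym absorb[OF assms])
  show P: "projector (\<lambda>x. E b x - E a x)"
    unfolding eq by (rule projector_product[OF proj projector_complement[OF proj] comm])
  show "(norm (E b x - E a x))\<^sup>2 = (norm (E b x))\<^sup>2 - (norm (E a x))\<^sup>2"
    using projector_inner[OF P, of x] by (simp add: inner_diff_right projector_inner[OF proj])
qed

text \<open>The sets for which such a projector exists make up a Dynkin system: complements are passed to complements,
  and disjoint unions are covered by \<open>projector_series\<close>. It contains the half-open intervals.\<close>

lemma spectral_projector_of_borel:
  assumes "A \<in> sets borel"
  shows "\<exists>P. projector P \<and> complex_linear P \<and> (\<forall>x. (norm (P x))\<^sup>2 = measure (form_measure x) A)"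
proof -
  let ?G = "range (\<lambda>(a, b). {a<..b::real})"
  have borel: "sets borel = sigma_sets UNIV ?G" by (simp add: borel_sigma_sets_Ioc)
  have "Int_stable ?G"
  proof (rule Int_stableI)
    fix a b assume "a \<in> ?G" "b \<in> ?G"
    then obtain p q r s where "a = {p<..q}" "b = {r<..s}" by auto
    then have "a \<inter> b = (\<lambda>(a, b). {a<..b}) (max p r, min q s)" by auto
    then show "a \<inter> b \<in> ?G" by (metis rangeI)
  qed
  moreover have "?G \<subseteq> Pow UNIV" by simp
  moreover have "A \<in> sigma_sets UNIV ?G" using assms by (simp only: borel)
  ultimately show ?thesis
  proof (induction A rule: sigma_sets_induct_disjoint)
    case (basic A)
    then obtain a b where A: "A = {a<..b}" by auto
    show ?case
    proof (cases "a \<le> b")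
      case True
      have "complex_linear (\<lambda>x. E b x - E a x)"
        using complex_lin by (simp add: complex_linear_def scaleC_diff_right)
      moreover have "(norm (E b x - E a x))\<^sup>2 = measure (form_measure x) A" for x
        by (simp only: projector_Ioc(2)[OF True] measure_form_measure_Ioc[OF True] A)
      ultimately show ?thesis using projector_Ioc(1)[OF True] by blast
    next
      case False
      then have "A = {}" using A by simp
      then show ?thesis
        by (intro exI[of _ "\<lambda>x. 0"]) (simp add: projector_def symmetric_op_def bounded_linear_zero complex_linear_def)
    qed
  next
    case empty
    show ?case
      by (intro exI[of _ "\<lambda>x. 0"]) (simp add: projector_def symmetric_op_def bounded_linear_zero complex_linear_def)
  next
    case (compl A)
    then obtain P where P: "projector P" "complex_linear P" "\<And>x. (norm (P x))\<^sup>2 = measure (form_measure x) A" by blast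
    have A: "A \<in> sets borel" using compl(1) by (simp only: borel)
    have "(norm (x - P x))\<^sup>2 = measure (form_measure x) (UNIV - A)" for x
      using projector_pythagoras[OF P(1), of x] P(3)[of x] A
        finite_measure.finite_measure_compl[OF finite_form_measure, of A x]
      by (simp add: measure_form_measure_UNIV)
    moreover have "complex_linear (\<lambda>x. x - P x)" using P(2) by (simp add: complex_linear_def scaleC_diff_right)
    ultimately show ?case using projector_complement[OF P(1)] by blast
  next
    case (union A)
    then obtain P where P: "\<And>i. projector (P i)" "\<And>i. complex_linear (P i)"
      "\<And>i x. (norm (P i x))\<^sup>2 = measure (form_measure x) (A i)" by metis
    have A: "range A \<subseteq> sets borel" using union(2) by (simp only: borel)
    have sums: "(\<lambda>i. (norm (P i x))\<^sup>2) sums measure (form_measure x) (\<Union>i. A i)" for x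
      unfolding P(3) using A union(1) by (intro finite_measure.finite_measure_UNION[OF finite_form_measure]) auto
    from projector_series[OF P(1) sums measure_form_measure_le] obtain S where
      S: "projector S" "\<And>x. (\<lambda>n. P n x) sums S x" "\<And>x. (norm (S x))\<^sup>2 = measure (form_measure x) (\<Union>i. A i)" by blast
    have "complex_linear (\<lambda>x. \<Sum>i<n. P i x)" for n
      unfolding complex_linear_def
    proof (intro allI)
      fix c x
      show "(\<Sum>i<n. P i (c *\<^sub>C x)) = c *\<^sub>C (\<Sum>i<n. P i x)"
        using P(2) by (simp add: complex_linear_def linear_sum[OF bounded_linear.linear[OF bounded_linear_scaleC]])
    qed
    from complex_linear_limit[OF this S(2)[unfolded sums_def]] have "complex_linear S" .
    then show ?case using S by blast
  qed
qed

lemma spectral_measure_exists: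
  "\<exists>M. projection_valued_measure M \<and> (\<forall>a b. a \<le> b \<longrightarrow> M {a<..b} = (\<lambda>x. E b x - E a x))"
proof -
  obtain M where M: "\<And>A. A \<in> sets borel \<Longrightarrow> projector (M A)" "\<And>A. A \<in> sets borel \<Longrightarrow> complex_linear (M A)"
    "\<And>A x. A \<in> sets borel \<Longrightarrow> (norm (M A x))\<^sup>2 = measure (form_measure x) A"
    using spectral_projector_of_borel by metis
  have uniq: "M A = P" if "A \<in> sets borel" "projector P" "\<And>x. (norm (P x))\<^sup>2 = measure (form_measure x) A" for A P
    using that M[OF that(1)]
    by (intro symmetric_op_eqI projectorD(1)) (auto simp: projector_inner)
  have "projection_valued_measure M"
    unfolding projection_valued_measure_def
  proof (intro conjI ballI allI impI)
    fix A :: "real set" assume A: "A \<in> sets borel"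
    note m = symmetric_opD[OF projectorD(1)[OF M(1)[OF A]]]
    show "orthogonal_projection (M A)"
      unfolding orthogonal_projection_def
      using m M(2)[OF A] projectorD(2)[OF M(1)[OF A]] cinner_symmetric_op[OF projectorD(1)[OF M(1)[OF A]] M(2)[OF A]]
      by (simp add: complex_linear_def)
  next
    have "projector (\<lambda>x. x)" by (simp add: projector_def symmetric_op_id)
    from uniq[OF _ this] show "M UNIV = id"
      by (simp add: measure_form_measure_UNIV id_def)
  next
    fix D :: "nat \<Rightarrow> real set" and x assume D: "range D \<subseteq> sets borel" "disjoint_family D"
    have Db: "D n \<in> sets borel" for n using D(1) by auto
    then have U: "(\<Union>n. D n) \<in> sets borel" by auto
    have sums: "(\<lambda>i. (norm (M (D i) x))\<^sup>2) sums measure (form_measure x) (\<Union>i. D i)" for x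
      unfolding M(3)[OF Db] using D by (intro finite_measure.finite_measure_UNION[OF finite_form_measure]) auto
    from projector_series[OF M(1)[OF Db] sums measure_form_measure_le] obtain S where
      S: "projector S" "\<And>x. (\<lambda>n. M (D n) x) sums S x" "\<And>x. (norm (S x))\<^sup>2 = measure (form_measure x) (\<Union>i. D i)" by blast
    from uniq[OF U S(1,3)] S(2)[of x] show "(\<lambda>n. M (D n) x) sums M (\<Union>n. D n) x" by simp
  qed
  moreover have "M {a<..b} = (\<lambda>x. E b x - E a x)" if "a \<le> b" for a b
    using projector_Ioc[OF that] measure_form_measure_Ioc[OF that] by (intro uniq) auto
  ultimately show ?thesis by blast
qed

end

section \<open>Projection-valued measures\<close>

lemma orthogonal_projection_projector:
  assumes "orthogonal_projection P"
  shows "projector P" "complex_linear P"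
proof -
  note o = assms[unfolded orthogonal_projection_def]
  have add: "P (x + y) = P x + P y" and scale: "P (c *\<^sub>C x) = c *\<^sub>C P x" and idem: "P (P x) = P x"
    and csym: "cinner (P x) y = cinner x (P y)" for c x y
    using o by auto
  have sym: "inner (P x) y = inner x (P y)" for x y using csym[of x y] by (simp add: Re_cinner[symmetric])
  have "bounded_linear P"
  proof (rule bounded_linear_intro[where K = 1])
    show "P (r *\<^sub>R x) = r *\<^sub>R P x" for r x using scale[of "complex_of_real r" x] by (simp add: scaleC_of_real)
    show "norm (P x) \<le> norm x * 1" for x
    proof (cases "P x = 0")
      case False
      have "inner (P x) (P x) = inner x (P x)" by (simp only: sym idem)
      then have "norm (P x) * norm (P x) \<le> norm x * norm (P x)"
        using norm_cauchy_schwarz[of x "P x"] by (simp add: power2_norm_eq_inner[symmetric] power2_eq_square)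
      then show ?thesis using False by simp
    qed simp
  qed (rule add)
  then show "projector P" using sym idem by (simp add: projector_def symmetric_op_def)
  show "complex_linear P" using scale by (simp add: complex_linear_def)
qed

locale pvm =
  fixes E :: "real set \<Rightarrow> 'h::complex_hilbert_space \<Rightarrow> 'h"
  assumes pvm: "projection_valued_measure E"
begin

lemma proj: "A \<in> sets borel \<Longrightarrow> projector (E A)"
  and complex_lin: "A \<in> sets borel \<Longrightarrow> complex_linear (E A)"
  using pvm orthogonal_projection_projector by (auto simp: projection_valued_measure_def)

lemmas proj_sym = symmetric_opD[OF projectorD(1)[OF proj]]

lemma UNIV_eq: "E UNIV x = x"
  using pvm by (simp add: projection_valued_measure_def)

lemma sums: "range D \<subseteq> sets borel \<Longrightarrow> disjoint_family D \<Longrightarrow> (\<lambda>n::nat. E (D n) x) sums E (\<Union>n. D n) x"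
  using pvm by (simp add: projection_valued_measure_def)

lemma empty: "E {} x = 0"
proof -
  have "(\<lambda>n::nat. E {} x) sums E (\<Union>n::nat. {}) x"
    by (rule sums) (auto simp: disjoint_family_on_def)
  then show ?thesis by (simp add: sums_iff summable_const_iff)
qed

lemma Un_disjoint:
  assumes A: "A \<in> sets borel" and B: "B \<in> sets borel" and "A \<inter> B = {}"
  shows "E (A \<union> B) x = E A x + E B x"
proof -
  have "(\<lambda>n. E (binaryset A B n) x) sums E (\<Union>n. binaryset A B n) x"
    using assms by (intro sums) (auto simp: binaryset_def disjoint_family_on_def)
  moreover have "(\<lambda>n. E (binaryset A B n) x) sums (E A x + E B x)"
    using sums_finite[of "{0, 1}" "\<lambda>n. E (binaryset A B n) x"] by (simp add: binaryset_def empty)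
  ultimately show ?thesis by (simp add: UN_binaryset_eq sums_unique2)
qed

text \<open>The form of \<open>E (A \<union> B)\<close> does not exceed \<open>\<parallel>y\<parallel>\<^sup>2\<close>, and for \<open>y\<close> in the range of \<open>E B\<close> the form of \<open>E B\<close>
  exhausts it.\<close>

lemma Int_disjoint:
  assumes A: "A \<in> sets borel" and B: "B \<in> sets borel" and disj: "A \<inter> B = {}"
  shows "E A (E B x) = 0"
proof -
  let ?y = "E B x"
  have AB: "A \<union> B \<in> sets borel" using A B by simp
  have "(norm (E A ?y))\<^sup>2 + (norm (E B ?y))\<^sup>2 = inner ?y (E (A \<union> B) ?y)"
    by (simp add: Un_disjoint[OF A B disj] inner_add_right projector_inner[OF proj[OF A]] projector_inner[OF proj[OF B]])
  also have "\<dots> = (norm (E (A \<union> B) ?y))\<^sup>2" by (rule projector_inner[OF proj[OF AB]])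
  also have "\<dots> \<le> (norm ?y)\<^sup>2" using projector_norm_le[OF proj[OF AB]] by (intro power_mono) auto
  finally have "(norm (E A ?y))\<^sup>2 \<le> 0" by (simp add: projectorD(2)[OF proj[OF B]])
  then show ?thesis by simp
qed

lemma mult:
  assumes A: "A \<in> sets borel" and B: "B \<in> sets borel"
  shows "E A (E B x) = E (A \<inter> B) x"
proof -
  have AB: "A \<inter> B \<in> sets borel" and AmB: "A - B \<in> sets borel" and BmA: "B - A \<in> sets borel" using A B by auto
  have "(A \<inter> B) \<union> (B - A) = B" by auto
  moreover have "E ((A \<inter> B) \<union> (B - A)) x = E (A \<inter> B) x + E (B - A) x"
    by (rule Un_disjoint[OF AB BmA]) auto
  ultimately have "E B x = E (A \<inter> B) x + E (B - A) x" by simp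
  moreover have "E A (E (B - A) x) = 0" by (rule Int_disjoint[OF A BmA]) auto
  moreover have "E A (E (A \<inter> B) x) = E (A \<inter> B) x"
  proof -
    have "E A (E (A \<inter> B) x) = E ((A \<inter> B) \<union> (A - B)) (E (A \<inter> B) x)" by (simp add: Int_Diff_Un)
    also have "\<dots> = E (A \<inter> B) (E (A \<inter> B) x) + E (A - B) (E (A \<inter> B) x)"
      by (rule Un_disjoint[OF AB AmB]) auto
    also have "E (A - B) (E (A \<inter> B) x) = 0" by (rule Int_disjoint[OF AmB AB]) auto
    finally show ?thesis by (simp add: projectorD(2)[OF proj[OF AB]])
  qed
  ultimately show ?thesis by (simp add: proj_sym(3)[OF A])
qed

lemma Compl:
  assumes "A \<in> sets borel"
  shows "E (- A) x = x - E A x"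
proof -
  have "- A \<in> sets borel" using assms by (metis borel_comp)
  from Un_disjoint[OF assms this, of x] show ?thesis by (simp add: UNIV_eq eq_diff_eq add.commute)
qed

abbreviation scalar :: "'h \<Rightarrow> real measure" where
  "scalar \<equiv> scalar_measure E"

lemma sets_scalar [simp, measurable_cong]: "sets (scalar x) = sets borel"
  and space_scalar [simp]: "space (scalar x) = UNIV"
  using sets.sigma_sets_eq[of borel] by (simp_all add: scalar_measure_def)

lemma emeasure_scalar:
  assumes A: "A \<in> sets borel"
  shows "emeasure (scalar x) A = ennreal ((norm (E A x))\<^sup>2)"
proof -
  have form: "Re (cinner x (E A x)) = (norm (E A x))\<^sup>2" if "A \<in> sets borel" for A
    by (simp add: Re_cinner projector_inner[OF proj[OF that]])
  have "emeasure (scalar x) A = ennreal (Re (cinner x (E A x)))"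
  proof (rule emeasure_measure_of[OF scalar_measure_def])
    show "positive (sets (scalar x)) (\<lambda>A. ennreal (Re (cinner x (E A x))))"
      by (simp add: positive_def empty Re_cinner)
    show "countably_additive (sets (scalar x)) (\<lambda>A. ennreal (Re (cinner x (E A x))))"
      unfolding countably_additive_def
    proof (intro allI impI)
      fix D :: "nat \<Rightarrow> real set" assume D: "range D \<subseteq> sets (scalar x)" "disjoint_family D"
      have Db: "D n \<in> sets borel" for n using D(1) by auto
      have "(\<lambda>n. inner x (E (D n) x)) sums inner x (E (\<Union>n. D n) x)"
        by (intro bounded_linear.sums[OF bounded_linear_inner_right] sums) (use D in auto)
      then show "(\<Sum>n. ennreal (Re (cinner x (E (D n) x)))) = ennreal (Re (cinner x (E (\<Union>n. D n) x)))"
        using form[OF Db] by (intro suminf_ennreal_eq) (simp_all add: Re_cinner)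
    qed
  qed (use A in auto)
  then show ?thesis by (simp add: form[OF A])
qed

lemma finite_scalar: "finite_measure (scalar x)"
  by (rule finite_measureI) (simp add: emeasure_scalar)

lemma measure_scalar: "A \<in> sets borel \<Longrightarrow> measure (scalar x) A = (norm (E A x))\<^sup>2"
  by (simp add: measure_def emeasure_scalar)

text \<open>Integrals over \<open>A\<close> are thereby integrals with respect to the measure of the vector \<open>E A x\<close>.\<close>

lemma scalar_restrict:
  assumes A: "A \<in> sets borel"
  shows "scalar (E A x) = density (scalar x) (\<lambda>t. ennreal (indicator A t))"
proof (rule measure_eqI)
  fix B assume "B \<in> sets (scalar (E A x))"
  then have B: "B \<in> sets borel" by simp
  have "emeasure (density (scalar x) (\<lambda>t. ennreal (indicator A t))) B
      = (\<integral>\<^sup>+t. ennreal (indicator A t) * indicator B t \<partial>scalar x)"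
    using A B by (intro emeasure_density) auto
  also have "\<dots> = (\<integral>\<^sup>+t. indicator (B \<inter> A) t \<partial>scalar x)"
    by (intro nn_integral_cong) (auto split: split_indicator)
  also have "\<dots> = emeasure (scalar x) (B \<inter> A)" using A B by simp
  also have "\<dots> = emeasure (scalar (E A x)) B" using A B by (simp add: emeasure_scalar mult)
  finally show "emeasure (scalar (E A x)) B = emeasure (density (scalar x) (\<lambda>t. ennreal (indicator A t))) B" ..
qed simp

lemma integrable_scalar_restrict:
  fixes f :: "real \<Rightarrow> real"
  assumes A: "A \<in> sets borel" and f: "f \<in> borel_measurable borel"
  shows "integrable (scalar (E A x)) f \<longleftrightarrow> integrable (scalar x) (\<lambda>t. indicator A t * f t)"
  unfolding scalar_restrict[OF A] using A f by (subst integrable_density) auto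

lemma integral_scalar_restrict:
  fixes f :: "real \<Rightarrow> real"
  assumes A: "A \<in> sets borel" and f: "f \<in> borel_measurable borel"
  shows "(\<integral>t. f t \<partial>scalar (E A x)) = (\<integral>t. indicator A t * f t \<partial>scalar x)"
  unfolding scalar_restrict[OF A] using A f by (subst integral_density) auto

lemma integrable_scalar_restrictI:
  fixes f :: "real \<Rightarrow> real"
  assumes A: "A \<in> sets borel" and f: "f \<in> borel_measurable borel" and "integrable (scalar x) f"
  shows "integrable (scalar (E A x)) f"
  unfolding integrable_scalar_restrict[OF A f] using A integrable_mult_indicator[of A "scalar x" f] assms(3) by simp

lemma integrable_scalar_split:
  fixes f :: "real \<Rightarrow> real"
  assumes A: "A \<in> sets borel" and f: "integrable (scalar x) f" "f \<in> borel_measurable borel"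
  shows "(\<integral>t. f t \<partial>scalar x) = (\<integral>t. f t \<partial>scalar (E A x)) + (\<integral>t. f t \<partial>scalar (E (- A) x))"
proof -
  have A': "- A \<in> sets borel" using A by (metis borel_comp)
  have "(\<integral>t. f t \<partial>scalar x) = (\<integral>t. indicator A t * f t + indicator (- A) t * f t \<partial>scalar x)"
    by (intro Bochner_Integration.integral_cong) (auto split: split_indicator)
  also have "\<dots> = (\<integral>t. indicator A t * f t \<partial>scalar x) + (\<integral>t. indicator (- A) t * f t \<partial>scalar x)"
    using integrable_mult_indicator[of A "scalar x" f] integrable_mult_indicator[of "- A" "scalar x" f] A A' f(1)
    by (intro Bochner_Integration.integral_add) auto
  finally show ?thesis by (simp add: integral_scalar_restrict A A' f)
qed

text \<open>The measure is finite, and \<open>\<bar>t\<bar> \<le> t\<^sup>2 + 1\<close>.\<close>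

lemma integrable_if_square:
  assumes "integrable (scalar x) (\<lambda>t. t\<^sup>2)"
  shows "integrable (scalar x) (\<lambda>t. t)"
proof (rule Bochner_Integration.integrable_bound)
  interpret finite_measure "scalar x" by (rule finite_scalar)
  show "integrable (scalar x) (\<lambda>t. t\<^sup>2 + 1)" using assms by simp
  have "\<bar>t\<bar> \<le> t\<^sup>2 + 1" for t :: real
    using zero_le_power2[of "\<bar>t\<bar> - 1"] by (simp add: power2_eq_square algebra_simps)
  then show "AE t in scalar x. norm t \<le> norm (t\<^sup>2 + 1)" by (intro AE_I2) simp
qed simp

end

section \<open>The spectral theorem\<close>

text \<open>Each halving of the intervals halves the bound, since the increments of \<open>F\<close> add up.\<close>

lemma interval_defect_zero:
  fixes D F :: "real \<Rightarrow> real"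
  assumes "a \<le> b"
    and defect: "\<And>s t. a \<le> s \<Longrightarrow> s \<le> t \<Longrightarrow> t \<le> b \<Longrightarrow> \<bar>D t - D s\<bar> \<le> C * (t - s) * (F t - F s)"
  shows "D b = D a"
proof -
  have halving: "\<bar>D t - D s\<bar> \<le> C * (t - s) / 2 ^ n * (F t - F s)" if "a \<le> s" "s \<le> t" "t \<le> b" for n s t
    using that
  proof (induction n arbitrary: s t)
    case 0 then show ?case using defect by simp
  next
    case (Suc n)
    define m where "m = (s + t) / 2"
    have m: "a \<le> m" "s \<le> m" "m \<le> t" "m \<le> b" using Suc.prems by (auto simp: m_def)
    have half: "m - s = (t - s) / 2" "t - m = (t - s) / 2" by (auto simp: m_def field_simps)
    have "\<bar>D t - D s\<bar> \<le> \<bar>D t - D m\<bar> + \<bar>D m - D s\<bar>" by linarith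
    also have "\<dots> \<le> C * (t - m) / 2 ^ n * (F t - F m) + C * (m - s) / 2 ^ n * (F m - F s)"
      using Suc.IH[of m t] Suc.IH[of s m] m Suc.prems by linarith
    also have "\<dots> = C * (t - s) / 2 ^ Suc n * (F t - F s)"
      unfolding half by (simp add: algebra_simps add_divide_distrib diff_divide_distrib)
    finally show ?case .
  qed
  define K where "K = C * (b - a) * (F b - F a)"
  have "\<bar>D b - D a\<bar> \<le> K * (1/2) ^ n" for n
    using halving[of a b n] assms(1) by (simp add: K_def power_divide field_simps)
  moreover have "(\<lambda>n. K * (1/2) ^ n) \<longlonglongrightarrow> K * 0" by (intro tendsto_intros LIMSEQ_power_zero) simp
  ultimately have "\<bar>D b - D a\<bar> \<le> K * 0" by (intro LIMSEQ_le_const) auto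
  then show ?thesis by simp
qed

text \<open>An additive interval function is the integral of \<open>g\<close> as soon as it agrees with \<open>g \<mu>\<close> on short intervals
  up to an error of first order in their length, relative to \<open>\<mu>\<close>. This replaces the approximation of \<open>T\<close> by step
  operators.\<close>

lemma additive_interval_function_eq_integral:
  fixes \<mu> :: "real measure" and \<Phi> :: "real \<Rightarrow> real \<Rightarrow> real" and g :: "real \<Rightarrow> real"
  assumes "finite_measure \<mu>" and sets [measurable_cong]: "sets \<mu> = sets borel"
    and [measurable]: "g \<in> borel_measurable borel" and "a \<le> b"
    and additive: "\<And>s t. a \<le> s \<Longrightarrow> s \<le> t \<Longrightarrow> t \<le> b \<Longrightarrow> \<Phi> a t = \<Phi> a s + \<Phi> s t"
    and close: "\<And>s t. a \<le> s \<Longrightarrow> s \<le> t \<Longrightarrow> t \<le> b \<Longrightarrow>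
      \<bar>\<Phi> s t - g s * measure \<mu> {s<..t}\<bar> \<le> C * (t - s) * measure \<mu> {s<..t}"
    and lipschitz: "\<And>s t. a \<le> s \<Longrightarrow> s \<le> t \<Longrightarrow> t \<le> b \<Longrightarrow> \<bar>g t - g s\<bar> \<le> C * (t - s)" and "0 \<le> C"
  shows "\<Phi> a b = (\<integral>r. indicator {a<..b} r * g r \<partial>\<mu>)"
proof -
  interpret finite_measure \<mu> by fact
  have Ioc: "{s<..t} \<in> sets \<mu>" for s t by (simp add: sets)
  have int: "integrable \<mu> (\<lambda>r. indicator {s<..t} r * g r)" if "a \<le> s" "s \<le> t" "t \<le> b" for s t
  proof (rule integrable_const_bound[where B = "\<bar>g a\<bar> + C * (b - a)"])
    have "norm (indicator {s<..t} r * g r) \<le> \<bar>g a\<bar> + C * (b - a)" for r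
    proof (cases "r \<in> {s<..t}")
      case True
      then have "\<bar>g r - g a\<bar> \<le> C * (r - a)" using that by (intro lipschitz) auto
      also have "\<dots> \<le> C * (b - a)" using True that \<open>0 \<le> C\<close> by (intro mult_left_mono) auto
      finally show ?thesis using True by simp
    qed (use \<open>a \<le> b\<close> \<open>0 \<le> C\<close> in auto)
    then show "AE r in \<mu>. norm (indicator {s<..t} r * g r) \<le> \<bar>g a\<bar> + C * (b - a)" by (intro AE_I2)
  qed measurable
  define I where "I s t = (\<integral>r. indicator {s<..t} r * g r \<partial>\<mu>)" for s t
  have Iadd: "I a t = I a s + I s t" if "a \<le> s" "s \<le> t" "t \<le> b" for s t
  proof -
    have "I a t = (\<integral>r. indicator {a<..s} r * g r + indicator {s<..t} r * g r \<partial>\<mu>)"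
      unfolding I_def using that by (intro Bochner_Integration.integral_cong) (auto split: split_indicator)
    then show ?thesis unfolding I_def using int[of a s] int[of s t] that by simp
  qed
  have Iclose: "\<bar>I s t - g s * measure \<mu> {s<..t}\<bar> \<le> C * (t - s) * measure \<mu> {s<..t}"
    if st: "a \<le> s" "s \<le> t" "t \<le> b" for s t
  proof -
    have intc: "integrable \<mu> (\<lambda>r. indicator {s<..t} r * c)" for c :: real
      by (rule integrable_const_bound[where B = "\<bar>c\<bar>"]) (auto split: split_indicator)
    have c: "(\<integral>r. indicator {s<..t} r * c \<partial>\<mu>) = c * measure \<mu> {s<..t}" for c :: real
      using Ioc by (simp add: mult.commute)
    have "I s t - g s * measure \<mu> {s<..t} = (\<integral>r. indicator {s<..t} r * g r - indicator {s<..t} r * g s \<partial>\<mu>)"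
      unfolding I_def c[symmetric] by (rule Bochner_Integration.integral_diff[symmetric]) (use int[OF st] intc in auto)
    also have "\<bar>\<dots>\<bar> \<le> (\<integral>r. indicator {s<..t} r * (C * (t - s)) \<partial>\<mu>)"
    proof (rule integral_abs_bound[THEN order_trans], rule integral_mono)
      show "integrable \<mu> (\<lambda>r. \<bar>indicator {s<..t} r * g r - indicator {s<..t} r * g s\<bar>)"
        using int[OF st] intc by (intro integrable_abs Bochner_Integration.integrable_diff)
      show "integrable \<mu> (\<lambda>r. indicator {s<..t} r * (C * (t - s)))" by (rule intc)
      fix r
      show "\<bar>indicator {s<..t} r * g r - indicator {s<..t} r * g s\<bar> \<le> indicator {s<..t} r * (C * (t - s))"
      proof (cases "r \<in> {s<..t}")
        case True
        then have "\<bar>g r - g s\<bar> \<le> C * (r - s)" using st by (intro lipschitz) auto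
        also have "\<dots> \<le> C * (t - s)" using True \<open>0 \<le> C\<close> by (intro mult_left_mono) auto
        finally show ?thesis using True by simp
      qed simp
    qed
    finally show ?thesis by (simp only: c)
  qed
  have madd: "measure \<mu> {a<..t} = measure \<mu> {a<..s} + measure \<mu> {s<..t}" if "a \<le> s" "s \<le> t" for s t
  proof -
    have "{a<..t} = {a<..s} \<union> {s<..t}" using that by auto
    then show ?thesis using Ioc by (simp add: finite_measure_Union)
  qed
  define D where "D t = \<Phi> a t - I a t" for t
  have "D b = D a"
  proof (rule interval_defect_zero[OF \<open>a \<le> b\<close>])
    fix s t assume st: "a \<le> s" "s \<le> t" "t \<le> b"
    have "D t - D s = (\<Phi> s t - g s * measure \<mu> {s<..t}) - (I s t - g s * measure \<mu> {s<..t})"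
      by (simp add: D_def additive[OF st] Iadd[OF st])
    then have "\<bar>D t - D s\<bar> \<le> 2 * (C * (t - s) * measure \<mu> {s<..t})"
      using close[OF st] Iclose[OF st] by linarith
    then show "\<bar>D t - D s\<bar> \<le> (2 * C) * (t - s) * (measure \<mu> {a<..t} - measure \<mu> {a<..s})"
      by (simp add: madd[OF st(1,2)] algebra_simps)
  qed
  moreover have "\<Phi> a a = 0" using additive[of a a] \<open>a \<le> b\<close> by simp
  ultimately show ?thesis by (simp add: D_def I_def)
qed

text \<open>The form of a symmetric operator controls its norm (by polarization), also on the part of the
  domain that lies in a reducing subspace.\<close>

lemma reduced_norm_le:
  assumes T: "self_adjoint T" and P: "projector P" "graph_invariant P T"
    and form: "\<And>y w. (y, w) \<in> T \<Longrightarrow> P y = y \<Longrightarrow> \<bar>inner y w - c * (norm y)\<^sup>2\<bar> \<le> r * (norm y)\<^sup>2"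
    and vw: "(v, w) \<in> T" "P v = v"
  shows "norm (w - c *\<^sub>R v) \<le> r * norm v"
proof (cases "v = 0")
  case True
  then have "w = 0" using vw(1) linear_operatorD(1,4)[OF self_adjoint_linear[OF T]] by blast
  then show ?thesis using True by simp
next
  case False
  note lin = linear_operatorD[OF self_adjoint_linear[OF T]]
  note p = symmetric_opD[OF projectorD(1)[OF P(1)]]
  let ?s = "w - c *\<^sub>R v"
  have r0: "0 \<le> r" using form[OF vw] False
    by (smt (verit) mult_neg_pos zero_less_norm_iff zero_less_power)
  have key: "inner u ?s \<le> r * norm u * norm v" if u: "(u, u') \<in> T" "P u = u" for u u'
  proof (cases "u = 0")
    case u0: False
    \<comment> \<open>Scaling \<open>u\<close> to the norm of \<open>v\<close> optimizes the bound that polarization gives.\<close>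
    define t where "t = norm v / norm u"
    have t: "t > 0" using False u0 by (simp add: t_def)
    let ?x = "t *\<^sub>R u" and ?x' = "t *\<^sub>R u'"
    have x: "(?x, ?x') \<in> T" "P ?x = ?x" using lin(5)[OF u(1)] u(2) by (auto simp: p)
    have sym: "inner ?x w = inner v ?x'"
      using self_adjoint_inner[OF T vw(1) x(1)] self_adjoint_inner[OF T x(1) vw(1)] by (metis inner_commute)
    have q1: "inner (?x + v) (?x' + w) - c * (norm (?x + v))\<^sup>2 \<le> r * (norm (?x + v))\<^sup>2"
      using form[OF lin(2)[OF x(1) vw(1)]] x(2) vw(2) by (simp add: p abs_le_iff)
    have q2: "- (inner (?x - v) (?x' - w) - c * (norm (?x - v))\<^sup>2) \<le> r * (norm (?x - v))\<^sup>2"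
      using form[OF lin(6)[OF x(1) vw(1)]] x(2) vw(2) by (simp add: p abs_le_iff)
    have pol: "inner (?x + v) (?x' + w) - c * (norm (?x + v))\<^sup>2
        - (inner (?x - v) (?x' - w) - c * (norm (?x - v))\<^sup>2) = 4 * inner ?x ?s"
    proof -
      have "inner (?x + v) (?x' + w) - inner (?x - v) (?x' - w) = 2 * inner ?x w + 2 * inner v ?x'"
        by (simp only: inner_add_left inner_add_right inner_diff_left inner_diff_right)
      moreover have "(norm (?x + v))\<^sup>2 - (norm (?x - v))\<^sup>2 = 4 * inner ?x v"
        unfolding power2_norm_eq_inner
        by (simp only: inner_add_left inner_add_right inner_diff_left inner_diff_right inner_commute[of v ?x])
      then have "c * (norm (?x + v))\<^sup>2 - c * (norm (?x - v))\<^sup>2 = c * (4 * inner ?x v)"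
        by (simp only: right_diff_distrib[symmetric])
      moreover have "inner ?x ?s = inner ?x w - c * inner ?x v" by (simp only: inner_diff_right inner_scaleR_right)
      ultimately show ?thesis using sym by linarith
    qed
    have "r * (norm (?x + v))\<^sup>2 + r * (norm (?x - v))\<^sup>2 = r * (2 * (norm ?x)\<^sup>2 + 2 * (norm v)\<^sup>2)"
      unfolding power2_norm_eq_inner
      by (simp add: inner_add_left inner_add_right inner_diff_left inner_diff_right inner_commute algebra_simps)
    moreover have "norm ?x = norm v" using u0 t by (simp add: t_def)
    ultimately have "r * (norm (?x + v))\<^sup>2 + r * (norm (?x - v))\<^sup>2 = r * (2 * (norm v)\<^sup>2 + 2 * (norm v)\<^sup>2)"
      by (simp only:)
    also have "\<dots> = 4 * (r * (norm v)\<^sup>2)" by (simp add: algebra_simps)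
    finally have "4 * inner ?x ?s \<le> 4 * (r * (norm v)\<^sup>2)" using q1 q2 pol by linarith
    then have "t * inner u ?s \<le> r * norm v * norm v" by (simp add: power2_eq_square)
    also have "\<dots> = t * (r * norm u * norm v)" using u0 by (simp add: t_def)
    finally show ?thesis using t by simp
  qed simp
  have Pw: "P w = w" using graph_invariantD[OF P(2) vw(1)] vw lin(4) by simp
  then have Ps: "P ?s = ?s" using vw(2) by (simp add: p)
  obtain f where f: "\<And>n. f n \<in> Domain T" "f \<longlonglongrightarrow> ?s" using self_adjoint_dense[OF T] by blast
  have lim: "(\<lambda>n. P (f n)) \<longlonglongrightarrow> ?s" using bounded_linear.tendsto[OF p(1) f(2)] Ps by simp
  have "inner ?s ?s \<le> r * norm ?s * norm v"
  proof (rule LIMSEQ_le)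
    show "(\<lambda>n. inner (P (f n)) ?s) \<longlonglongrightarrow> inner ?s ?s" by (intro tendsto_intros lim)
    show "(\<lambda>n. r * norm (P (f n)) * norm v) \<longlonglongrightarrow> r * norm ?s * norm v" by (intro tendsto_intros lim)
    have "inner (P (f n)) ?s \<le> r * norm (P (f n)) * norm v" for n
    proof -
      obtain g where "(f n, g) \<in> T" using f(1)[of n] by auto
      from key[OF graph_invariantD[OF P(2) this]] show ?thesis by (simp add: projectorD(2)[OF P(1)])
    qed
    then show "\<exists>N. \<forall>n\<ge>N. inner (P (f n)) ?s \<le> r * norm (P (f n)) * norm v" by blast
  qed
  then have "norm ?s * norm ?s \<le> norm ?s * (r * norm v)"
    by (simp add: power2_norm_eq_inner[symmetric] power2_eq_square algebra_simps)
  then show ?thesis using r0 by (cases "?s = 0") auto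
qed

text \<open>Approximate \<open>x\<close> from the domain and project: the images under \<open>T\<close> converge as well, and \<open>T\<close> is closed.\<close>

lemma bounded_part_in_Domain:
  assumes T: "self_adjoint T" and P: "projector P" "graph_invariant P T"
    and bound: "\<And>y w. (y, w) \<in> T \<Longrightarrow> P y = y \<Longrightarrow> norm w \<le> K * norm y"
    and x: "P x = x"
  shows "x \<in> Domain T"
proof -
  note lin = linear_operatorD[OF self_adjoint_linear[OF T]]
  note p = symmetric_opD[OF projectorD(1)[OF P(1)]]
  obtain f where f: "\<And>n. f n \<in> Domain T" "f \<longlonglongrightarrow> x" using self_adjoint_dense[OF T] by blast
  have "\<forall>n. \<exists>g. (f n, g) \<in> T" using f(1) by blast
  then obtain g where g: "\<And>n. (f n, g n) \<in> T" by metis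
  have lim: "(\<lambda>n. P (f n)) \<longlonglongrightarrow> x" using bounded_linear.tendsto[OF p(1) f(2)] x by simp
  have pg: "(P (f n), P (g n)) \<in> T" for n by (rule graph_invariantD[OF P(2) g])
  have "Cauchy (\<lambda>n. P (f n))" using lim by (rule LIMSEQ_imp_Cauchy)
  then have "Cauchy (\<lambda>n. P (g n))"
  proof (rule Cauchy_if_power_dist_le[where p = 1 and K = K])
    fix m n
    have "norm (P (g m) - P (g n)) \<le> K * norm (P (f m) - P (f n))"
      by (rule bound[OF lin(6)[OF pg pg]]) (simp add: p projectorD(2)[OF P(1)])
    then show "dist (P (g m)) (P (g n)) ^ 1 \<le> K * dist (P (f m)) (P (f n))" by (simp add: dist_norm)
  qed
  then obtain y where "(\<lambda>n. P (g n)) \<longlonglongrightarrow> y" using Cauchy_convergent convergent_def by blast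
  from self_adjoint_closed[OF T pg lim this] show ?thesis by auto
qed

lemma (in pvm) tendsto_symmetric_intervals: "(\<lambda>n. E {- real n<..real n} x) \<longlonglongrightarrow> x"
proof -
  interpret finite_measure "scalar x" by (rule finite_scalar)
  have "\<exists>n. - real n < y \<and> y \<le> real n" for y
  proof -
    obtain n where "\<bar>y\<bar> < real n" using reals_Archimedean2 by blast
    then show ?thesis by (intro exI[of _ n]) linarith
  qed
  then have U: "(\<Union>n. {- real n<..real n}) = UNIV" by auto
  have "(\<lambda>n. measure (scalar x) {- real n<..real n}) \<longlonglongrightarrow> measure (scalar x) (\<Union>n. {- real n<..real n})"
    by (rule finite_Lim_measure_incseq) (auto simp: incseq_def)
  then have "(\<lambda>n. (norm (E {- real n<..real n} x))\<^sup>2) \<longlonglongrightarrow> (norm x)\<^sup>2"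
    by (simp add: U measure_scalar UNIV_eq)
  from tendsto_diff[OF tendsto_const[of "(norm x)\<^sup>2"] this]
  have "(\<lambda>n. (norm x)\<^sup>2 - (norm (E {- real n<..real n} x))\<^sup>2) \<longlonglongrightarrow> 0" by simp
  moreover have "(norm x)\<^sup>2 - (norm (E {- real n<..real n} x))\<^sup>2 = (norm (x - E {- real n<..real n} x))\<^sup>2" for n
    using projector_pythagoras[OF proj, of "{- real n<..real n}" x] by simp
  ultimately have "(\<lambda>n. (norm (x - E {- real n<..real n} x))\<^sup>2) \<longlonglongrightarrow> 0" by (simp only:)
  from tendsto_real_sqrt[OF this] have "(\<lambda>n. norm (x - E {- real n<..real n} x)) \<longlonglongrightarrow> 0" by simp
  then have "(\<lambda>n. x - E {- real n<..real n} x) \<longlonglongrightarrow> 0" by (rule tendsto_norm_zero_cancel)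
  from tendsto_diff[OF tendsto_const[of x] this] show ?thesis by simp
qed

text \<open>What a projection-valued measure has to satisfy to be the spectral measure of \<open>T\<close>, expressed on half-open
  intervals.\<close>

locale reducing_measure = pvm E for E :: "real set \<Rightarrow> 'h::complex_hilbert_space \<Rightarrow> 'h" +
  fixes T :: "'h operator"
  assumes T: "self_adjoint T"
    and inv: "a \<le> b \<Longrightarrow> graph_invariant (E {a<..b}) T"
    and bounds: "a \<le> b \<Longrightarrow> (y, w) \<in> T \<Longrightarrow> E {a<..b} y = y \<Longrightarrow>
      a * (norm y)\<^sup>2 \<le> inner y w \<and> inner y w \<le> b * (norm y)\<^sup>2"
begin

lemmas T_lin = linear_operatorD[OF self_adjoint_linear[OF T]]

lemma Ioc_proj: "projector (E {a<..b})"
  by (rule proj) simp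

lemma norm_shift_le:
  assumes "a \<le> b" "(y, w) \<in> T" "E {a<..b} y = y"
  shows "norm (w - a *\<^sub>R y) \<le> (b - a) * norm y"
proof (rule reduced_norm_le[OF T Ioc_proj inv[OF assms(1)] _ assms(2,3)])
  fix y w assume "(y, w) \<in> T" "E {a<..b} y = y"
  from bounds[OF assms(1) this] show "\<bar>inner y w - a * (norm y)\<^sup>2\<bar> \<le> (b - a) * (norm y)\<^sup>2"
    by (simp add: abs_le_iff algebra_simps)
qed

lemma Ioc_add: "a \<le> s \<Longrightarrow> s \<le> t \<Longrightarrow> E {a<..t} x = E {a<..s} x + E {s<..t} x"
  using Un_disjoint[of "{a<..s}" "{s<..t}" x] by (simp add: ivl_disj_un)

text \<open>On the range of \<open>E {s<..t}\<close> the form of \<open>T\<close> lies between \<open>s\<close> and \<open>t\<close>.\<close>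

lemma form_on_interval:
  assumes xz: "(x, z) \<in> T" and "a \<le> b"
  shows "inner (E {a<..b} x) z = (\<integral>r. indicator {a<..b} r * r \<partial>scalar x)"
proof (rule additive_interval_function_eq_integral[where C = 1 and \<Phi> = "\<lambda>s t. inner (E {s<..t} x) z" and g = "\<lambda>r. r"])
  fix s t assume st: "a \<le> s" "s \<le> t" "t \<le> b"
  show "inner (E {a<..t} x) z = inner (E {a<..s} x) z + inner (E {s<..t} x) z"
    by (simp add: Ioc_add[OF st(1,2)] inner_add_left)
  let ?P = "E {s<..t}"
  have idem: "?P (?P x) = ?P x" by (rule projectorD(2)[OF Ioc_proj])
  have "inner (?P x) z = inner (?P (?P x)) z" by (simp only: idem)
  also have "\<dots> = inner (?P x) (?P z)" by (rule symmetric_opD(2)[OF projectorD(1)[OF Ioc_proj]])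
  finally show "\<bar>inner (?P x) z - s * measure (scalar x) {s<..t}\<bar> \<le> 1 * (t - s) * measure (scalar x) {s<..t}"
    using bounds[OF st(2) graph_invariantD[OF inv[OF st(2)] xz] idem]
    by (simp add: measure_scalar abs_le_iff algebra_simps)
qed (use \<open>a \<le> b\<close> finite_scalar in auto)

text \<open>On the range of \<open>E {s<..t}\<close> the operator \<open>T\<close> differs from \<open>s\<close> by at most \<open>t - s\<close> in norm, hence
  \<open>\<bar>\<parallel>T y\<parallel>\<^sup>2 - s\<^sup>2 \<parallel>y\<parallel>\<^sup>2\<bar> \<le> \<parallel>(T - s) y\<parallel> \<parallel>(T + s) y\<parallel>\<close>, and \<open>T + s\<close> is bounded there by \<open>(t - s) + 2 \<bar>s\<bar> \<le> 4 n\<close>.\<close>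

lemma norm_on_interval:
  assumes xz: "(x, z) \<in> T"
  shows "(norm (E {- real n<..real n} z))\<^sup>2 = (\<integral>r. indicator {- real n<..real n} r * r\<^sup>2 \<partial>scalar x)"
proof (rule additive_interval_function_eq_integral[where C = "4 * real n"
      and \<Phi> = "\<lambda>s t. (norm (E {s<..t} z))\<^sup>2" and g = "\<lambda>r. r\<^sup>2"])
  fix s t assume st: "- real n \<le> s" "s \<le> t" "t \<le> real n"
  let ?a = "- real n"
  interpret finite_measure "scalar z" by (rule finite_scalar)
  have "{?a<..t} = {?a<..s} \<union> {s<..t}" using st by auto
  then have "measure (scalar z) {?a<..t} = measure (scalar z) {?a<..s} + measure (scalar z) {s<..t}"
    by (simp add: finite_measure_Union)
  then show "(norm (E {?a<..t} z))\<^sup>2 = (norm (E {?a<..s} z))\<^sup>2 + (norm (E {s<..t} z))\<^sup>2"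
    by (simp add: measure_scalar)
  let ?y = "E {s<..t} x" and ?w = "E {s<..t} z"
  have idem: "E {s<..t} ?y = ?y" by (rule projectorD(2)[OF Ioc_proj])
  have shift: "norm (?w - s *\<^sub>R ?y) \<le> (t - s) * norm ?y"
    by (rule norm_shift_le[OF st(2) graph_invariantD[OF inv[OF st(2)] xz] idem])
  have "(norm ?w)\<^sup>2 - s\<^sup>2 * (norm ?y)\<^sup>2 = inner (?w - s *\<^sub>R ?y) (?w + s *\<^sub>R ?y)"
    unfolding power2_norm_eq_inner
    by (simp add: inner_diff_left inner_add_right inner_commute[of ?y ?w] power2_eq_square algebra_simps)
  also have "\<bar>\<dots>\<bar> \<le> norm (?w - s *\<^sub>R ?y) * norm (?w + s *\<^sub>R ?y)" by (rule Cauchy_Schwarz_ineq2)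
  also have "\<dots> \<le> ((t - s) * norm ?y) * (4 * real n * norm ?y)"
  proof (intro mult_mono shift)
    have "?w + s *\<^sub>R ?y = (?w - s *\<^sub>R ?y) + (2 * s) *\<^sub>R ?y" by (simp add: algebra_simps scaleR_2[symmetric])
    then have "norm (?w + s *\<^sub>R ?y) \<le> norm (?w - s *\<^sub>R ?y) + \<bar>2 * s\<bar> * norm ?y"
      by (metis norm_scaleR norm_triangle_ineq)
    also have "\<dots> \<le> (t - s + \<bar>2 * s\<bar>) * norm ?y" using shift by (simp add: algebra_simps)
    also have "\<dots> \<le> (4 * real n) * norm ?y" using st by (intro mult_right_mono) auto
    finally show "norm (?w + s *\<^sub>R ?y) \<le> 4 * real n * norm ?y" .
  qed (use st in auto)
  finally show "\<bar>(norm ?w)\<^sup>2 - s\<^sup>2 * measure (scalar x) {s<..t}\<bar> \<le> 4 * real n * (t - s) * measure (scalar x) {s<..t}"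
    by (simp add: measure_scalar power2_eq_square algebra_simps)
  have "t\<^sup>2 - s\<^sup>2 = (t + s) * (t - s)" by (simp add: power2_eq_square algebra_simps)
  then have "\<bar>t\<^sup>2 - s\<^sup>2\<bar> = \<bar>t + s\<bar> * (t - s)" using st by (simp add: abs_mult)
  also have "\<dots> \<le> 4 * real n * (t - s)" using st by (intro mult_right_mono) auto
  finally show "\<bar>t\<^sup>2 - s\<^sup>2\<bar> \<le> 4 * real n * (t - s)" .
qed (use finite_scalar in auto)

lemma tendsto_indicator_intervals:
  "(\<lambda>n. indicator {- real n<..real n} r * f r) \<longlonglongrightarrow> (f r :: real)"
proof (rule tendsto_eventually)
  obtain N where "\<bar>r\<bar> < real N" using reals_Archimedean2 by blast
  then have "indicator {- real n<..real n} r * f r = f r" if "n \<ge> N" for n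
    using that by (auto split: split_indicator)
  then show "\<forall>\<^sub>F n in sequentially. indicator {- real n<..real n} r * f r = f r"
    unfolding eventually_sequentially by blast
qed

lemma square_integrable:
  assumes xz: "(x, z) \<in> T"
  shows "integrable (scalar x) (\<lambda>r. r\<^sup>2)" "(norm z)\<^sup>2 = (\<integral>r. r\<^sup>2 \<partial>scalar x)"
proof -
  interpret finite_measure "scalar x" by (rule finite_scalar)
  let ?f = "\<lambda>n r. indicator {- real n<..real n} r * r\<^sup>2"
  have int: "integrable (scalar x) (?f n)" for n
  proof (rule integrable_const_bound[where B = "(real n)\<^sup>2"])
    show "AE r in scalar x. norm (?f n r) \<le> (real n)\<^sup>2"
      by (intro AE_I2) (auto split: split_indicator intro!: abs_le_square_iff[THEN iffD1])
  qed measurable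
  have mono: "AE r in scalar x. mono (\<lambda>n. ?f n r)"
    by (intro AE_I2 monoI) (auto split: split_indicator)
  have nonneg: "AE r in scalar x. 0 \<le> ?f n r" for n by (intro AE_I2) simp
  have lim: "AE r in scalar x. (\<lambda>n. ?f n r) \<longlonglongrightarrow> r\<^sup>2" by (intro AE_I2 tendsto_indicator_intervals)
  have ilim: "(\<lambda>n. \<integral>r. ?f n r \<partial>scalar x) \<longlonglongrightarrow> (norm z)\<^sup>2"
    unfolding norm_on_interval[OF xz, symmetric] by (intro tendsto_intros tendsto_symmetric_intervals)
  show "integrable (scalar x) (\<lambda>r. r\<^sup>2)" "(norm z)\<^sup>2 = (\<integral>r. r\<^sup>2 \<partial>scalar x)"
    using integral_monotone_convergence_nonneg[OF int mono nonneg lim ilim] by auto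
qed

lemma form_eq_integral:
  assumes xz: "(x, z) \<in> T"
  shows "inner x z = (\<integral>r. r \<partial>scalar x)"
proof (rule LIMSEQ_unique)
  show "(\<lambda>n. inner (E {- real n<..real n} x) z) \<longlonglongrightarrow> inner x z"
    by (intro tendsto_intros tendsto_symmetric_intervals)
  have "(\<lambda>n. \<integral>r. indicator {- real n<..real n} r * r \<partial>scalar x) \<longlonglongrightarrow> (\<integral>r. r \<partial>scalar x)"
  proof (rule integral_dominated_convergence)
    show "integrable (scalar x) (\<lambda>r. \<bar>r\<bar>)"
      using integrable_if_square[OF square_integrable(1)[OF xz]] by (rule integrable_abs)
    show "AE r in scalar x. (\<lambda>n. indicator {- real n<..real n} r * r) \<longlonglongrightarrow> r"
      by (intro AE_I2 tendsto_indicator_intervals)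
    show "AE r in scalar x. norm (indicator {- real n<..real n} r * r) \<le> \<bar>r\<bar>" for n
      by (intro AE_I2) (auto split: split_indicator)
  qed measurable
  then show "(\<lambda>n. inner (E {- real n<..real n} x) z) \<longlonglongrightarrow> (\<integral>r. r \<partial>scalar x)"
    by (simp add: form_on_interval[OF xz])
qed

text \<open>The truncations \<open>E {- n<..n} x\<close> lie in the domain, and by the norm formula for differences of truncations
  their images under \<open>T\<close> form a Cauchy sequence.\<close>

lemma Domain_if_square_integrable:
  assumes "integrable (scalar x) (\<lambda>r. r\<^sup>2)"
  shows "x \<in> Domain T"
proof -
  let ?J = "\<lambda>n::nat. {- real n<..real n}"
  have "E (?J n) x \<in> Domain T" for n
  proof (rule bounded_part_in_Domain[OF T Ioc_proj inv])
    show "E (?J n) (E (?J n) x) = E (?J n) x" by (rule projectorD(2)[OF Ioc_proj])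
    fix y w assume "(y, w) \<in> T" "E (?J n) y = y"
    from norm_shift_le[OF _ this] have "norm (w - (- real n) *\<^sub>R y) \<le> (2 * real n) * norm y" by simp
    moreover have "norm w \<le> norm (w - (- real n) *\<^sub>R y) + norm ((- real n) *\<^sub>R y)"
      by (metis diff_add_cancel norm_triangle_ineq)
    ultimately show "norm w \<le> (3 * real n) * norm y" by (simp add: algebra_simps)
  qed simp
  then have "\<forall>n. \<exists>z. (E (?J n) x, z) \<in> T" by blast
  then obtain z where z: "\<And>n. (E (?J n) x, z n) \<in> T" by metis
  define I where "I n = (\<integral>r. indicator (?J n) r * r\<^sup>2 \<partial>scalar x)" for n
  have int: "integrable (scalar x) (\<lambda>r. indicator (?J n) r * r\<^sup>2)" for n
    using integrable_mult_indicator[of "?J n" "scalar x" "\<lambda>r. r\<^sup>2"] assms by simp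
  have "I \<longlonglongrightarrow> (\<integral>r. r\<^sup>2 \<partial>scalar x)"
    unfolding I_def
  proof (rule integral_dominated_convergence[OF _ _ assms])
    show "AE r in scalar x. (\<lambda>n. indicator (?J n) r * r\<^sup>2) \<longlonglongrightarrow> r\<^sup>2"
      by (intro AE_I2 tendsto_indicator_intervals)
    show "AE r in scalar x. norm (indicator (?J n) r * r\<^sup>2) \<le> r\<^sup>2" for n
      by (intro AE_I2) (auto split: split_indicator)
  qed measurable
  then have CI: "Cauchy I" by (rule LIMSEQ_imp_Cauchy)
  have diff: "(norm (z n - z m))\<^sup>2 = I n - I m" if "m \<le> n" for m n
  proof -
    let ?A = "?J n - ?J m"
    have "?J m \<union> ?A = ?J n" using that by auto
    then have "E (?J n) x = E (?J m) x + E ?A x" using Un_disjoint[of "?J m" ?A x] by auto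
    then have "(E ?A x, z n - z m) \<in> T" using T_lin(6)[OF z[of n] z[of m]] by simp
    from square_integrable(2)[OF this]
    have "(norm (z n - z m))\<^sup>2 = (\<integral>r. indicator ?A r * r\<^sup>2 \<partial>scalar x)" by (simp add: integral_scalar_restrict)
    also have "\<dots> = (\<integral>r. indicator (?J n) r * r\<^sup>2 - indicator (?J m) r * r\<^sup>2 \<partial>scalar x)"
      using that by (intro Bochner_Integration.integral_cong) (auto split: split_indicator)
    also have "\<dots> = I n - I m" unfolding I_def by (rule Bochner_Integration.integral_diff[OF int int])
    finally show ?thesis .
  qed
  from CI have "Cauchy z"
  proof (rule Cauchy_if_power_dist_le[where p = 2 and K = 1])
    fix m n :: nat assume mn: "m \<le> n"
    show "(dist (z m) (z n))\<^sup>2 \<le> 1 * dist (I m) (I n)"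
      using diff[OF mn] by (simp add: dist_norm norm_minus_commute)
  qed
  then obtain y where "z \<longlonglongrightarrow> y" using Cauchy_convergent convergent_def by blast
  from self_adjoint_closed[OF T z tendsto_symmetric_intervals this] show ?thesis by auto
qed

lemma is_spectral_integral: "is_spectral_integral E (\<lambda>t. t) T"
  unfolding is_spectral_integral_def
proof (intro conjI allI impI)
  show "linear_operator T" by (rule self_adjoint_linear[OF T])
  show "Domain T = {x. integrable (scalar x) (\<lambda>t. t\<^sup>2)}"
    using Domain_if_square_integrable square_integrable(1) by auto
  fix x y assume xy: "(x, y) \<in> T"
  show "cinner x y = complex_of_real (\<integral>t. t \<partial>scalar x)"
    using form_eq_integral[OF xy] self_adjoint_Im[OF T xy] by (simp add: complex_eq_iff Re_cinner)
qed

end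

theorem spectral_theorem:
  fixes T :: "'h::complex_hilbert_space operator"
  assumes T: "self_adjoint T"
  shows "projection_valued_measure (spectral_projection T)"
    "is_spectral_integral (spectral_projection T) (\<lambda>t. t) T"
proof -
  obtain F where "spectral_family T F" using spectral_family_exists[OF T] by blast
  then interpret F: spectral_family T F .
  obtain E where E: "projection_valued_measure E" "\<And>a b. a \<le> b \<Longrightarrow> E {a<..b} = (\<lambda>x. F b x - F a x)"
    using F.spectral_measure_exists by blast
  interpret pvm E by unfold_locales (rule E(1))
  have "reducing_measure E T"
  proof
    fix a b :: real assume ab: "a \<le> b"
    show "graph_invariant (E {a<..b}) T"
      using F.inv linear_operatorD(6)[OF self_adjoint_linear[OF T]] by (auto simp: E(2)[OF ab] graph_invariant_def)
    fix y w assume yw: "(y, w) \<in> T" and "E {a<..b} y = y"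
    then have y: "F b y - F a y = y" by (simp add: E(2)[OF ab])
    have "F a y = F a (F b y - F a y)" by (simp only: y)
    then have a0: "F a y = 0" by (simp add: F.proj_sym F.absorb(1)[OF ab] projectorD(2)[OF F.proj])
    then have "F b y = y" using y by simp
    from F.upper[OF yw this] F.lower[OF yw a0]
    show "a * (norm y)\<^sup>2 \<le> inner y w \<and> inner y w \<le> b * (norm y)\<^sup>2"
      using yw linear_operatorD(1,4)[OF self_adjoint_linear[OF T]] by (cases "y = 0") auto
  qed (rule T)
  from reducing_measure.is_spectral_integral[OF this] E(1)
  have "\<exists>E. projection_valued_measure E \<and> is_spectral_integral E (\<lambda>t. t) T" by blast
  from someI_ex[OF this] show "projection_valued_measure (spectral_projection T)"
    "is_spectral_integral (spectral_projection T) (\<lambda>t. t) T"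
    unfolding spectral_projection_def by blast+
qed

section \<open>Reduction by spectral projections\<close>

text \<open>Since \<open>spectral_projection T\<close> is defined by a choice, all its properties are derived from \<open>spectral_theorem\<close>.\<close>

locale self_adjoint_operator =
  fixes T :: "'h::complex_hilbert_space operator"
  assumes T: "self_adjoint T"
begin

sublocale pvm "spectral_projection T"
  by unfold_locales (rule spectral_theorem(1)[OF T])

abbreviation E :: "real set \<Rightarrow> 'h \<Rightarrow> 'h" where
  "E \<equiv> spectral_projection T"

lemmas T_lin = linear_operatorD[OF self_adjoint_linear[OF T]]

lemma Domain_iff: "x \<in> Domain T \<longleftrightarrow> integrable (scalar x) (\<lambda>t. t\<^sup>2)"
  using spectral_theorem(2)[OF T] by (auto simp: is_spectral_integral_def)

lemma integrable_square: "(x, y) \<in> T \<Longrightarrow> integrable (scalar x) (\<lambda>t. t\<^sup>2)"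
  using Domain_iff by blast

lemma integrable_id: "(x, y) \<in> T \<Longrightarrow> integrable (scalar x) (\<lambda>t. t)"
  by (rule integrable_if_square[OF integrable_square])

lemma form_eq: "(x, y) \<in> T \<Longrightarrow> inner x y = (\<integral>t. t \<partial>scalar x)"
  using spectral_theorem(2)[OF T] by (simp add: is_spectral_integral_def Re_cinner[symmetric])

lemma Domain_restrict:
  assumes A: "A \<in> sets borel" and x: "x \<in> Domain T"
  shows "E A x \<in> Domain T"
  using x integrable_scalar_restrictI[OF A, of "\<lambda>t. t\<^sup>2" x] by (simp add: Domain_iff)

text \<open>A sum of vectors from the ranges of \<open>E A\<close> and \<open>E (- A)\<close> has the sum of their forms as its form, so the
  mixed terms vanish.\<close>

lemma off_diagonal_form_zero:
  assumes A: "A \<in> sets borel" and x: "(x, w) \<in> T" "E A x = x" and v: "(v, u) \<in> T" "E A v = 0"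
  shows "inner v w = 0"
proof -
  have A': "- A \<in> sets borel" using A by (metis borel_comp)
  have xv: "(x + v, w + u) \<in> T" by (rule T_lin(2)[OF x(1) v(1)])
  have "E A (x + v) = x" "E (- A) (x + v) = v" using x(2) v(2) by (simp_all add: Compl[OF A] proj_sym(3)[OF A])
  then have "inner (x + v) (w + u) = inner x w + inner v u"
    using integrable_scalar_split[OF A integrable_id[OF xv]] form_eq[OF xv] form_eq[OF x(1)] form_eq[OF v(1)] by simp
  moreover have "inner x u = inner v w" using self_adjoint_inner[OF T v(1) x(1)] by (simp add: inner_commute)
  ultimately show ?thesis by (simp add: inner_add_left inner_add_right)
qed

text \<open>By \<open>off_diagonal_form_zero\<close> the operator maps a vector of the domain in the range of \<open>E B\<close> to a vector orthogonal to
  a dense subset of the range of \<open>E (- B)\<close>.\<close>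

lemma graph_invariant_spectral:
  assumes A: "A \<in> sets borel"
  shows "graph_invariant (E A) T"
  unfolding graph_invariant_def
proof (intro allI impI)
  fix x y assume xy: "(x, y) \<in> T"
  have A': "- A \<in> sets borel" using A by (metis borel_comp)
  have range: "E B w = w" if B: "B \<in> sets borel" "(x', w) \<in> T" "E B x' = x'" for B x' w
  proof -
    have B': "- B \<in> sets borel" using B(1) by (metis borel_comp)
    have "inner (E (- B) w) v = 0" for v
    proof (rule continuous_eq_on_Domain[OF T, where f = "\<lambda>v. inner (E (- B) w) v" and g = "\<lambda>v. 0"])
      fix v assume "v \<in> Domain T"
      then obtain u where u: "(E (- B) v, u) \<in> T" using Domain_restrict[OF B'] by blast
      have "E B (E (- B) v) = 0" by (rule Int_disjoint[OF B(1) B']) simp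
      from off_diagonal_form_zero[OF B(1-3) u this] have "inner (E (- B) v) w = 0" .
      then show "inner (E (- B) w) v = 0" using proj_sym(2)[OF B', of v w] by (metis inner_commute)
    qed (auto intro: bounded_linear_inner_right bounded_linear_zero)
    then have "inner (E (- B) w) (E (- B) w) = 0" .
    then show ?thesis by (simp add: Compl[OF B(1)])
  qed
  obtain w where w: "(E A x, w) \<in> T" using Domain_restrict[OF A] xy by blast
  have "(x - E A x, y - w) \<in> T" by (rule T_lin(6)[OF xy w])
  then have w': "(E (- A) x, y - w) \<in> T" by (simp add: Compl[OF A])
  have "E A w = w" by (rule range[OF A w]) (rule projectorD(2)[OF proj[OF A]])
  moreover have "E (- A) (y - w) = y - w" by (rule range[OF A' w']) (rule projectorD(2)[OF proj[OF A']])
  ultimately have "E A y = w" by (simp add: Compl[OF A] proj_sym[OF A])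
  then show "(E A x, E A y) \<in> T" using w by simp
qed

lemma form_restrict:
  assumes A: "A \<in> sets borel" and x: "(x, y) \<in> T" "E A x = x"
  shows "inner x y - c * (norm x)\<^sup>2 = (\<integral>t. indicator A t * (t - c) \<partial>scalar x)"
    "integrable (scalar x) (\<lambda>t. indicator A t * (t - c))"
proof -
  interpret finite_measure "scalar x" by (rule finite_scalar)
  have int: "integrable (scalar x) (\<lambda>t. t - c)" using integrable_id[OF x(1)] by simp
  then show "integrable (scalar x) (\<lambda>t. indicator A t * (t - c))"
    using integrable_mult_indicator[of A "scalar x" "\<lambda>t. t - c"] A by simp
  have "inner x y - c * (norm x)\<^sup>2 = (\<integral>t. t - c \<partial>scalar x)"
    using integrable_id[OF x(1)] form_eq[OF x(1)] measure_scalar[of UNIV x] by (simp add: UNIV_eq)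
  also have "\<dots> = (\<integral>t. indicator A t * (t - c) \<partial>scalar x)"
    using integral_scalar_restrict[OF A, of "\<lambda>t. t - c" x] x(2) by simp
  finally show "inner x y - c * (norm x)\<^sup>2 = (\<integral>t. indicator A t * (t - c) \<partial>scalar x)" .
qed

lemma form_upper:
  assumes A: "A \<in> sets borel" "\<And>t. t \<in> A \<Longrightarrow> t \<le> c" and x: "(x, y) \<in> T" "E A x = x"
  shows "inner x y \<le> c * (norm x)\<^sup>2"
proof -
  have "(\<integral>t. indicator A t * (t - c) \<partial>scalar x) \<le> (\<integral>t. 0 \<partial>scalar x)"
    using A(2) by (intro integral_mono form_restrict(2)[OF A(1) x]) (auto split: split_indicator)
  then show ?thesis using form_restrict(1)[OF A(1) x, of c] by simp
qed

lemma form_lower: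
  assumes A: "A \<in> sets borel" "\<And>t. t \<in> A \<Longrightarrow> c \<le> t" and x: "(x, y) \<in> T" "E A x = x"
  shows "c * (norm x)\<^sup>2 \<le> inner x y"
proof -
  have "(\<integral>t. 0 \<partial>scalar x) \<le> (\<integral>t. indicator A t * (t - c) \<partial>scalar x)"
    using A(2) by (intro integral_mono form_restrict(2)[OF A(1) x]) (auto split: split_indicator)
  then show ?thesis using form_restrict(1)[OF A(1) x, of c] by simp
qed

section \<open>Support of the spectral measure\<close>

text \<open>Only the real points matter, since the spectrum is real.\<close>

definition real_resolvent :: "real set" where
  "real_resolvent = {t. complex_of_real t \<in> resolvent_set T}"

lemma real_resolventI:
  assumes c: "c > 0" and lower: "\<And>x y. (x, y) \<in> T \<Longrightarrow> c * norm x \<le> norm (y - t *\<^sub>R x)"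
  shows "t \<in> real_resolvent"
proof -
  have "c * norm x \<le> norm (y - complex_of_real t *\<^sub>C x)" if "(x, y) \<in> T" for x y
    using lower[OF that] by (simp add: scaleC_of_real)
  moreover have "x = 0" if "(x, cnj (complex_of_real t) *\<^sub>C x) \<in> T" for x
    using lower[OF that] c by (simp add: scaleC_of_real mult_le_0_iff)
  ultimately show ?thesis
    using resolvent_exists[OF T c, of "complex_of_real t"]
    unfolding real_resolvent_def resolvent_set_def by blast
qed

lemma real_resolventE:
  assumes "t \<in> real_resolvent"
  obtains c where "c > 0" "\<And>x y. (x, y) \<in> T \<Longrightarrow> c * norm x \<le> norm (y - t *\<^sub>R x)"
proof -
  obtain R where R: "bounded_linear R" "\<And>x y. (x, y) \<in> T \<Longrightarrow> R (y - t *\<^sub>R x) = x"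
    using assms unfolding real_resolvent_def resolvent_set_def by (auto simp: scaleC_of_real)
  obtain K where K: "K > 0" "\<And>x. norm (R x) \<le> norm x * K"
    using bounded_linear.pos_bounded[OF R(1)] by blast
  have "1 / K * norm x \<le> norm (y - t *\<^sub>R x)" if "(x, y) \<in> T" for x y
    using K(2)[of "y - t *\<^sub>R x"] R(2)[OF that] K(1) by (simp add: field_simps)
  then show thesis using that[of "1 / K"] K(1) by simp
qed

text \<open>Let \<open>\<parallel>(T - t) y\<parallel> \<ge> c \<parallel>y\<parallel>\<close>. On the range of \<open>E\<close> for the interval of radius \<open>c/2\<close> about \<open>t\<close> one has
  \<open>\<parallel>(T - t) y\<parallel> \<le> c/2 \<parallel>y\<parallel>\<close>, so this range is trivial; and \<open>\<parallel>(T - s) y\<parallel> \<ge> c/2 \<parallel>y\<parallel>\<close> for all \<open>s\<close> in the interval.\<close>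

lemma real_resolvent_neighbourhood:
  assumes "t \<in> real_resolvent"
  obtains r where "r > 0" "{t - r<..<t + r} \<subseteq> real_resolvent" "\<And>x. E {t - r<..<t + r} x = 0"
proof -
  obtain c where c: "c > 0" "\<And>x y. (x, y) \<in> T \<Longrightarrow> c * norm x \<le> norm (y - t *\<^sub>R x)"
    using real_resolventE[OF assms] by blast
  define r where "r = c / 2"
  let ?A = "{t - r<..<t + r}"
  have A: "?A \<in> sets borel" by simp
  have near: "s \<in> real_resolvent" if "s \<in> ?A" for s
  proof (rule real_resolventI[of r])
    show "r > 0" using c by (simp add: r_def)
    fix x y assume xy: "(x, y) \<in> T"
    have "c * norm x \<le> norm ((y - s *\<^sub>R x) + (s - t) *\<^sub>R x)" using c(2)[OF xy] by (simp add: algebra_simps)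
    also have "\<dots> \<le> norm (y - s *\<^sub>R x) + \<bar>s - t\<bar> * norm x" by (metis norm_scaleR norm_triangle_ineq)
    also have "\<bar>s - t\<bar> * norm x \<le> r * norm x" using that by (intro mult_right_mono) auto
    finally show "r * norm x \<le> norm (y - s *\<^sub>R x)" by (simp add: r_def)
  qed
  have null: "E ?A x = 0" for x
  proof (rule projector_eq_0[OF T proj[OF A] graph_invariant_spectral[OF A]])
    have form: "\<bar>inner y w - t * (norm y)\<^sup>2\<bar> \<le> r * (norm y)\<^sup>2" if "(y, w) \<in> T" "E ?A y = y" for y w
      using form_upper[OF A _ that, of "t + r"] form_lower[OF A _ that, of "t - r"]
      by (simp add: abs_le_iff algebra_simps)
    fix y w assume y: "(y, w) \<in> T" "E ?A y = y"
    from reduced_norm_le[OF T proj[OF A] graph_invariant_spectral[OF A] form y]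
    have "norm (w - t *\<^sub>R y) \<le> r * norm y" .
    then have "c * norm y \<le> c / 2 * norm y" using c(2)[OF y(1)] by (simp add: r_def)
    then show "y = 0" using c(1) by (simp add: mult_le_0_iff)
  qed
  show thesis
  proof (rule that[of r])
    show "r > 0" using c(1) by (simp add: r_def)
    show "?A \<subseteq> real_resolvent" using near by blast
  qed (rule null)
qed

lemma open_real_resolvent: "open real_resolvent"
  unfolding open_contains_ball
proof
  fix t assume "t \<in> real_resolvent"
  then obtain r where "r > 0" "{t - r<..<t + r} \<subseteq> real_resolvent" using real_resolvent_neighbourhood by metis
  then show "\<exists>r>0. ball t r \<subseteq> real_resolvent" by (auto simp: ball_eq_greaterThanLessThan)
qed

lemma borel_real_resolvent: "real_resolvent \<in> sets borel"
  by (rule borel_open[OF open_real_resolvent])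

text \<open>Every point has a null neighbourhood, and countably many of these cover the set.\<close>

lemma spectral_projection_real_resolvent: "E real_resolvent x = 0"
proof -
  define \<F> where "\<F> = {U. open U \<and> U \<in> null_sets (scalar x)}"
  obtain \<F>' where F': "\<F>' \<subseteq> \<F>" "countable \<F>'" "\<Union>\<F>' = \<Union>\<F>"
    using Lindelof[of \<F>] by (auto simp: \<F>_def)
  have "real_resolvent \<subseteq> \<Union>\<F>"
  proof
    fix t assume "t \<in> real_resolvent"
    then obtain r where r: "r > 0" "\<And>x. E {t - r<..<t + r} x = 0" using real_resolvent_neighbourhood by metis
    then have "{t - r<..<t + r} \<in> \<F>" by (simp add: \<F>_def null_sets_def emeasure_scalar)
    then show "t \<in> \<Union>\<F>" using r(1) by (intro UnionI) auto
  qed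
  then have sub: "real_resolvent \<subseteq> \<Union>\<F>'" by (simp only: F'(3))
  have null: "\<Union>\<F>' \<in> null_sets (scalar x)"
    using null_sets_UN'[OF F'(2), of "\<lambda>U. U" "scalar x"] F'(1) by (auto simp: \<F>_def)
  have "real_resolvent \<in> null_sets (scalar x)"
    by (rule null_sets_subset[OF null _ sub]) (simp add: borel_real_resolvent)
  then show ?thesis by (simp add: null_sets_def emeasure_scalar[OF borel_real_resolvent])
qed

end

section \<open>A gap in the spectrum\<close>

locale spectral_gap = self_adjoint_operator T for T :: "'h::complex_hilbert_space operator" +
  fixes \<sigma>m \<sigma>p :: "real set" and \<mu> d :: real
  assumes spectrum: "spectrum T = complex_of_real ` (\<sigma>m \<union> \<sigma>p)" and d: "d > 0"
    and below: "s \<in> \<sigma>m \<Longrightarrow> s \<le> \<mu> - d" and above: "s \<in> \<sigma>p \<Longrightarrow> \<mu> + d \<le> s"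
begin

lemma real_resolvent_eq: "real_resolvent = - (\<sigma>m \<union> \<sigma>p)"
proof -
  have "t \<in> real_resolvent \<longleftrightarrow> complex_of_real t \<notin> spectrum T" for t
    by (simp add: real_resolvent_def spectrum_def)
  then show ?thesis by (auto simp: spectrum)
qed

lemma borel_parts: "\<sigma>m \<in> sets borel" "\<sigma>p \<in> sets borel"
proof -
  have "\<sigma>m = - real_resolvent \<inter> {..<\<mu>}" "\<sigma>p = - real_resolvent \<inter> {\<mu><..}"
    using below above d by (force simp: real_resolvent_eq)+
  moreover have "- real_resolvent \<in> sets borel" using borel_real_resolvent by (metis borel_comp)
  ultimately show "\<sigma>m \<in> sets borel" "\<sigma>p \<in> sets borel" by (metis greaterThan_borel lessThan_borel sets.Int)+
qed

lemma disjoint_parts: "\<sigma>m \<inter> \<sigma>p = {}"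
  using below above d by force

lemma parts_add: "E \<sigma>m x + E \<sigma>p x = x"
proof -
  have "E (\<sigma>m \<union> \<sigma>p) x = E (- real_resolvent) x" by (simp add: real_resolvent_eq)
  also have "\<dots> = x" by (simp add: Compl[OF borel_real_resolvent] spectral_projection_real_resolvent)
  finally show ?thesis by (simp add: Un_disjoint[OF borel_parts disjoint_parts])
qed

lemma Compl_part: "E (- \<sigma>p) x = E \<sigma>m x"
  using parts_add[of x] by (simp add: Compl[OF borel_parts(2)] algebra_simps)

text \<open>The two parts of the spectrum keep a positive distance from \<open>\<mu>\<close>, so \<open>J (T - \<mu>)\<close> is \<open>\<bar>T - \<mu>\<bar>\<close>.\<close>

definition J :: "'h \<Rightarrow> 'h" where
  "J x = E \<sigma>p x - E \<sigma>m x"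

lemma J_sign_operator: "J = sign_operator T \<sigma>m \<sigma>p"
  by (simp add: fun_eq_iff J_def sign_operator_def)

lemma symmetry_J: "symmetry J"
  unfolding symmetry_def
proof (intro conjI allI)
  note m = proj_sym[OF borel_parts(1)] and p = proj_sym[OF borel_parts(2)]
  show "symmetric_op J"
    using symmetric_op_combine[OF projectorD(1)[OF proj[OF borel_parts(2)]] projectorD(1)[OF proj[OF borel_parts(1)]],
        of 1 "-1"] by (simp add: J_def[abs_def])
  show "complex_linear J"
    using complex_lin[OF borel_parts(1)] complex_lin[OF borel_parts(2)]
    by (simp add: complex_linear_def J_def scaleC_diff_right)
  have "E \<sigma>m (E \<sigma>p x) = 0" "E \<sigma>p (E \<sigma>m x) = 0" for x
    using Int_disjoint[OF borel_parts disjoint_parts] Int_disjoint[OF borel_parts(2,1)] disjoint_parts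
    by (auto simp: Int_commute)
  then show "J (J x) = x" for x
    using parts_add[of x]
    by (simp add: J_def m p projectorD(2)[OF proj[OF borel_parts(1)]] projectorD(2)[OF proj[OF borel_parts(2)]] add.commute)
qed

lemma graph_invariant_J: "graph_invariant J T"
  using graph_invariant_spectral[OF borel_parts(1)] graph_invariant_spectral[OF borel_parts(2)] T_lin(6)
  by (auto simp: graph_invariant_def J_def)

lemma J_form_split:
  assumes xy: "(x, y) \<in> T"
  shows "inner (J x) (y - \<mu> *\<^sub>R x) = (inner (E \<sigma>p x) (E \<sigma>p y) - \<mu> * (norm (E \<sigma>p x))\<^sup>2)
    - (inner (E \<sigma>m x) (E \<sigma>m y) - \<mu> * (norm (E \<sigma>m x))\<^sup>2)"
proof -
  have e: "inner (E A x) (y - \<mu> *\<^sub>R x) = inner (E A x) (E A y) - \<mu> * (norm (E A x))\<^sup>2" if A: "A \<in> sets borel" for A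
  proof -
    have "inner (E A x) z = inner (E A x) (E A z)" for z
      using proj_sym(2)[OF A, of "E A x" z] by (simp add: projectorD(2)[OF proj[OF A]])
    from this[of y] this[of x] show ?thesis by (simp add: inner_diff_right power2_norm_eq_inner)
  qed
  show ?thesis by (simp add: J_def inner_diff_left e[OF borel_parts(1)] e[OF borel_parts(2)])
qed

lemma J_form_lower:
  assumes xy: "(x, y) \<in> T"
  shows "d * (norm x)\<^sup>2 \<le> inner (J x) (y - \<mu> *\<^sub>R x)"
proof -
  have xy': "(E A x, E A y) \<in> T" "E A (E A x) = E A x" if "A \<in> sets borel" for A
    using graph_invariantD[OF graph_invariant_spectral[OF that] xy] projectorD(2)[OF proj[OF that]] by auto
  have "(\<mu> + d) * (norm (E \<sigma>p x))\<^sup>2 \<le> inner (E \<sigma>p x) (E \<sigma>p y)"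
    by (rule form_lower[OF borel_parts(2) above xy'[OF borel_parts(2)]])
  moreover have "inner (E \<sigma>m x) (E \<sigma>m y) \<le> (\<mu> - d) * (norm (E \<sigma>m x))\<^sup>2"
    by (rule form_upper[OF borel_parts(1) below xy'[OF borel_parts(1)]])
  moreover have "(norm x)\<^sup>2 = (norm (E \<sigma>p x))\<^sup>2 + (norm (E \<sigma>m x))\<^sup>2"
    using projector_pythagoras[OF proj[OF borel_parts(2)], of x] Compl[OF borel_parts(2), of x] Compl_part[of x] by simp
  ultimately show ?thesis unfolding J_form_split[OF xy] by (simp add: algebra_simps)
qed

text \<open>Split along \<open>\<sigma>m\<close> and \<open>\<sigma>p\<close>, on which the sign of \<open>t - \<mu>\<close> is constant.\<close>

lemma J_form_eq_integral:
  assumes xy: "(x, y) \<in> T"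
  shows "inner (J x) (y - \<mu> *\<^sub>R x) = (\<integral>t. \<bar>t - \<mu>\<bar> \<partial>scalar x)"
proof -
  interpret finite_measure "scalar x" by (rule finite_scalar)
  have xy': "(E A x, E A y) \<in> T" "E A (E A x) = E A x" if "A \<in> sets borel" for A
    using graph_invariantD[OF graph_invariant_spectral[OF that] xy] projectorD(2)[OF proj[OF that]] by auto
  have restrict: "(\<integral>t. indicator A t * f t \<partial>scalar (E A x)) = (\<integral>t. f t \<partial>scalar (E A x))"
    if "A \<in> sets borel" "f \<in> borel_measurable borel" for A and f :: "real \<Rightarrow> real"
    using integral_scalar_restrict[OF that, of "E A x"] projectorD(2)[OF proj[OF that(1)], of x] by simp
  have "integrable (scalar x) (\<lambda>t. \<bar>t - \<mu>\<bar>)" using integrable_id[OF xy] by simp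
  from integrable_scalar_split[OF borel_parts(2) this]
  have "(\<integral>t. \<bar>t - \<mu>\<bar> \<partial>scalar x) = (\<integral>t. \<bar>t - \<mu>\<bar> \<partial>scalar (E \<sigma>p x)) + (\<integral>t. \<bar>t - \<mu>\<bar> \<partial>scalar (E \<sigma>m x))"
    by (simp add: Compl_part)
  also have "(\<integral>t. \<bar>t - \<mu>\<bar> \<partial>scalar (E \<sigma>p x)) = (\<integral>t. indicator \<sigma>p t * \<bar>t - \<mu>\<bar> \<partial>scalar (E \<sigma>p x))"
    by (rule restrict[OF borel_parts(2), symmetric]) measurable
  also have "\<dots> = (\<integral>t. indicator \<sigma>p t * (t - \<mu>) \<partial>scalar (E \<sigma>p x))"
    using above d by (intro Bochner_Integration.integral_cong) (force split: split_indicator)+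
  also have "\<dots> = inner (E \<sigma>p x) (E \<sigma>p y) - \<mu> * (norm (E \<sigma>p x))\<^sup>2"
    by (rule form_restrict(1)[OF borel_parts(2) xy'[OF borel_parts(2)], symmetric])
  also have "(\<integral>t. \<bar>t - \<mu>\<bar> \<partial>scalar (E \<sigma>m x)) = (\<integral>t. indicator \<sigma>m t * \<bar>t - \<mu>\<bar> \<partial>scalar (E \<sigma>m x))"
    by (rule restrict[OF borel_parts(1), symmetric]) measurable
  also have "\<dots> = (\<integral>t. - (indicator \<sigma>m t * (t - \<mu>)) \<partial>scalar (E \<sigma>m x))"
    using below d by (intro Bochner_Integration.integral_cong) (force split: split_indicator)+
  also have "\<dots> = - (inner (E \<sigma>m x) (E \<sigma>m y) - \<mu> * (norm (E \<sigma>m x))\<^sup>2)"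
    using form_restrict(1)[OF borel_parts(1) xy'[OF borel_parts(1)], of \<mu>] by simp
  finally show ?thesis unfolding J_form_split[OF xy] by simp
qed

text \<open>This witness for the functional calculus at \<open>t \<mapsto> \<bar>t - \<mu>\<bar>\<close> settles its existence. Whatever operator the choice
  in \<open>functional_calculus\<close> yields, it has the same form.\<close>

definition abs_graph :: "'h operator" where
  "abs_graph = {(x, J (y - \<mu> *\<^sub>R x)) | x y. (x, y) \<in> T}"

lemma is_spectral_integral_abs_graph:
  "is_spectral_integral E (\<lambda>t. \<bar>t - \<mu>\<bar>) abs_graph"
  unfolding is_spectral_integral_def
proof (intro conjI allI impI)
  note j = symmetric_opD[OF symmetryD(1)[OF symmetry_J]]
  show "linear_operator abs_graph"
    unfolding linear_operator_def
  proof (intro conjI allI impI)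
    show "(0, 0) \<in> abs_graph" unfolding abs_graph_def using T_lin(1) j(6) by force
    show "(x + x', y + y') \<in> abs_graph" if "(x, y) \<in> abs_graph" "(x', y') \<in> abs_graph" for x y x' y'
    proof -
      obtain w w' where w: "(x, w) \<in> T" "(x', w') \<in> T" "y = J (w - \<mu> *\<^sub>R x)" "y' = J (w' - \<mu> *\<^sub>R x')"
        using \<open>(x, y) \<in> abs_graph\<close> \<open>(x', y') \<in> abs_graph\<close> by (auto simp: abs_graph_def)
      have "y + y' = J ((w + w') - \<mu> *\<^sub>R (x + x'))"
        unfolding w j(3)[symmetric] by (rule arg_cong[of _ _ J]) (simp add: algebra_simps)
      then show ?thesis using T_lin(2)[OF w(1,2)] unfolding abs_graph_def by blast
    qed
    show "(c *\<^sub>C x, c *\<^sub>C y) \<in> abs_graph" if "(x, y) \<in> abs_graph" for c x y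
    proof -
      obtain w where w: "(x, w) \<in> T" "y = J (w - \<mu> *\<^sub>R x)"
        using \<open>(x, y) \<in> abs_graph\<close> by (auto simp: abs_graph_def)
      have "c *\<^sub>C y = J (c *\<^sub>C w - \<mu> *\<^sub>R (c *\<^sub>C x))"
        unfolding w symmetryD(2)[OF symmetry_J, symmetric] by (simp add: scaleC_diff_right scaleC_scaleR)
      then show ?thesis using T_lin(3)[OF w(1)] unfolding abs_graph_def by blast
    qed
    show "single_valued abs_graph"
      using T_lin(4) by (auto simp: single_valued_def abs_graph_def)
  qed
  have "integrable (scalar x) (\<lambda>t. t\<^sup>2) \<longleftrightarrow> integrable (scalar x) (\<lambda>t. \<bar>t - \<mu>\<bar>\<^sup>2)" for x
  proof -
    interpret finite_measure "scalar x" by (rule finite_scalar)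
    have bound: "integrable (scalar x) g" if f: "integrable (scalar x) f" and [measurable]: "g \<in> borel_measurable borel"
      and le: "\<And>t. \<bar>g t\<bar> \<le> 2 * f t + 2 * \<mu>\<^sup>2" for f g :: "real \<Rightarrow> real"
    proof (rule Bochner_Integration.integrable_bound)
      show "integrable (scalar x) (\<lambda>t. 2 * f t + 2 * \<mu>\<^sup>2)" using f by simp
      show "AE t in scalar x. norm (g t) \<le> norm (2 * f t + 2 * \<mu>\<^sup>2)"
        using le by (intro AE_I2) (smt (verit) real_norm_def)
    qed measurable
    have "(a + b)\<^sup>2 \<le> 2 * a\<^sup>2 + 2 * b\<^sup>2" for a b :: real
      using zero_le_power2[of "a - b"] by (simp add: power2_eq_square algebra_simps)
    from this[of _ "- \<mu>"] this[of "t - \<mu>" \<mu> for t] show ?thesis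
      by (intro iffI; elim bound) auto
  qed
  then show "Domain abs_graph = {x. integrable (scalar x) (\<lambda>t. \<bar>t - \<mu>\<bar>\<^sup>2)}"
    using Domain_iff unfolding abs_graph_def by blast
  fix x z assume "(x, z) \<in> abs_graph"
  then obtain y where y: "(x, y) \<in> T" "z = J (y - \<mu> *\<^sub>R x)" by (auto simp: abs_graph_def)
  have Jc: "cinner (J a) b = cinner a (J b)" for a b
    using symmetry_J by (auto simp: symmetry_def intro: cinner_symmetric_op)
  have "cinner y (J x) = cinner x (J y)"
    by (rule self_adjoint_cinner[OF T graph_invariantD[OF graph_invariant_J y(1)] y(1)])
  then have "cnj (cinner x (J y)) = cinner x (J y)" using cinner_commute[of y "J x"] Jc[of x y] by simp
  moreover have "cnj (cinner x (J x)) = cinner x (J x)" using cinner_commute[of x "J x"] Jc[of x x] by simp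
  moreover have "cinner x z = cinner x (J y) - complex_of_real \<mu> * cinner x (J x)"
  proof -
    have "J y = z + complex_of_real \<mu> *\<^sub>C J x" by (simp add: y(2) j scaleC_of_real)
    then show ?thesis by (simp add: cinner_add_right cinner_scaleC_right)
  qed
  ultimately have "cnj (cinner x z) = cinner x z" by simp
  then have "Im (cinner x z) = 0" by (metis Reals_cnj_iff complex_is_Real_iff)
  moreover have "Re (cinner x z) = (\<integral>t. \<bar>t - \<mu>\<bar> \<partial>scalar x)"
    by (simp only: Re_cinner y(2) j(2)[symmetric] J_form_eq_integral[OF y(1)])
  ultimately show "cinner x z = complex_of_real (\<integral>t. \<bar>t - \<mu>\<bar> \<partial>scalar x)" by (simp add: complex_eq_iff)
qed

lemma abs_shift_form:
  assumes xy: "(x, y) \<in> T"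
  shows "cinner x (app (abs_shift T \<mu>) x) = complex_of_real (inner (J x) (y - \<mu> *\<^sub>R x))"
proof -
  have ex: "\<exists>S. is_spectral_integral E (\<lambda>t. \<bar>t - \<mu>\<bar>) S" using is_spectral_integral_abs_graph by blast
  have S: "is_spectral_integral E (\<lambda>t. \<bar>t - \<mu>\<bar>) (abs_shift T \<mu>)"
    unfolding abs_shift_def functional_calculus_def by (rule someI_ex[OF ex])
  have "x \<in> Domain abs_graph" using xy by (auto simp: abs_graph_def)
  then have "x \<in> Domain (abs_shift T \<mu>)"
    using S is_spectral_integral_abs_graph by (simp add: is_spectral_integral_def)
  then obtain z where z: "(x, z) \<in> abs_shift T \<mu>" by blast
  have "app (abs_shift T \<mu>) x = z" using S z by (intro app_eq) (simp add: is_spectral_integral_def)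
  moreover have "cinner x z = complex_of_real (\<integral>t. \<bar>t - \<mu>\<bar> \<partial>scalar x)"
    using S z by (simp add: is_spectral_integral_def)
  ultimately show ?thesis by (simp add: J_form_eq_integral[OF xy])
qed

end

section \<open>Off-diagonal perturbations\<close>

locale off_diagonal_perturbation = spectral_gap A \<sigma>m \<sigma>p \<mu> d
  for A :: "'h::complex_hilbert_space operator" and \<sigma>m \<sigma>p \<mu> d +
  fixes V L :: "'h operator"
  assumes V: "symmetric V" and dom: "Domain A \<subseteq> Domain V"
    and off: "off_diagonal (spectral_projection A \<sigma>m) (spectral_projection A \<sigma>p) V"
    and L: "L = closure (op_add A V)" and sa_L: "self_adjoint L"
begin

lemmas J_sym = symmetric_opD[OF symmetryD(1)[OF symmetry_J]]

lemma cinner_J: "cinner (J x) y = cinner x (J y)"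
  using symmetry_J by (auto simp: symmetry_def intro: cinner_symmetric_op)

lemma V_lin: "linear_operator V"
  using V by (simp add: symmetric_def)

lemma range_orthogonal:
  assumes "B \<in> sets borel" "C \<in> sets borel" "B \<inter> C = {}" "a \<in> range (E B)" "b \<in> range (E C)"
  shows "cinner a b = 0"
proof -
  obtain a' b' where ab: "a = E B a'" "b = E C b'" using assms(4,5) by auto
  have "cinner a b = cinner a' (E B (E C b'))"
    unfolding ab by (rule cinner_symmetric_op[OF projectorD(1)[OF proj[OF assms(1)]] complex_lin[OF assms(1)]])
  then show ?thesis using cinner_scaleC_right[of a' 0 0] by (simp add: Int_disjoint[OF assms(1-3)])
qed

text \<open>Decompose \<open>x = x\<^sub>- + x\<^sub>+\<close>. As \<open>V\<close> exchanges the two subspaces, \<open>\<langle>J x, V x\<rangle> = \<langle>x\<^sub>+, V x\<^sub>-\<rangle> - \<langle>x\<^sub>-, V x\<^sub>+\<rangle>\<close>, and by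
  symmetry the two terms are conjugate to each other.\<close>

lemma V_form_imaginary:
  assumes x: "x \<in> Domain A" and xv: "(x, v) \<in> V"
  shows "Re (cinner (J x) v) = 0"
proof -
  let ?m = "E \<sigma>m x" and ?p = "E \<sigma>p x"
  have "?m \<in> Domain V" "?p \<in> Domain V"
    using dom Domain_restrict[OF borel_parts(1) x] Domain_restrict[OF borel_parts(2) x] by auto
  then obtain vm vp where vm: "(?m, vm) \<in> V" and vp: "(?p, vp) \<in> V" by blast
  have "(?m + ?p, vm + vp) \<in> V" by (rule linear_operatorD(2)[OF V_lin vm vp])
  then have v: "v = vm + vp" using linear_operatorD(4)[OF V_lin xv] by (simp add: parts_add)
  have ranges: "vm \<in> range (E \<sigma>p)" "vp \<in> range (E \<sigma>m)"
    using off vm vp unfolding off_diagonal_def by blast+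
  have dis: "\<sigma>p \<inter> \<sigma>m = {}" using disjoint_parts by blast
  have "cinner ?p vp = 0" by (rule range_orthogonal[OF borel_parts(2,1) dis _ ranges(2)]) simp
  moreover have "cinner ?m vm = 0"
    by (rule range_orthogonal[OF borel_parts disjoint_parts _ ranges(1)]) simp
  moreover have "cinner (J x) v = cinner ?p v - cinner ?m v"
    using cinner_add_left[of "J x" ?m v] by (simp add: J_def)
  moreover have "cinner vp ?m = cinner ?p vm"
    using V vm vp by (auto simp: symmetric_def op_adjoint_def)
  ultimately have "cinner (J x) v = cnj (cinner ?m vp) - cinner ?m vp"
    using cinner_commute[of vp ?m] by (simp add: v cinner_add_right)
  then show ?thesis by simp
qed

lemma J_graph_form:
  assumes "(x, y) \<in> A" "(x, v) \<in> V"
  shows "cinner (J x) (y + v - \<mu> *\<^sub>R x) =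
    Complex (inner (J x) (y - \<mu> *\<^sub>R x)) (Im (cinner (J x) v))"
proof -
  have "(x, J (y - \<mu> *\<^sub>R x)) \<in> abs_graph" using assms(1) by (auto simp: abs_graph_def)
  then have "cinner x (J (y - \<mu> *\<^sub>R x)) = complex_of_real (\<integral>t. \<bar>t - \<mu>\<bar> \<partial>scalar x)"
    using is_spectral_integral_abs_graph by (simp add: is_spectral_integral_def)
  then have "Im (cinner (J x) (y - \<mu> *\<^sub>R x)) = 0" by (simp add: cinner_J)
  moreover have "cinner (J x) (y + v - \<mu> *\<^sub>R x) = cinner (J x) (y - \<mu> *\<^sub>R x) + cinner (J x) v"
    by (simp add: cinner_add_right[symmetric] algebra_simps)
  moreover have "Re (cinner (J x) v) = 0" using V_form_imaginary assms by blast
  ultimately show ?thesis by (simp add: complex_eq_iff Re_cinner)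
qed

lemma L_approx:
  assumes "(x, w) \<in> L"
  obtains f g where "\<And>n. (f n, g n) \<in> op_add A V" "f \<longlonglongrightarrow> x" "g \<longlonglongrightarrow> w"
proof -
  have "(x, w) \<in> closure (op_add A V)" using assms by (simp add: L)
  then obtain h where h: "\<And>n. h n \<in> op_add A V" "h \<longlonglongrightarrow> (x, w)" by (auto simp: closure_sequential)
  have "(\<lambda>n. fst (h n)) \<longlonglongrightarrow> x" "(\<lambda>n. snd (h n)) \<longlonglongrightarrow> w"
    using tendsto_fst[OF h(2)] tendsto_snd[OF h(2)] by simp_all
  then show thesis using that[of "\<lambda>n. fst (h n)" "\<lambda>n. snd (h n)"] h(1) by simp
qed

lemma tendsto_J_form:
  assumes "f \<longlonglongrightarrow> x" "g \<longlonglongrightarrow> w"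
  shows "(\<lambda>n. cinner (J (f n)) (g n - \<mu> *\<^sub>R f n)) \<longlonglongrightarrow> cinner (J x) (w - \<mu> *\<^sub>R x)"
  by (intro tendsto_cinner bounded_linear.tendsto[OF J_sym(1)] tendsto_intros assms)

lemma L_form_lower:
  assumes "(x, w) \<in> L"
  shows "d * (norm x)\<^sup>2 \<le> Re (cinner (J x) (w - \<mu> *\<^sub>R x))"
proof -
  obtain f g where fg: "\<And>n. (f n, g n) \<in> op_add A V" "f \<longlonglongrightarrow> x" "g \<longlonglongrightarrow> w" using L_approx[OF assms] by blast
  show ?thesis
  proof (rule LIMSEQ_le)
    show "(\<lambda>n. d * (norm (f n))\<^sup>2) \<longlonglongrightarrow> d * (norm x)\<^sup>2" by (intro tendsto_intros fg)
    show "(\<lambda>n. Re (cinner (J (f n)) (g n - \<mu> *\<^sub>R f n))) \<longlonglongrightarrow> Re (cinner (J x) (w - \<mu> *\<^sub>R x))"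
      by (intro tendsto_Re tendsto_J_form fg)
    have "d * (norm (f n))\<^sup>2 \<le> Re (cinner (J (f n)) (g n - \<mu> *\<^sub>R f n))" for n
    proof -
      obtain y v where yv: "(f n, y) \<in> A" "(f n, v) \<in> V" "g n = y + v" using fg(1)[of n] by (auto simp: op_add_def)
      show ?thesis using J_form_lower[OF yv(1)] J_graph_form[OF yv(1,2)] by (simp add: yv(3))
    qed
    then show "\<exists>N. \<forall>n\<ge>N. d * (norm (f n))\<^sup>2 \<le> Re (cinner (J (f n)) (g n - \<mu> *\<^sub>R f n))" by blast
  qed
qed

text \<open>The contribution of the single point \<open>\<mu>\<close> to the infimum in \<open>kappa\<close>.\<close>

definition kappa_at :: ennreal where
  "kappa_at = (SUP x\<in>{x \<in> Domain A. norm x = 1}.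
     ennreal (cmod (cinner x (sign_operator A \<sigma>m \<sigma>p (app V x))) / Re (cinner x (app (abs_shift A \<mu>) x))))"

text \<open>The quotients are taken at unit vectors; both sides are homogeneous of degree two.\<close>

lemma graph_sector:
  assumes k: "0 \<le> k" "kappa_at \<le> ennreal k" and yv: "(x, y) \<in> A" "(x, v) \<in> V"
  shows "\<bar>Im (cinner (J x) v)\<bar> \<le> k * inner (J x) (y - \<mu> *\<^sub>R x)"
proof -
  have unit: "\<bar>Im (cinner (J x) v)\<bar> \<le> k * inner (J x) (y - \<mu> *\<^sub>R x)"
    if x: "norm x = 1" "(x, y) \<in> A" "(x, v) \<in> V" for x y v
  proof -
    define den where "den = inner (J x) (y - \<mu> *\<^sub>R x)"
    have "den > 0" using J_form_lower[OF x(2)] d x(1) by (simp add: den_def)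
    have xD: "x \<in> Domain A" using x(2) by blast
    have "app V x = v" by (rule app_eq[OF V_lin x(3)])
    then have "ennreal (cmod (cinner (J x) v) / den) \<le> kappa_at"
      unfolding kappa_at_def using x(1) xD
      by (intro SUP_upper2[of x]) (auto simp: abs_shift_form[OF x(2)] J_sign_operator[symmetric] cinner_J den_def)
    then have "ennreal (cmod (cinner (J x) v) / den) \<le> ennreal k" using k(2) by (rule order_trans)
    then have "cmod (cinner (J x) v) / den \<le> k" using k(1) by (simp add: ennreal_le_iff)
    then have "cmod (cinner (J x) v) \<le> k * den" using \<open>den > 0\<close> by (simp add: pos_divide_le_eq)
    then show ?thesis using abs_Im_le_cmod[of "cinner (J x) v"] by (simp add: den_def)
  qed
  show ?thesis
  proof (cases "x = 0")
    case True
    then show ?thesis using cinner_scaleC_left[of 0 0 v] by (simp add: J_sym)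
  next
    case False
    define r where "r = 1 / norm x"
    have r: "r > 0" "r * norm x = 1" using False by (auto simp: r_def)
    have "norm (r *\<^sub>R x) = 1" using r by simp
    from unit[OF this T_lin(5)[OF yv(1), of r] linear_operatorD(5)[OF V_lin yv(2), of r]]
    have "\<bar>Im (cinner (J (r *\<^sub>R x)) (r *\<^sub>R v))\<bar> \<le> k * inner (J (r *\<^sub>R x)) (r *\<^sub>R y - \<mu> *\<^sub>R (r *\<^sub>R x))" .
    moreover have "r *\<^sub>R y - \<mu> *\<^sub>R (r *\<^sub>R x) = r *\<^sub>R (y - \<mu> *\<^sub>R x)" by (simp add: algebra_simps)
    moreover have "Im (cinner (J (r *\<^sub>R x)) (r *\<^sub>R v)) = r * (r * Im (cinner (J x) v))"
      by (simp add: J_sym Im_cinner scaleC_scaleR)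
    ultimately have "r * (r * \<bar>Im (cinner (J x) v)\<bar>) \<le> r * (r * (k * inner (J x) (y - \<mu> *\<^sub>R x)))"
      using r(1) by (simp add: J_sym abs_mult algebra_simps)
    then show ?thesis using r(1) by simp
  qed
qed

lemma L_sector:
  assumes k: "0 \<le> k" "kappa_at \<le> ennreal k" and xw: "(x, w) \<in> L"
  shows "\<bar>Im (cinner (J x) (w - \<mu> *\<^sub>R x))\<bar> \<le> k * Re (cinner (J x) (w - \<mu> *\<^sub>R x))"
proof -
  obtain f g where fg: "\<And>n. (f n, g n) \<in> op_add A V" "f \<longlonglongrightarrow> x" "g \<longlonglongrightarrow> w" using L_approx[OF xw] by blast
  let ?q = "\<lambda>n. cinner (J (f n)) (g n - \<mu> *\<^sub>R f n)"
  show ?thesis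
  proof (rule LIMSEQ_le)
    show "(\<lambda>n. \<bar>Im (?q n)\<bar>) \<longlonglongrightarrow> \<bar>Im (cinner (J x) (w - \<mu> *\<^sub>R x))\<bar>"
      by (intro tendsto_rabs tendsto_Im tendsto_J_form fg)
    show "(\<lambda>n. k * Re (?q n)) \<longlonglongrightarrow> k * Re (cinner (J x) (w - \<mu> *\<^sub>R x))"
      by (intro tendsto_mult tendsto_const tendsto_Re tendsto_J_form fg)
    have "\<bar>Im (?q n)\<bar> \<le> k * Re (?q n)" for n
    proof -
      obtain y v where yv: "(f n, y) \<in> A" "(f n, v) \<in> V" "g n = y + v" using fg(1)[of n] by (auto simp: op_add_def)
      show ?thesis using graph_sector[OF k yv(1,2)] J_graph_form[OF yv(1,2)] by (simp add: yv(3))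
    qed
    then show "\<exists>N. \<forall>n\<ge>N. \<bar>Im (?q n)\<bar> \<le> k * Re (?q n)" by blast
  qed
qed

lemma norm_J: "norm (J x) = norm x"
proof -
  have "inner (J x) (J x) = inner x x" by (simp only: J_sym(2) symmetryD(3)[OF symmetry_J])
  then show ?thesis by (simp add: norm_eq_sqrt_inner)
qed

lemma L_lower:
  assumes "(x, w) \<in> L"
  shows "d * norm x \<le> norm (w - \<mu> *\<^sub>R x)"
proof (cases "x = 0")
  case False
  have "d * (norm x)\<^sup>2 \<le> norm (J x) * norm (w - \<mu> *\<^sub>R x)"
    using L_form_lower[OF assms] norm_cauchy_schwarz[of "J x" "w - \<mu> *\<^sub>R x"] by (simp add: Re_cinner)
  then have "norm x * (d * norm x) \<le> norm x * norm (w - \<mu> *\<^sub>R x)"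
    by (simp add: norm_J power2_eq_square algebra_simps)
  then show ?thesis using False by simp
qed simp

lemma \<mu>_resolvent_L: "complex_of_real \<mu> \<in> resolvent_set L"
proof -
  interpret L: self_adjoint_operator L by unfold_locales (rule sa_L)
  show ?thesis using L.real_resolventI[OF d L_lower] by (simp add: L.real_resolvent_def)
qed

text \<open>The operator \<open>R = \<bar>L - \<mu>\<bar>\<^sup>-\<^sup>1\<close> is bounded although \<open>\<bar>L - \<mu>\<bar>\<close> need not be; it carries the sector
  condition for \<open>J (L - \<mu>) = J Q \<bar>L - \<mu>\<bar>\<close> over to the form \<open>\<langle>R y, J Q y\<rangle>\<close> on the whole space.\<close>

lemma projection_difference:
  assumes gap: "spectral_gap L \<tau>m \<tau>p \<mu> d"
  shows "norm (spectral_projection L \<tau>m y - spectral_projection A \<sigma>m y) \<le> sin (pi / 4) * norm y"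
    and "0 \<le> k \<Longrightarrow> kappa_at \<le> ennreal k \<Longrightarrow>
      norm (spectral_projection L \<tau>m y - spectral_projection A \<sigma>m y) \<le> sin (arctan k / 2) * norm y"
proof -
  interpret L: spectral_gap L \<tau>m \<tau>p \<mu> d by fact
  define Q where "Q = L.J"
  note Q = L.symmetry_J[folded Q_def]
  note q = symmetric_opD[OF symmetryD(1)[OF Q]]
  note Linv = L.graph_invariant_J[folded Q_def]
  obtain G where G: "bounded_linear G" "\<And>x w. (x, w) \<in> L \<Longrightarrow> G (w - \<mu> *\<^sub>R x) = x"
    "\<And>y. (G y, y + \<mu> *\<^sub>R G y) \<in> L"
    using \<mu>_resolvent_L unfolding resolvent_set_def by (auto simp: scaleC_of_real)
  have GQ: "G (Q y) = Q (G y)" for y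
  proof -
    have "(Q (G y), Q (y + \<mu> *\<^sub>R G y)) \<in> L" by (rule graph_invariantD[OF Linv G(3)])
    from G(2)[OF this] show ?thesis by (simp add: q)
  qed
  have Gsym: "inner (G x) y = inner x (G y)" for x y
    using self_adjoint_inner[OF sa_L G(3)[of y] G(3)[of x]] by (simp add: inner_add_left inner_add_right)
  define R where "R = (\<lambda>y. Q (G y))"
  have R: "positive_op R"
    unfolding positive_op_def symmetric_op_def
  proof (intro conjI allI)
    show "bounded_linear R" unfolding R_def by (rule bounded_linear_compose[OF q(1) G(1)])
    show "inner (R x) y = inner x (R y)" for x y by (simp only: R_def q(2) Gsym GQ)
    show "0 \<le> inner y (R y)" for y
    proof -
      have "d * (norm (G y))\<^sup>2 \<le> inner (Q (G y)) (y + \<mu> *\<^sub>R G y - \<mu> *\<^sub>R G y)"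
        unfolding Q_def by (rule L.J_form_lower[OF G(3)])
      moreover have "0 \<le> d * (norm (G y))\<^sup>2" using d by simp
      ultimately show ?thesis by (simp add: R_def inner_commute)
    qed
  qed
  have inj: "y = 0" if "R y = 0" for y
  proof -
    have "Q (R y) = G y" by (simp add: R_def symmetryD(3)[OF Q])
    then have "G y = 0" using that by (simp add: q)
    then have "(0, y) \<in> L" using G(3)[of y] by simp
    then show ?thesis using L.T_lin(1,4) by blast
  qed
  have Rgraph: "(R y, Q y + \<mu> *\<^sub>R R y) \<in> L" for y
    using G(3)[of "Q y"] by (simp add: R_def GQ)
  have form: "cinner (J (R y)) (Q y + \<mu> *\<^sub>R R y - \<mu> *\<^sub>R R y) = cinner (R y) (J (Q y))" for y
    by (simp add: cinner_J)
  have accr: "0 \<le> Re (cinner (R y) (J (Q y)))" for y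
  proof -
    have "0 \<le> d * (norm (R y))\<^sup>2" using d by simp
    also have "\<dots> \<le> Re (cinner (R y) (J (Q y)))" using L_form_lower[OF Rgraph, of y] by (simp only: form)
    finally show ?thesis .
  qed
  have diff: "spectral_projection L \<tau>m y - spectral_projection A \<sigma>m y = (1/2) *\<^sub>R (J y - Q y)" for y
  proof -
    have "J y = y - 2 *\<^sub>R E \<sigma>m y" using parts_add[of y] by (simp add: J_def scaleR_2 algebra_simps)
    moreover have "Q y = y - 2 *\<^sub>R L.E \<tau>m y" using L.parts_add[of y] by (simp add: Q_def L.J_def scaleR_2 algebra_simps)
    ultimately show ?thesis by (simp add: scaleR_diff_right)
  qed
  have bound: "norm (spectral_projection L \<tau>m y - spectral_projection A \<sigma>m y) \<le> sin (\<theta> / 2) * norm y"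
    if "0 \<le> \<theta>" "\<theta> \<le> pi" "cos \<theta> * (norm y)\<^sup>2 \<le> inner y (J (Q y))" for \<theta>
    using symmetry_difference_norm[OF symmetry_J Q that] by (simp add: diff)
  have "0 \<le> Re (1 * cinner y (J (Q y)))"
    using accr by (intro symmetry_product_accretive[OF symmetry_J Q _ R inj]) auto
  then show "norm (spectral_projection L \<tau>m y - spectral_projection A \<sigma>m y) \<le> sin (pi / 4) * norm y"
    using bound[of "pi / 2"] by (simp add: Re_cinner)
  assume k: "0 \<le> k" "kappa_at \<le> ennreal k"
  have "\<bar>Im (cinner (R y) (J (Q y)))\<bar> \<le> k * Re (cinner (R y) (J (Q y)))" for y
    using L_sector[OF k Rgraph, of y] by (simp only: form)
  from symmetry_product_sector[OF symmetry_J Q k(1) R inj this accr]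
  have "cos (arctan k) * (norm y)\<^sup>2 \<le> inner y (J (Q y))" .
  moreover have "0 \<le> arctan k" "arctan k \<le> pi" using k(1) arctan_ubound[of k] pi_gt_zero by (simp, linarith)
  ultimately show "norm (spectral_projection L \<tau>m y - spectral_projection A \<sigma>m y) \<le> sin (arctan k / 2) * norm y"
    using bound by blast
qed

end

lemma gap_distance:
  assumes "esup S < ereal \<mu>" "ereal \<mu> < einf U"
  obtains d where "d > 0" "esup S \<le> ereal (\<mu> - d)" "ereal (\<mu> + d) \<le> einf U"
proof -
  obtain a where a: "esup S < ereal a" "ereal a < ereal \<mu>" using ereal_dense2[OF assms(1)] by blast
  obtain b where b: "ereal \<mu> < ereal b" "ereal b < einf U" using ereal_dense2[OF assms(2)] by blast
  define d where "d = min (\<mu> - a) (b - \<mu>)"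
  have d: "d > 0" "ereal a \<le> ereal (\<mu> - d)" "ereal (\<mu> + d) \<le> ereal b" using a(2) b(1) by (auto simp: d_def)
  show thesis
  proof (rule that[OF d(1)])
    show "esup S \<le> ereal (\<mu> - d)" using a(1) d(2) by (meson less_imp_le order_trans)
    show "ereal (\<mu> + d) \<le> einf U" using b(2) d(3) by (meson less_imp_le order_trans)
  qed
qed

text \<open>For a finite infimum \<open>k\<close> every \<open>k + 1/n\<close> exceeds some \<open>K i\<close>, and \<open>sin (arctan k / 2)\<close> depends continuously on
  \<open>k\<close>. An infinite infimum corresponds to \<open>arctan \<infinity> = \<pi>/2\<close>.\<close>

lemma arctan_ext_INF_bound:
  assumes infinite: "b \<le> sin (pi / 4) * c" and "0 \<le> c"
    and finite: "\<And>i k. i \<in> I \<Longrightarrow> 0 \<le> k \<Longrightarrow> K i \<le> ennreal k \<Longrightarrow> b \<le> sin (arctan k / 2) * c"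
  shows "b \<le> sin (arctan_ext (INF i\<in>I. K i) / 2) * c"
proof (cases "(INF i\<in>I. K i) = \<infinity>")
  case True
  then show ?thesis using infinite by (simp add: arctan_ext_def)
next
  case False
  then obtain k where k: "0 \<le> k" "(INF i\<in>I. K i) = ennreal k"
    by (cases "INF i\<in>I. K i") auto
  have "b \<le> sin (arctan (k + inverse (real (Suc n))) / 2) * c" for n
  proof -
    have "(INF i\<in>I. K i) < ennreal (k + inverse (real (Suc n)))"
      unfolding k(2) using k(1) by (simp add: ennreal_less_iff)
    then obtain i where "i \<in> I" "K i < ennreal (k + inverse (real (Suc n)))" by (auto simp: INF_less_iff)
    then show ?thesis using k(1) by (intro finite) auto
  qed
  moreover have "(\<lambda>n. sin (arctan (k + inverse (real (Suc n))) / 2) * c) \<longlonglongrightarrow> sin (arctan (k + 0) / 2) * c"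
    by (intro tendsto_intros LIMSEQ_inverse_real_of_nat) simp
  ultimately have "b \<le> sin (arctan (k + 0) / 2) * c" by (intro LIMSEQ_le_const) auto
  then show ?thesis using k by (simp add: arctan_ext_def)
qed

theorem theorem1:
  fixes A V L :: "'h::complex_hilbert_space operator"
    and \<sigma>m \<sigma>p :: "real set"
  assumes "self_adjoint A"
    and "spectrum A = complex_of_real ` (\<sigma>m \<union> \<sigma>p)"
    and "esup \<sigma>m < einf \<sigma>p"
    and "symmetric V"
    and "Domain A \<subseteq> Domain V"
    and "off_diagonal (spectral_projection A \<sigma>m) (spectral_projection A \<sigma>p) V"
    and "L = closure (op_add A V)"
    and "self_adjoint L"
  shows "\<exists>\<sigma>m' \<sigma>p' :: real set.
    spectrum L = complex_of_real ` (\<sigma>m' \<union> \<sigma>p') \<and>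
    esup \<sigma>m' < einf \<sigma>p' \<and>
    (\<forall>s\<in>\<sigma>m'. ereal s \<le> esup \<sigma>m) \<and>
    (\<forall>s\<in>\<sigma>p'. einf \<sigma>p \<le> ereal s) \<and>
    onorm (\<lambda>x. spectral_projection L \<sigma>m' x - spectral_projection A \<sigma>m x)
      \<le> sin (arctan_ext (kappa A V \<sigma>m \<sigma>p) / 2)"
proof -
  define gap where "gap = {\<mu>::real. esup \<sigma>m < ereal \<mu> \<and> ereal \<mu> < einf \<sigma>p}"
  define \<tau>m where "\<tau>m = {s. complex_of_real s \<in> spectrum L \<and> ereal s \<le> esup \<sigma>m}"
  define \<tau>p where "\<tau>p = {s. complex_of_real s \<in> spectrum L \<and> einf \<sigma>p \<le> ereal s}"
  have lower: "esup \<tau>m \<le> esup \<sigma>m" and upper: "einf \<sigma>p \<le> einf \<tau>p"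
    unfolding esup_def[of \<tau>m] einf_def[of \<tau>p] by (auto simp: \<tau>m_def \<tau>p_def intro: SUP_least INF_greatest)
  have perturbation: "\<exists>d. off_diagonal_perturbation A \<sigma>m \<sigma>p \<mu> d V L \<and> d > 0 \<and>
    esup \<sigma>m \<le> ereal (\<mu> - d) \<and> ereal (\<mu> + d) \<le> einf \<sigma>p" if "\<mu> \<in> gap" for \<mu>
  proof -
    have "esup \<sigma>m < ereal \<mu>" "ereal \<mu> < einf \<sigma>p" using that by (auto simp: gap_def)
    from gap_distance[OF this] obtain d where
      d: "d > 0" "esup \<sigma>m \<le> ereal (\<mu> - d)" "ereal (\<mu> + d) \<le> einf \<sigma>p" by blast
    have "off_diagonal_perturbation A \<sigma>m \<sigma>p \<mu> d V L"
    proof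
      show "s \<le> \<mu> - d" if "s \<in> \<sigma>m" for s
        using SUP_upper[OF that, of ereal] d(2) unfolding esup_def by (metis ereal_less_eq(3) order_trans)
      show "\<mu> + d \<le> s" if "s \<in> \<sigma>p" for s
        using INF_lower[OF that, of ereal] d(3) unfolding einf_def by (metis ereal_less_eq(3) order_trans)
    qed (use assms d(1) in auto)
    then show ?thesis using d by blast
  qed
  have spectrum: "spectrum L = complex_of_real ` (\<tau>m \<union> \<tau>p)"
  proof (intro set_eqI iffI)
    fix z assume z: "z \<in> spectrum L"
    then have "Im z = 0" by (rule spectrum_real[OF assms(8)])
    then have z_eq: "z = complex_of_real (Re z)" by (simp add: complex_eq_iff)
    have "Re z \<notin> gap"
    proof
      assume "Re z \<in> gap"
      then obtain d where "off_diagonal_perturbation A \<sigma>m \<sigma>p (Re z) d V L" using perturbation by blast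
      from off_diagonal_perturbation.\<mu>_resolvent_L[OF this] show False
        using z z_eq by (simp add: spectrum_def)
    qed
    then have "Re z \<in> \<tau>m \<union> \<tau>p" using z z_eq by (auto simp: gap_def \<tau>m_def \<tau>p_def not_less)
    then show "z \<in> complex_of_real ` (\<tau>m \<union> \<tau>p)" using z_eq by (rule rev_image_eqI)
  qed (auto simp: \<tau>m_def \<tau>p_def)
  have gap_L: "spectral_gap L \<tau>m \<tau>p \<mu> d"
    if "esup \<sigma>m \<le> ereal (\<mu> - d)" "ereal (\<mu> + d) \<le> einf \<sigma>p" "d > 0" for \<mu> d
  proof
    show "s \<le> \<mu> - d" if "s \<in> \<tau>m" for s
    proof -
      have "ereal s \<le> esup \<sigma>m" using that by (simp add: \<tau>m_def)
      also have "\<dots> \<le> ereal (\<mu> - d)" by fact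
      finally show ?thesis by simp
    qed
    show "\<mu> + d \<le> s" if "s \<in> \<tau>p" for s
    proof -
      have "ereal (\<mu> + d) \<le> einf \<sigma>p" by fact
      also have "\<dots> \<le> ereal s" using that by (simp add: \<tau>p_def)
      finally show ?thesis by simp
    qed
  qed (use assms(8) spectrum that in auto)
  let ?D = "\<lambda>x. spectral_projection L \<tau>m x - spectral_projection A \<sigma>m x"
  define K where "K \<mu> = (SUP x\<in>{x \<in> Domain A. norm x = 1}.
     ennreal (cmod (cinner x (sign_operator A \<sigma>m \<sigma>p (app V x))) / Re (cinner x (app (abs_shift A \<mu>) x))))" for \<mu>
  have pointwise: "norm (?D x) \<le> sin (arctan_ext (kappa A V \<sigma>m \<sigma>p) / 2) * norm x" for x
  proof -
    have kappa_eq: "kappa A V \<sigma>m \<sigma>p = (INF \<mu>\<in>gap. K \<mu>)" by (simp add: kappa_def gap_def K_def)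
    have bounds: "norm (?D x) \<le> sin (pi / 4) * norm x \<and>
      (\<forall>k. 0 \<le> k \<longrightarrow> K \<mu> \<le> ennreal k \<longrightarrow> norm (?D x) \<le> sin (arctan k / 2) * norm x)" if "\<mu> \<in> gap" for \<mu>
    proof -
      obtain d where P: "off_diagonal_perturbation A \<sigma>m \<sigma>p \<mu> d V L"
        and d: "d > 0" "esup \<sigma>m \<le> ereal (\<mu> - d)" "ereal (\<mu> + d) \<le> einf \<sigma>p" using perturbation[OF \<open>\<mu> \<in> gap\<close>] by blast
      have "K \<mu> = off_diagonal_perturbation.kappa_at A \<sigma>m \<sigma>p \<mu> V"
        by (simp add: K_def off_diagonal_perturbation.kappa_at_def[OF P])
      then show ?thesis using off_diagonal_perturbation.projection_difference[OF P gap_L[OF d(2,3,1)]] by metis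
    qed
    obtain \<mu> where "\<mu> \<in> gap" using ereal_dense2[OF assms(3)] by (auto simp: gap_def)
    then have "norm (?D x) \<le> sin (pi / 4) * norm x" using bounds by blast
    then show ?thesis unfolding kappa_eq using bounds by (intro arctan_ext_INF_bound) auto
  qed
  have "onorm ?D \<le> sin (arctan_ext (kappa A V \<sigma>m \<sigma>p) / 2)"
  proof (rule onorm_bound[OF _ pointwise])
    have "0 \<le> arctan_ext k / 2 \<and> arctan_ext k / 2 \<le> pi" for k
      using arctan_ubound[of "enn2real k"] pi_gt_zero unfolding arctan_ext_def
      by (auto intro: order_trans[of _ "pi / 2"] simp: less_imp_le)
    then show "0 \<le> sin (arctan_ext (kappa A V \<sigma>m \<sigma>p) / 2)" by (intro sin_ge_zero) auto
  qed
  moreover have "esup \<tau>m < einf \<tau>p"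
    using le_less_trans[OF lower assms(3)] upper by (rule less_le_trans)
  moreover have "\<forall>s\<in>\<tau>m. ereal s \<le> esup \<sigma>m" "\<forall>s\<in>\<tau>p. einf \<sigma>p \<le> ereal s"
    by (simp_all add: \<tau>m_def \<tau>p_def)
  ultimately show ?thesis using spectrum by blast
qed

end
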